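(* Let $z_0=(t_0,x_0)$ and $L_{x_1}=\{(t,x_1):t\in\mathbb{R}\}$ be, respectively, a point and a line in a standard stationary spacetime $(\mathbb{R}\times S,g)$ with Fermat metric $F$ and reverse Fermat metric $\tilde F$. Then $z_0$ can be joined with $L_{x_1}$ by means of a future-pointing (resp. past-pointing) lightlike pregeodesic $t\mapsto\gamma(t)=(t,x_\gamma(t))$ (resp. $t\mapsto\gamma(t)=(2t_0-t,x_\gamma(t))$) starting at $z_0$ if and only if $x_\gamma$ is a unit speed geodesic of $F$ (resp. $\tilde F$) which joins $x_0$ with $x_1$. In this case, if $(t_1,x_1)$ is the point at which $\gamma$ reaches $L_{x_1}$, the interval of time $t_1-t_0$ (resp. $t_0-t_1$) is equal to the length of the curve $x_\gamma(t)$, $t\in[t_0,t_1]$ (resp. $t\in[t_0,2t_0-t_1]$), computed with $F$ (resp. $\tilde F$).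
   Context: Standard stationary spacetime: $S$ is a smooth connected (paracompact) manifold, $\pi:\mathbb{R}\times S\to S$ and $t:\mathbb{R}\times S\to\mathbb{R}$ are the projections, and $g=-(\beta\circ\pi)\,dt^2+\pi^*\omega\otimes dt+dt\otimes\pi^*\omega+\pi^*g_0$, where $g_0$ is a Riemannian metric, $\omega$ a smooth $1$-form and $\beta$ a smooth positive function on $S$; the time-orientation makes $\partial_t$ future-pointing. Fermat metric: the Finsler metric on $S$ given by $F(v)=\frac{1}{\beta}\omega(v)+\sqrt{\frac{1}{\beta}g_0(v,v)+\frac{1}{\beta^2}\omega(v)^2}$, $v\in TS$; its reverse metric is $\tilde F(v)=F(-v)$. The length of a curve $x$ computed with $F$ is $\int F(\dot x)\,ds$. Geodesics of a Finsler metric are the constant speed critical points of its energy functional $\int F^2(\dot x)\,ds$ with fixed endpoints. A pregeodesic is a curve which becomes a geodesic after a reparametrization. A curve is lightlike if its velocity $v$ is everywhere nonzero with $g(v,v)=0$. *)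

theory Defs
  imports "HOL-Analysis.Analysis"
begin

section \<open>Smoothness in normed spaces\<close>

text \<open>The derivative is taken within \<open>X\<close>, so that the same notion serves open sets, compact
  intervals and products of both (one-sided derivatives at boundary points). For the sets used
  below this derivative is unique, and since the domain is finite-dimensional, continuity of
  \<open>f' x v\<close> for every fixed \<open>v\<close> is continuity of \<open>f'\<close>.\<close>

primrec Ck_on :: "nat \<Rightarrow> 'a::euclidean_space set \<Rightarrow> ('a \<Rightarrow> 'b::real_normed_vector) \<Rightarrow> bool" where
  "Ck_on 0 X f \<longleftrightarrow> continuous_on X f"
| "Ck_on (Suc k) X f \<longleftrightarrow>
     (\<exists>f'. (\<forall>x\<in>X. (f has_derivative f' x) (at x within X)) \<and> (\<forall>v. Ck_on k X (\<lambda>x. f' x v)))"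

definition smooth_on :: "'a::euclidean_space set \<Rightarrow> ('a \<Rightarrow> 'b::real_normed_vector) \<Rightarrow> bool" where
  "smooth_on X f \<longleftrightarrow> (\<forall>k. Ck_on k X f)"


section \<open>Smooth manifolds\<close>

definition paracompact_space :: "'a topology \<Rightarrow> bool" where
  "paracompact_space T \<longleftrightarrow>
     (\<forall>\<U>. (\<forall>U\<in>\<U>. openin T U) \<and> \<Union>\<U> = topspace T \<longrightarrow>
       (\<exists>\<V>. (\<forall>V\<in>\<V>. openin T V) \<and> \<Union>\<V> = topspace T \<and>
            (\<forall>V\<in>\<V>. \<exists>U\<in>\<U>. V \<subseteq> U) \<and> locally_finite_in T \<V>))"

text \<open>The values of \<open>cmap\<close> outside \<open>cdom\<close> are irrelevant.\<close>

datatype ('a, 'e) chart = Chart (cdom: "'a set") (cmap: "'a \<Rightarrow> 'e")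

abbreviation cimage :: "('a, 'e) chart \<Rightarrow> 'e set" where
  "cimage c \<equiv> cmap c ` cdom c"

definition cinv :: "('a, 'e) chart \<Rightarrow> 'e \<Rightarrow> 'a" where
  "cinv c = inv_into (cdom c) (cmap c)"

text \<open>The smooth structure is given by an atlas, not required to be maximal.\<close>

definition smooth_manifold :: "'a topology \<Rightarrow> ('a, 'e::euclidean_space) chart set \<Rightarrow> bool" where
  "smooth_manifold T A \<longleftrightarrow>
     Hausdorff_space T \<and> paracompact_space T \<and>
     (\<Union>c\<in>A. cdom c) = topspace T \<and>
     (\<forall>c\<in>A. openin T (cdom c) \<and> open (cimage c) \<and>
        homeomorphic_map (subtopology T (cdom c)) (top_of_set (cimage c)) (cmap c)) \<and>
     (\<forall>c\<in>A. \<forall>d\<in>A. smooth_on (cmap c ` (cdom c \<inter> cdom d)) (cmap d \<circ> cinv c))"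

definition smooth_function :: "('a, 'e::euclidean_space) chart set \<Rightarrow> ('a \<Rightarrow> real) \<Rightarrow> bool" where
  "smooth_function A f \<longleftrightarrow> (\<forall>c\<in>A. smooth_on (cimage c) (f \<circ> cinv c))"

definition smooth_into ::
  "'a topology \<Rightarrow> ('a, 'e::euclidean_space) chart set \<Rightarrow> 'x::euclidean_space set \<Rightarrow> ('x \<Rightarrow> 'a) \<Rightarrow> bool"
  where
  "smooth_into T A X f \<longleftrightarrow>
     continuous_map (top_of_set X) T f \<and>
     (\<forall>c\<in>A. smooth_on {s\<in>X. f s \<in> cdom c} (cmap c \<circ> f))"


section \<open>Tangent vectors\<close>

text \<open>A tangent vector is its base point together with its components in every chart of the
  atlas around that point, related by the derivatives of the transition maps; the components are
  set to \<open>0\<close> for all other charts. By \<open>coord_vec A c p v\<close> we denote the vector at \<open>p\<close> with components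
  \<open>v\<close> in the chart \<open>c\<close>; the tangent space at \<open>p\<close> is the range of \<open>coord_vec A c p\<close>, for any
  chart \<open>c\<close> around \<open>p\<close>.\<close>

type_synonym ('a, 'e) tvec = "'a \<times> (('a, 'e) chart \<Rightarrow> 'e)"

definition coord_vec ::
  "('a, 'e::euclidean_space) chart set \<Rightarrow> ('a, 'e) chart \<Rightarrow> 'a \<Rightarrow> 'e \<Rightarrow> ('a, 'e) tvec" where
  "coord_vec A c p v =
     (p, \<lambda>d. if d \<in> A \<and> p \<in> cdom d
             then frechet_derivative (cmap d \<circ> cinv c) (at (cmap c p)) v else 0)"

definition tneg :: "('a, 'e::euclidean_space) tvec \<Rightarrow> ('a, 'e) tvec" where
  "tneg V = (fst V, \<lambda>c. - snd V c)"

definition tzero :: "'a \<Rightarrow> ('a, 'e::euclidean_space) tvec" where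
  "tzero p = (p, \<lambda>c. 0)"

definition velocity ::
  "('a, 'e::euclidean_space) chart set \<Rightarrow> real set \<Rightarrow> (real \<Rightarrow> 'a) \<Rightarrow> real \<Rightarrow> ('a, 'e) tvec" where
  "velocity A I x s =
     (x s, \<lambda>d. if d \<in> A \<and> x s \<in> cdom d
               then vector_derivative (cmap d \<circ> x) (at s within I) else 0)"

definition chart_at :: "('a, 'e) chart set \<Rightarrow> 'a \<Rightarrow> ('a, 'e) chart" where
  "chart_at A p = (SOME c. c \<in> A \<and> p \<in> cdom c)"

text \<open>Differentials of maps between manifolds and of real functions; the chart used at the
  base point does not matter.\<close>

definition tangent_map ::
  "('a, 'e::euclidean_space) chart set \<Rightarrow> ('b, 'f::euclidean_space) chart set \<Rightarrow> ('a \<Rightarrow> 'b) \<Rightarrow>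
     ('a, 'e) tvec \<Rightarrow> ('b, 'f) tvec" where
  "tangent_map A B f V =
     (let c = chart_at A (fst V) in
       (f (fst V), \<lambda>d. if d \<in> B \<and> f (fst V) \<in> cdom d
          then frechet_derivative (cmap d \<circ> f \<circ> cinv c) (at (cmap c (fst V))) (snd V c) else 0))"

definition differential ::
  "('a, 'e::euclidean_space) chart set \<Rightarrow> ('a \<Rightarrow> real) \<Rightarrow> ('a, 'e) tvec \<Rightarrow> real" where
  "differential A f V =
     (let c = chart_at A (fst V) in
       frechet_derivative (f \<circ> cinv c) (at (cmap c (fst V))) (snd V c))"


section \<open>One-forms and metrics\<close>

definition smooth_one_form ::
  "('a, 'e::euclidean_space) chart set \<Rightarrow> (('a, 'e) tvec \<Rightarrow> real) \<Rightarrow> bool" where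
  "smooth_one_form A \<omega> \<longleftrightarrow>
     (\<forall>c\<in>A. (\<forall>p\<in>cdom c. linear (\<lambda>v. \<omega> (coord_vec A c p v))) \<and>
            (\<forall>v. smooth_on (cimage c) (\<lambda>u. \<omega> (coord_vec A c (cinv c u) v))))"

definition metric_rep ::
  "('a, 'e::euclidean_space) chart set \<Rightarrow> (('a, 'e) tvec \<Rightarrow> ('a, 'e) tvec \<Rightarrow> real) \<Rightarrow>
     ('a, 'e) chart \<Rightarrow> 'e \<Rightarrow> 'e \<Rightarrow> 'e \<Rightarrow> real" where
  "metric_rep A g c u v w = g (coord_vec A c (cinv c u) v) (coord_vec A c (cinv c u) w)"

definition riemannian_metric ::
  "('a, 'e::euclidean_space) chart set \<Rightarrow> (('a, 'e) tvec \<Rightarrow> ('a, 'e) tvec \<Rightarrow> real) \<Rightarrow> bool" where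
  "riemannian_metric A g \<longleftrightarrow>
     (\<forall>c\<in>A.
        (\<forall>u\<in>cimage c.
           (\<forall>v. linear (metric_rep A g c u v)) \<and>
           (\<forall>v w. metric_rep A g c u v w = metric_rep A g c u w v) \<and>
           (\<forall>v. v \<noteq> 0 \<longrightarrow> metric_rep A g c u v v > 0)) \<and>
        (\<forall>v w. smooth_on (cimage c) (\<lambda>u. metric_rep A g c u v w)))"


section \<open>Geodesics of a pseudo-Riemannian metric\<close>

text \<open>The covariant derivative of the (constant) coordinate field \<open>w\<close> in the direction \<open>v\<close> for the
  Levi-Civita connection, in the chart \<open>c\<close>, given by the Koszul formula.\<close>

definition christoffel ::
  "('a, 'e::euclidean_space) chart set \<Rightarrow> (('a, 'e) tvec \<Rightarrow> ('a, 'e) tvec \<Rightarrow> real) \<Rightarrow>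
     ('a, 'e) chart \<Rightarrow> 'e \<Rightarrow> 'e \<Rightarrow> 'e \<Rightarrow> 'e" where
  "christoffel A g c u v w =
     (THE a. \<forall>z. 2 * metric_rep A g c u a z =
          frechet_derivative (\<lambda>q. metric_rep A g c q w z) (at u) v
        + frechet_derivative (\<lambda>q. metric_rep A g c q v z) (at u) w
        - frechet_derivative (\<lambda>q. metric_rep A g c q v w) (at u) z)"

definition metric_geodesic ::
  "'a topology \<Rightarrow> ('a, 'e::euclidean_space) chart set \<Rightarrow> (('a, 'e) tvec \<Rightarrow> ('a, 'e) tvec \<Rightarrow> real) \<Rightarrow>
     real \<Rightarrow> real \<Rightarrow> (real \<Rightarrow> 'a) \<Rightarrow> bool" where
  "metric_geodesic T A g a b \<gamma> \<longleftrightarrow>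
     a < b \<and> smooth_into T A {a..b} \<gamma> \<and>
     (\<forall>c\<in>A. \<forall>s\<in>{a..b}. \<gamma> s \<in> cdom c \<longrightarrow>
        (let y = (\<lambda>r. vector_derivative (cmap c \<circ> \<gamma>) (at r within {a..b})) in
          vector_derivative y (at s within {a..b})
            + christoffel A g c (cmap c (\<gamma> s)) (y s) (y s) = 0))"

text \<open>\<open>G a b \<gamma>\<close> stands for ``\<open>\<gamma>\<close>, restricted to \<open>[a,b]\<close>, is a geodesic''.\<close>

definition pregeodesic ::
  "(real \<Rightarrow> real \<Rightarrow> (real \<Rightarrow> 'a) \<Rightarrow> bool) \<Rightarrow> real \<Rightarrow> real \<Rightarrow> (real \<Rightarrow> 'a) \<Rightarrow> bool" where
  "pregeodesic G a b \<gamma> \<longleftrightarrow>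
     (\<exists>a' b' h. a' < b' \<and> bij_betw h {a'..b'} {a..b} \<and> smooth_on {a'..b'} h \<and>
        (\<forall>s\<in>{a'..b'}. vector_derivative h (at s within {a'..b'}) \<noteq> 0) \<and>
        G a' b' (\<gamma> \<circ> h))"


section \<open>Geodesics of a Finsler metric\<close>

definition finsler_length ::
  "('a, 'e::euclidean_space) chart set \<Rightarrow> (('a, 'e) tvec \<Rightarrow> real) \<Rightarrow>
     real \<Rightarrow> real \<Rightarrow> (real \<Rightarrow> 'a) \<Rightarrow> real" where
  "finsler_length A F a b x = integral {a..b} (\<lambda>s. F (velocity A {a..b} x s))"

definition finsler_energy ::
  "('a, 'e::euclidean_space) chart set \<Rightarrow> (('a, 'e) tvec \<Rightarrow> real) \<Rightarrow>
     real \<Rightarrow> real \<Rightarrow> (real \<Rightarrow> 'a) \<Rightarrow> real" where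
  "finsler_energy A F a b x = integral {a..b} (\<lambda>s. (F (velocity A {a..b} x s))\<^sup>2)"

definition fixed_end_variation ::
  "'a topology \<Rightarrow> ('a, 'e::euclidean_space) chart set \<Rightarrow> real \<Rightarrow> real \<Rightarrow> (real \<Rightarrow> 'a) \<Rightarrow>
     real \<Rightarrow> (real \<times> real \<Rightarrow> 'a) \<Rightarrow> bool" where
  "fixed_end_variation T A a b x \<delta> H \<longleftrightarrow>
     \<delta> > 0 \<and> smooth_into T A ({-\<delta><..<\<delta>} \<times> {a..b}) H \<and>
     (\<forall>s\<in>{a..b}. H (0, s) = x s) \<and>
     (\<forall>\<epsilon>\<in>{-\<delta><..<\<delta>}. H (\<epsilon>, a) = x a \<and> H (\<epsilon>, b) = x b)"

definition energy_critical ::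
  "'a topology \<Rightarrow> ('a, 'e::euclidean_space) chart set \<Rightarrow> (('a, 'e) tvec \<Rightarrow> real) \<Rightarrow>
     real \<Rightarrow> real \<Rightarrow> (real \<Rightarrow> 'a) \<Rightarrow> bool" where
  "energy_critical T A F a b x \<longleftrightarrow>
     (\<forall>\<delta> H. fixed_end_variation T A a b x \<delta> H \<longrightarrow>
        ((\<lambda>\<epsilon>. finsler_energy A F a b (\<lambda>s. H (\<epsilon>, s))) has_real_derivative 0) (at 0))"

definition finsler_geodesic ::
  "'a topology \<Rightarrow> ('a, 'e::euclidean_space) chart set \<Rightarrow> (('a, 'e) tvec \<Rightarrow> real) \<Rightarrow>
     real \<Rightarrow> real \<Rightarrow> (real \<Rightarrow> 'a) \<Rightarrow> bool" where
  "finsler_geodesic T A F a b x \<longleftrightarrow>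
     a < b \<and> smooth_into T A {a..b} x \<and>
     (\<exists>k. \<forall>s\<in>{a..b}. F (velocity A {a..b} x s) = k) \<and>
     energy_critical T A F a b x"

definition unit_speed_geodesic ::
  "'a topology \<Rightarrow> ('a, 'e::euclidean_space) chart set \<Rightarrow> (('a, 'e) tvec \<Rightarrow> real) \<Rightarrow>
     real \<Rightarrow> real \<Rightarrow> (real \<Rightarrow> 'a) \<Rightarrow> bool" where
  "unit_speed_geodesic T A F a b x \<longleftrightarrow>
     finsler_geodesic T A F a b x \<and> (\<forall>s\<in>{a..b}. F (velocity A {a..b} x s) = 1)"

definition fermat_metric ::
  "('a \<Rightarrow> real) \<Rightarrow> (('a, 'e::euclidean_space) tvec \<Rightarrow> real) \<Rightarrow>
     (('a, 'e) tvec \<Rightarrow> ('a, 'e) tvec \<Rightarrow> real) \<Rightarrow> ('a, 'e) tvec \<Rightarrow> real" where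
  "fermat_metric \<beta> \<omega> g\<^sub>0 V =
     1 / \<beta> (fst V) * \<omega> V
       + sqrt (1 / \<beta> (fst V) * g\<^sub>0 V V + 1 / (\<beta> (fst V))\<^sup>2 * (\<omega> V)\<^sup>2)"

definition reverse_metric ::
  "(('a, 'e::euclidean_space) tvec \<Rightarrow> real) \<Rightarrow> ('a, 'e) tvec \<Rightarrow> real" where
  "reverse_metric F V = F (tneg V)"


section \<open>Standard stationary spacetimes\<close>

text \<open>The product manifold of the real line and \<open>S\<close>; the projections are \<open>t = fst\<close> and
  \<open>\<pi> = snd\<close>.\<close>

definition line_product :: "'a topology \<Rightarrow> (real \<times> 'a) topology" where
  "line_product S = prod_topology euclideanreal S"

definition line_product_chart :: "('a, 'e) chart \<Rightarrow> (real \<times> 'a, real \<times> 'e) chart" where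
  "line_product_chart c = Chart (UNIV \<times> cdom c) (\<lambda>(t, p). (t, cmap c p))"

definition line_product_atlas ::
  "('a, 'e) chart set \<Rightarrow> (real \<times> 'a, real \<times> 'e) chart set" where
  "line_product_atlas A = line_product_chart ` A"

definition stationary_metric ::
  "('a, 'e::euclidean_space) chart set \<Rightarrow> ('a \<Rightarrow> real) \<Rightarrow> (('a, 'e) tvec \<Rightarrow> real) \<Rightarrow>
     (('a, 'e) tvec \<Rightarrow> ('a, 'e) tvec \<Rightarrow> real) \<Rightarrow>
     (real \<times> 'a, real \<times> 'e) tvec \<Rightarrow> (real \<times> 'a, real \<times> 'e) tvec \<Rightarrow> real" where
  "stationary_metric A \<beta> \<omega> g\<^sub>0 V W =
     (let dt = differential (line_product_atlas A) fst;
          d\<pi> = tangent_map (line_product_atlas A) A snd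
      in - \<beta> (snd (fst V)) * dt V * dt W + \<omega> (d\<pi> V) * dt W + dt V * \<omega> (d\<pi> W)
           + g\<^sub>0 (d\<pi> V) (d\<pi> W))"

definition time_field ::
  "('a, 'e::euclidean_space) chart set \<Rightarrow> real \<times> 'a \<Rightarrow> (real \<times> 'a, real \<times> 'e) tvec" where
  "time_field A z = velocity (line_product_atlas A) UNIV (\<lambda>s. (s, snd z)) (fst z)"

text \<open>A nonzero causal vector lies in the same (resp. opposite) causal cone as the timelike vector
  \<open>\<partial>\<^sub>t\<close> iff its product with \<open>\<partial>\<^sub>t\<close> is negative (resp. positive).\<close>

definition future_pointing ::
  "('a, 'e::euclidean_space) chart set \<Rightarrow>
     ((real \<times> 'a, real \<times> 'e) tvec \<Rightarrow> (real \<times> 'a, real \<times> 'e) tvec \<Rightarrow> real) \<Rightarrow>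
     (real \<times> 'a, real \<times> 'e) tvec \<Rightarrow> bool" where
  "future_pointing A g V \<longleftrightarrow>
     V \<noteq> tzero (fst V) \<and> g V V \<le> 0 \<and> g V (time_field A (fst V)) < 0"

definition past_pointing ::
  "('a, 'e::euclidean_space) chart set \<Rightarrow>
     ((real \<times> 'a, real \<times> 'e) tvec \<Rightarrow> (real \<times> 'a, real \<times> 'e) tvec \<Rightarrow> real) \<Rightarrow>
     (real \<times> 'a, real \<times> 'e) tvec \<Rightarrow> bool" where
  "past_pointing A g V \<longleftrightarrow>
     V \<noteq> tzero (fst V) \<and> g V V \<le> 0 \<and> g V (time_field A (fst V)) > 0"

definition lightlike_curve ::
  "('a, 'e::euclidean_space) chart set \<Rightarrow> (('a, 'e) tvec \<Rightarrow> ('a, 'e) tvec \<Rightarrow> real) \<Rightarrow>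
     real \<Rightarrow> real \<Rightarrow> (real \<Rightarrow> 'a) \<Rightarrow> bool" where
  "lightlike_curve A g a b \<gamma> \<longleftrightarrow>
     (\<forall>s\<in>{a..b}. let V = velocity A {a..b} \<gamma> s in V \<noteq> tzero (\<gamma> s) \<and> g V V = 0)"

definition lightlike_pregeodesic ::
  "'a topology \<Rightarrow> ('a, 'e::euclidean_space) chart set \<Rightarrow>
     ((real \<times> 'a, real \<times> 'e) tvec \<Rightarrow> (real \<times> 'a, real \<times> 'e) tvec \<Rightarrow> real) \<Rightarrow>
     real \<Rightarrow> real \<Rightarrow> (real \<Rightarrow> real \<times> 'a) \<Rightarrow> bool" where
  "lightlike_pregeodesic S A g a b \<gamma> \<longleftrightarrow>
     a < b \<and> smooth_into (line_product S) (line_product_atlas A) {a..b} \<gamma> \<and>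
     lightlike_curve (line_product_atlas A) g a b \<gamma> \<and>
     pregeodesic (metric_geodesic (line_product S) (line_product_atlas A) g) a b \<gamma>"

definition future_lightlike_pregeodesic ::
  "'a topology \<Rightarrow> ('a, 'e::euclidean_space) chart set \<Rightarrow>
     ((real \<times> 'a, real \<times> 'e) tvec \<Rightarrow> (real \<times> 'a, real \<times> 'e) tvec \<Rightarrow> real) \<Rightarrow>
     real \<Rightarrow> real \<Rightarrow> (real \<Rightarrow> real \<times> 'a) \<Rightarrow> bool" where
  "future_lightlike_pregeodesic S A g a b \<gamma> \<longleftrightarrow>
     lightlike_pregeodesic S A g a b \<gamma> \<and>
     (\<forall>s\<in>{a..b}. future_pointing A g (velocity (line_product_atlas A) {a..b} \<gamma> s))"

definition past_lightlike_pregeodesic ::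
  "'a topology \<Rightarrow> ('a, 'e::euclidean_space) chart set \<Rightarrow>
     ((real \<times> 'a, real \<times> 'e) tvec \<Rightarrow> (real \<times> 'a, real \<times> 'e) tvec \<Rightarrow> real) \<Rightarrow>
     real \<Rightarrow> real \<Rightarrow> (real \<Rightarrow> real \<times> 'a) \<Rightarrow> bool" where
  "past_lightlike_pregeodesic S A g a b \<gamma> \<longleftrightarrow>
     lightlike_pregeodesic S A g a b \<gamma> \<and>
     (\<forall>s\<in>{a..b}. past_pointing A g (velocity (line_product_atlas A) {a..b} \<gamma> s))"

definition time_line :: "'a \<Rightarrow> (real \<times> 'a) set" where
  "time_line p = {(t, p) | t. True}"

end

theory Submission
  imports Defs
begin

text \<open>Future-pointing and past-pointing curves are treated together as \<open>\<gamma>(t) = (k + \<sigma> t, x(t))\<close> with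
  \<open>\<sigma> = 1\<close> or \<open>\<sigma> = -1\<close>, where \<open>F(v)\<close> stands for the Fermat metric of \<open>\<sigma> v\<close>. Since \<open>F\<close> is a root of the
  quadratic equation \<open>\<beta> F\<^sup>2 = 2 \<sigma> \<omega>(v) F + g\<^sub>0(v, v)\<close>, the curve \<open>x\<close> has unit speed iff \<open>\<gamma>\<close> is lightlike
  and \<open>D = \<beta> - \<sigma> \<omega>(x')\<close> is positive, and the sign of \<open>D\<close> is the time-orientation of \<open>\<gamma>\<close>. The spacetime
  metric does not depend on \<open>t\<close>, so the time component of the geodesic equation of \<open>\<gamma> \<circ> h\<close> is the
  conservation law \<open>h' D = const\<close>. It can be solved for \<open>h\<close>, and modulo this law the space components
  are, pointwise in every chart, the Euler-Lagrange equations of \<open>F\<close> for \<open>x\<close>.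

  The Euler-Lagrange equations are equivalent to criticality of the energy by the first variation
  formula. There the momentum paired with the variation field is expressed by \<open>\<omega>\<close> and \<open>g\<^sub>0\<close> directly,
  hence independently of charts, so the integration by parts needs no partition of the
  interval.\<close>

section \<open>Calculus of iterated differentiability\<close>

text \<open>Two features of the definitions shape the work. A derivative in \<open>Ck_on\<close> is
  an existential witness that may change with the order and with the set; it becomes a definite
  object only where the derivative within the set is unique, hence the class \<open>spread\<close>
  of domains. And F is merely continuous at zero vectors, so the energy of a variation is not
  obviously differentiable; compactness of the interval keeps F close to 1, and with it the
  velocities nonzero, for small parameters.

  The value of the derivative of F is never computed from the square root. It comes from the
  quadratic equation by implicit differentiation, and this is where the denominator D arises. The
  square of D in the residual has its origin in the quotient rule for the momentum. Of the solutions
  of the conservation law the one with constant 1 is taken, so that h is the inverse of a primitive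
  of D.\<close>

lemma Ck_on_SucI:
  assumes "\<And>x. x \<in> X \<Longrightarrow> (f has_derivative f' x) (at x within X)"
    and "\<And>v. Ck_on k X (\<lambda>x. f' x v)"
  shows "Ck_on (Suc k) X f"
  unfolding Ck_on.simps using assms by blast

lemma Ck_on_SucE:
  assumes "Ck_on (Suc k) X f"
  obtains f' where "\<And>x. x \<in> X \<Longrightarrow> (f has_derivative f' x) (at x within X)"
    and "\<And>v. Ck_on k X (\<lambda>x. f' x v)"
  using assms unfolding Ck_on.simps by blast

lemma Ck_on_transform:
  assumes "Ck_on k X f" and eq: "\<And>x. x \<in> X \<Longrightarrow> g x = f x"
  shows "Ck_on k X g"
proof (cases k)
  case 0
  then show ?thesis using assms by (simp cong: continuous_on_cong)
next
  case (Suc n)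
  then obtain f' where f': "\<And>x. x \<in> X \<Longrightarrow> (f has_derivative f' x) (at x within X)"
      "\<And>v. Ck_on n X (\<lambda>x. f' x v)" using assms(1) Ck_on_SucE by blast
  show ?thesis unfolding Suc
    by (rule Ck_on_SucI[OF has_derivative_transform[OF _ eq f'(1)] f'(2)])
qed

lemma Ck_on_subset: "Ck_on k X f \<Longrightarrow> Y \<subseteq> X \<Longrightarrow> Ck_on k Y f"
proof (induction k arbitrary: f)
  case 0
  then show ?case by (auto intro: continuous_on_subset)
next
  case (Suc k)
  then obtain f' where f': "\<And>x. x \<in> X \<Longrightarrow> (f has_derivative f' x) (at x within X)"
      "\<And>v. Ck_on k X (\<lambda>x. f' x v)" using Ck_on_SucE by blast
  have "(f has_derivative f' x) (at x within Y)" if "x \<in> Y" for x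
    using f'(1) that Suc.prems(2) has_derivative_subset by blast
  then show ?case by (rule Ck_on_SucI[OF _ Suc.IH[OF f'(2) Suc.prems(2)]])
qed

text \<open>The product and chain rules rest on this: there an undifferentiated factor, known to
  order k + 1, meets an induction hypothesis of order k.\<close>

lemma Ck_on_SucD: "Ck_on (Suc k) X f \<Longrightarrow> Ck_on k X f"
proof (induction k arbitrary: f)
  case 0
  then show ?case by (auto intro: has_derivative_continuous_on)
next
  case (Suc k)
  then obtain f' where f': "\<And>x. x \<in> X \<Longrightarrow> (f has_derivative f' x) (at x within X)"
      "\<And>v. Ck_on (Suc k) X (\<lambda>x. f' x v)" using Ck_on_SucE by blast
  show ?case by (rule Ck_on_SucI[OF f'(1) Suc.IH[OF f'(2)]])
qed

lemma Ck_on_const: "Ck_on k X (\<lambda>x. c)"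
proof (induction k arbitrary: c)
  case (Suc k)
  show ?case by (rule Ck_on_SucI[OF has_derivative_const Suc])
qed simp

lemma Ck_on_linear_compose:
  assumes "bounded_linear L"
  shows "Ck_on k X f \<Longrightarrow> Ck_on k X (\<lambda>x. L (f x))"
proof (induction k arbitrary: f)
  case 0
  then show ?case using assms by (simp add: bounded_linear.continuous_on)
next
  case (Suc k)
  then obtain f' where f': "\<And>x. x \<in> X \<Longrightarrow> (f has_derivative f' x) (at x within X)"
      "\<And>v. Ck_on k X (\<lambda>x. f' x v)" using Ck_on_SucE by blast
  show ?case
    by (rule Ck_on_SucI[OF bounded_linear.has_derivative[OF assms f'(1)] Suc.IH[OF f'(2)]])
qed

lemma Ck_on_linear:
  assumes "bounded_linear L"
  shows "Ck_on k X L"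
proof (cases k)
  case 0
  then show ?thesis using assms by (simp add: linear_continuous_on)
next
  case (Suc n)
  show ?thesis unfolding Suc
    by (rule Ck_on_SucI[OF bounded_linear_imp_has_derivative[OF assms] Ck_on_const])
qed

lemma Ck_on_add:
  "Ck_on k X f \<Longrightarrow> Ck_on k X g \<Longrightarrow> Ck_on k X (\<lambda>x. f x + g x)"
proof (induction k arbitrary: f g)
  case 0
  then show ?case by (auto intro: continuous_on_add)
next
  case (Suc k)
  obtain f' where f': "\<And>x. x \<in> X \<Longrightarrow> (f has_derivative f' x) (at x within X)"
      "\<And>v. Ck_on k X (\<lambda>x. f' x v)" using Suc.prems(1) Ck_on_SucE by blast
  obtain g' where g': "\<And>x. x \<in> X \<Longrightarrow> (g has_derivative g' x) (at x within X)"
      "\<And>v. Ck_on k X (\<lambda>x. g' x v)" using Suc.prems(2) Ck_on_SucE by blast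
  show ?case by (rule Ck_on_SucI[OF has_derivative_add[OF f'(1) g'(1)] Suc.IH[OF f'(2) g'(2)]])
qed

lemma Ck_on_sum:
  "(\<And>i. i \<in> I \<Longrightarrow> Ck_on k X (f i)) \<Longrightarrow> Ck_on k X (\<lambda>x. \<Sum>i\<in>I. f i x)"
  by (induction I rule: infinite_finite_induct) (simp_all add: Ck_on_add Ck_on_const)

lemma Ck_on_bilinear:
  assumes "bounded_bilinear B"
  shows "Ck_on k X f \<Longrightarrow> Ck_on k X g \<Longrightarrow> Ck_on k X (\<lambda>x. B (f x) (g x))"
proof (induction k arbitrary: f g)
  case 0
  then show ?case using bounded_bilinear.continuous_on[OF assms] by simp
next
  case (Suc k)
  obtain f' where f': "\<And>x. x \<in> X \<Longrightarrow> (f has_derivative f' x) (at x within X)"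
      "\<And>v. Ck_on k X (\<lambda>x. f' x v)" using Suc.prems(1) Ck_on_SucE by blast
  obtain g' where g': "\<And>x. x \<in> X \<Longrightarrow> (g has_derivative g' x) (at x within X)"
      "\<And>v. Ck_on k X (\<lambda>x. g' x v)" using Suc.prems(2) Ck_on_SucE by blast
  show ?case
    by (rule Ck_on_SucI[OF bounded_bilinear.FDERIV[OF assms f'(1) g'(1)]
        Ck_on_add[OF Suc.IH[OF Ck_on_SucD[OF Suc.prems(1)] g'(2)]
          Suc.IH[OF f'(2) Ck_on_SucD[OF Suc.prems(2)]]]])
qed

lemmas Ck_on_scaleR = Ck_on_bilinear[OF bounded_bilinear_scaleR]
lemmas Ck_on_mult = Ck_on_bilinear[OF bounded_bilinear_mult]
lemmas Ck_on_minus = Ck_on_linear_compose[OF bounded_linear_minus[OF bounded_linear_ident]]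

lemma Ck_on_diff:
  "Ck_on k X f \<Longrightarrow> Ck_on k X g \<Longrightarrow> Ck_on k X (\<lambda>x. f x - g x)"
  using Ck_on_add[of k X f "\<lambda>x. - g x"] Ck_on_minus[of k X g] by simp

lemma Ck_on_compose:
  fixes f :: "'a::euclidean_space \<Rightarrow> 'b::euclidean_space" and g :: "'b \<Rightarrow> 'c::real_normed_vector"
  shows "Ck_on k X f \<Longrightarrow> f ` X \<subseteq> Y \<Longrightarrow> Ck_on k Y g \<Longrightarrow> Ck_on k X (\<lambda>x. g (f x))"
proof (induction k arbitrary: f g)
  case 0
  show ?case using continuous_on_compose2[OF _ _ 0(2)] 0(1,3) unfolding Ck_on.simps by blast
next
  case (Suc k)
  obtain f' where f': "\<And>x. x \<in> X \<Longrightarrow> (f has_derivative f' x) (at x within X)"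
      "\<And>v. Ck_on k X (\<lambda>x. f' x v)" using Suc.prems(1) Ck_on_SucE by blast
  obtain g' where g': "\<And>y. y \<in> Y \<Longrightarrow> (g has_derivative g' y) (at y within Y)"
      "\<And>v. Ck_on k Y (\<lambda>y. g' y v)" using Suc.prems(3) Ck_on_SucE by blast
  have deriv: "((\<lambda>x. g (f x)) has_derivative (\<lambda>v. g' (f x) (f' x v))) (at x within X)"
    if "x \<in> X" for x
    using has_derivative_in_compose2[OF g'(1) Suc.prems(2) that f'(1)[OF that]] .
  \<comment> \<open>The direction \<open>f' x v\<close> moves with x, whereas \<open>Ck_on\<close>
    controls \<open>g'\<close> only in fixed directions. Expanding in the basis leaves finitely many
    fixed directions with scalar coefficients.\<close>
  have "Ck_on k X (\<lambda>x. \<Sum>b\<in>Basis. (f' x v \<bullet> b) *\<^sub>R g' (f x) b)" for v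
    by (intro Ck_on_sum Ck_on_scaleR Ck_on_linear_compose[OF bounded_linear_inner_left] f'(2)
        Suc.IH[OF Ck_on_SucD[OF Suc.prems(1)] Suc.prems(2) g'(2)])
  moreover have "g' (f x) (f' x v) = (\<Sum>b\<in>Basis. (f' x v \<bullet> b) *\<^sub>R g' (f x) b)" if "x \<in> X" for x v
  proof -
    have "linear (g' (f x))" using g'(1) that Suc.prems(2) has_derivative_linear by blast
    then have "g' (f x) (\<Sum>b\<in>Basis. (f' x v \<bullet> b) *\<^sub>R b) = (\<Sum>b\<in>Basis. (f' x v \<bullet> b) *\<^sub>R g' (f x) b)"
      by (simp add: linear_sum linear_scale)
    then show ?thesis by (simp add: euclidean_representation)
  qed
  ultimately have "Ck_on k X (\<lambda>x. g' (f x) (f' x v))" for v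
    by (rule Ck_on_transform)
  then show ?case by (intro Ck_on_SucI[OF deriv])
qed

lemma Ck_on_Pair:
  assumes "Ck_on k X f" "Ck_on k X g"
  shows "Ck_on k X (\<lambda>x. (f x, g x))"
proof -
  have "bounded_linear (\<lambda>x. (x, 0))" "bounded_linear (\<lambda>x. (0, x))"
    by (auto intro!: bounded_linear_Pair bounded_linear_ident bounded_linear_zero)
  from Ck_on_linear_compose[OF this(1) assms(1)] Ck_on_linear_compose[OF this(2) assms(2)]
  have "Ck_on k X (\<lambda>x. (f x, 0) + (0, g x))" by (rule Ck_on_add)
  then show ?thesis by simp
qed

text \<open>The derivative is a polynomial in the function itself, so the induction hypothesis and
  the product rule suffice.\<close>

lemma Ck_on_inverse_real: "Ck_on k {0<..} (inverse :: real \<Rightarrow> real)"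
proof (induction k)
  case 0
  then show ?case by (auto intro!: continuous_intros)
next
  case (Suc k)
  have "(inverse has_derivative (\<lambda>v. - (inverse x * v * inverse x))) (at x within {0<..})"
    if "x \<in> {0<..}" for x :: real
    using that by (intro has_derivative_inverse') auto
  then show ?case
    by (rule Ck_on_SucI[OF _ Ck_on_minus[OF Ck_on_mult[OF Ck_on_mult[OF Suc Ck_on_const] Suc]]])
qed

text \<open>The induction closes because the derivative is half the reciprocal of the square root,
  the induction hypothesis composed with the inverse.\<close>

lemma Ck_on_sqrt: "Ck_on k {0<..} sqrt"
proof (induction k)
  case 0
  then show ?case by (auto intro!: continuous_intros)
next
  case (Suc k)
  show ?case
  proof (rule Ck_on_SucI)
    show "(sqrt has_derivative (*) (inverse (sqrt x) / 2)) (at x within {0<..})"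
      if "x \<in> {0<..}" for x :: real
      using DERIV_real_sqrt[of x] that unfolding has_field_derivative_def
      by (simp add: has_derivative_at_withinI)
    have "Ck_on k {0<..} (\<lambda>x. inverse (sqrt x) * (1/2) * v)" for v :: real
      by (intro Ck_on_mult Ck_on_const Ck_on_compose[OF Suc _ Ck_on_inverse_real]) auto
    then show "Ck_on k {0<..} (\<lambda>x. inverse (sqrt x) / 2 * v)" for v :: real by simp
  qed
qed

section \<open>Closure properties of smooth maps\<close>

lemma smooth_on_transform: "smooth_on X f \<Longrightarrow> (\<And>x. x \<in> X \<Longrightarrow> g x = f x) \<Longrightarrow> smooth_on X g"
  unfolding smooth_on_def using Ck_on_transform by blast

lemma smooth_on_subset: "smooth_on X f \<Longrightarrow> Y \<subseteq> X \<Longrightarrow> smooth_on Y f"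
  unfolding smooth_on_def using Ck_on_subset by blast

lemma smooth_on_compose:
  fixes f :: "'a::euclidean_space \<Rightarrow> 'b::euclidean_space"
  shows "smooth_on Y g \<Longrightarrow> smooth_on X f \<Longrightarrow> f ` X \<subseteq> Y \<Longrightarrow> smooth_on X (\<lambda>x. g (f x))"
  unfolding smooth_on_def using Ck_on_compose by blast

lemma smooth_on_imp_continuous_on: "smooth_on X f \<Longrightarrow> continuous_on X f"
  unfolding smooth_on_def by (metis Ck_on.simps(1))

lemma smooth_on_const: "smooth_on X (\<lambda>x. c)"
  and smooth_on_linear: "bounded_linear L \<Longrightarrow> smooth_on X L"
  and smooth_on_linear_compose: "bounded_linear L' \<Longrightarrow> smooth_on X u \<Longrightarrow> smooth_on X (\<lambda>x. L' (u x))"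
  and smooth_on_add: "smooth_on X f \<Longrightarrow> smooth_on X g \<Longrightarrow> smooth_on X (\<lambda>x. f x + g x)"
  and smooth_on_diff: "smooth_on X f \<Longrightarrow> smooth_on X g \<Longrightarrow> smooth_on X (\<lambda>x. f x - g x)"
  and smooth_on_sum: "(\<And>i. i \<in> I \<Longrightarrow> smooth_on X (F i)) \<Longrightarrow> smooth_on X (\<lambda>x. \<Sum>i\<in>I. F i x)"
  and smooth_on_scaleR: "smooth_on X r \<Longrightarrow> smooth_on X f \<Longrightarrow> smooth_on X (\<lambda>x. r x *\<^sub>R f x)"
  and smooth_on_Pair: "smooth_on X p \<Longrightarrow> smooth_on X q \<Longrightarrow> smooth_on X (\<lambda>x. (p x, q x))"
  unfolding smooth_on_def
  by (simp_all add: Ck_on_const Ck_on_linear Ck_on_linear_compose Ck_on_add Ck_on_diff Ck_on_sum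
      Ck_on_scaleR Ck_on_Pair)

lemma smooth_on_mult:
  fixes f g :: "'a::euclidean_space \<Rightarrow> real"
  shows "smooth_on X f \<Longrightarrow> smooth_on X g \<Longrightarrow> smooth_on X (\<lambda>x. f x * g x)"
  using smooth_on_scaleR[of X f g] by simp

lemma smooth_on_divide:
  fixes f g :: "'a::euclidean_space \<Rightarrow> real"
  assumes "smooth_on X f" "smooth_on X g" "\<And>x. x \<in> X \<Longrightarrow> g x > 0"
  shows "smooth_on X (\<lambda>x. f x / g x)"
proof -
  have "smooth_on {0<..} (inverse :: real \<Rightarrow> real)"
    using Ck_on_inverse_real by (auto simp: smooth_on_def)
  then have "smooth_on X (\<lambda>x. f x * inverse (g x))"
    using assms by (intro smooth_on_mult smooth_on_compose[of "{0<..}" inverse X g]) auto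
  then show ?thesis by (simp add: divide_inverse)
qed

lemma smooth_on_sqrt:
  fixes f :: "'a::euclidean_space \<Rightarrow> real"
  assumes "smooth_on X f" "\<And>x. x \<in> X \<Longrightarrow> f x > 0"
  shows "smooth_on X (\<lambda>x. sqrt (f x))"
proof -
  have "smooth_on {0<..} sqrt" using Ck_on_sqrt by (auto simp: smooth_on_def)
  then show ?thesis using assms by (intro smooth_on_compose[of "{0<..}" sqrt X f]) auto
qed

text \<open>The domains on which derivatives within the set are unique: every point is approached
  along every coordinate axis, from at least one side. This is the premise of
  \<open>frechet_derivative_unique_within\<close>; it admits closed intervals and their products,
  boundary points included.\<close>

definition spread :: "'a::euclidean_space set \<Rightarrow> bool" where
  "spread X \<longleftrightarrow> (\<forall>x\<in>X. \<forall>i\<in>Basis. \<forall>e>0. \<exists>d. 0 < \<bar>d\<bar> \<and> \<bar>d\<bar> < e \<and> x + d *\<^sub>R i \<in> X)"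

lemma spread_derivative_unique:
  assumes "spread X" "x \<in> X" "(f has_derivative f') (at x within X)"
    "(f has_derivative f'') (at x within X)"
  shows "f' = f''"
  using frechet_derivative_unique_within[OF assms(3,4)] assms(1,2) unfolding spread_def by blast

lemma spread_Int_open:
  assumes "spread X" "open U"
  shows "spread (X \<inter> U)"
  unfolding spread_def
proof (intro ballI allI impI)
  fix x i :: 'a and e :: real assume *: "x \<in> X \<inter> U" "i \<in> Basis" "e > 0"
  then obtain r where r: "r > 0" "ball x r \<subseteq> U" using assms(2) openE by blast
  obtain d where d: "0 < \<bar>d\<bar>" "\<bar>d\<bar> < min e r" "x + d *\<^sub>R i \<in> X"
    using assms(1) * r(1) unfolding spread_def by (metis IntD1 min_less_iff_conj)
  then have "x + d *\<^sub>R i \<in> ball x r" using * by (simp add: dist_norm)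
  then show "\<exists>d. 0 < \<bar>d\<bar> \<and> \<bar>d\<bar> < e \<and> x + d *\<^sub>R i \<in> X \<inter> U" using d r by auto
qed

lemma spread_openin:
  assumes "spread X" "openin (top_of_set X) Y"
  shows "spread Y"
  using assms spread_Int_open by (metis openin_open)

lemma at_within_openin:
  assumes "openin (top_of_set X) Y" "x \<in> Y"
  shows "at x within Y = at x within X"
proof -
  obtain U where "open U" "Y = X \<inter> U" using assms openin_open by metis
  then show ?thesis using assms(2) by (intro at_within_nhd[of x U]) auto
qed

lemma spread_Icc: "a < b \<Longrightarrow> spread {a..b::real}"
  unfolding spread_def
proof (intro ballI allI impI)
  fix x i e :: real assume *: "a < b" "x \<in> {a..b}" "i \<in> Basis" "0 < e"
  show "\<exists>d. 0 < \<bar>d\<bar> \<and> \<bar>d\<bar> < e \<and> x + d *\<^sub>R i \<in> {a..b}"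
  \<comment> \<open>Step to the right unless x is the right endpoint, with the length capped by the
    room left in the interval.\<close>
  proof (cases "x < b")
    case True
    then show ?thesis using * by (intro exI[of _ "min (e/2) (b - x)"]) (auto simp: min_def)
  next
    case False
    then show ?thesis using * by (intro exI[of _ "- min (e/2) (x - a)"]) (auto simp: min_def)
  qed
qed

lemma spread_UNIV: "spread UNIV"
  unfolding spread_def by (metis UNIV_I abs_of_pos field_lbound_gt_zero)

lemma spread_open: "open X \<Longrightarrow> spread X"
  using spread_Int_open[OF spread_UNIV] by fastforce

lemma spread_Times:
  assumes "spread X" "spread Y"
  shows "spread (X \<times> Y)"
  unfolding spread_def
proof (intro ballI allI impI)
  fix x i :: "'a \<times> 'b" and e :: real assume *: "x \<in> X \<times> Y" "i \<in> Basis" "e > 0"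
  then consider j where "i = (j, 0)" "j \<in> Basis" | j where "i = (0, j)" "j \<in> Basis"
    by (auto simp: Basis_prod_def)
  then show "\<exists>d. 0 < \<bar>d\<bar> \<and> \<bar>d\<bar> < e \<and> x + d *\<^sub>R i \<in> X \<times> Y"
  proof cases
    case 1
    then show ?thesis using assms * unfolding spread_def by (cases x) (force)
  next
    case 2
    then show ?thesis using assms * unfolding spread_def by (cases x) (force)
  qed
qed

text \<open>Local derivative witnesses need not match as given. Uniqueness on spread sets identifies
  each of them with one globally chosen witness, and the induction is applied to the directional
  derivatives of that one.\<close>

lemma Ck_on_local:
  assumes "spread X"
  shows "(\<And>x. x \<in> X \<Longrightarrow> \<exists>Y. openin (top_of_set X) Y \<and> x \<in> Y \<and> Ck_on k Y f) \<Longrightarrow> Ck_on k X f"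
proof (induction k arbitrary: f)
  case 0
  have "continuous (at x within X) f" if "x \<in> X" for x
    using 0[OF that] at_within_openin[of X _ x] by (auto simp: continuous_on_eq_continuous_within)
  then show ?case by (simp add: continuous_on_eq_continuous_within)
next
  case (Suc k)
  then obtain Y where Y: "\<And>x. x \<in> X \<Longrightarrow> openin (top_of_set X) (Y x)"
      "\<And>x. x \<in> X \<Longrightarrow> x \<in> Y x" "\<And>x. x \<in> X \<Longrightarrow> Ck_on (Suc k) (Y x) f" by metis
  define f' where "f' x = (SOME D. (f has_derivative D) (at x within X))" for x
  have f': "(f has_derivative f' x) (at x within X)" if "x \<in> X" for x
  proof -
    obtain D where "\<And>y. y \<in> Y x \<Longrightarrow> (f has_derivative D y) (at y within Y x)"
      using Ck_on_SucE[OF Y(3)[OF \<open>x \<in> X\<close>]] by metis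
    then have "\<exists>D. (f has_derivative D) (at x within Y x)" using Y(2)[OF \<open>x \<in> X\<close>] by blast
    then show ?thesis
      using Y that at_within_openin[of X "Y x" x] someI unfolding f'_def by metis
  qed
  have "Ck_on k X (\<lambda>x. f' x v)" for v
  proof (rule Suc.IH)
    fix x assume x: "x \<in> X"
    obtain D where D: "\<And>y. y \<in> Y x \<Longrightarrow> (f has_derivative D y) (at y within Y x)"
        "\<And>v. Ck_on k (Y x) (\<lambda>y. D y v)" using Y(3)[OF x] Ck_on_SucE by blast
    have "D y = f' y" if "y \<in> Y x" for y
    proof -
      have "y \<in> X" using that Y[OF x] openin_imp_subset by blast
      then have "(f has_derivative f' y) (at y within Y x)"
        using f' at_within_openin[OF Y(1)[OF x] that] by simp
      then show ?thesis
        using spread_derivative_unique[OF spread_openin[OF assms Y(1)[OF x]] that D(1)[OF that]]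
        by blast
    qed
    then have "Ck_on k (Y x) (\<lambda>y. f' y v)" using Ck_on_transform[OF D(2)[of v]] by simp
    then show "\<exists>Y. openin (top_of_set X) Y \<and> x \<in> Y \<and> Ck_on k Y (\<lambda>x. f' x v)"
      using Y(1,2)[OF x] by blast
  qed
  then show ?case by (intro Ck_on_SucI[OF f'])
qed

lemma smooth_on_local:
  assumes "spread X" "\<And>x. x \<in> X \<Longrightarrow> \<exists>Y. openin (top_of_set X) Y \<and> x \<in> Y \<and> smooth_on Y f"
  shows "smooth_on X f"
  unfolding smooth_on_def
  using Ck_on_local[OF assms(1), of _ f] assms(2) unfolding smooth_on_def by meson

text \<open>\<open>smooth_on\<close> supplies a separate derivative for each order. Uniqueness on a
  spread set merges them, so a single witness is smooth in each fixed direction.\<close>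

lemma smooth_on_derivativeE:
  assumes "smooth_on X f" "spread X"
  obtains f' where "\<And>x. x \<in> X \<Longrightarrow> (f has_derivative f' x) (at x within X)"
    "\<And>v. smooth_on X (\<lambda>x. f' x v)"
proof -
  have C: "Ck_on k X f" for k using assms(1) by (simp add: smooth_on_def)
  from C[of "Suc 0"] obtain f' where f': "\<And>x. x \<in> X \<Longrightarrow> (f has_derivative f' x) (at x within X)"
      "\<And>v. Ck_on 0 X (\<lambda>x. f' x v)"
    by (rule Ck_on_SucE) (rule that)
  have "Ck_on k X (\<lambda>x. f' x v)" for k v
  proof -
    from C[of "Suc k"] obtain D where D: "\<And>x. x \<in> X \<Longrightarrow> (f has_derivative D x) (at x within X)"
        "\<And>v. Ck_on k X (\<lambda>x. D x v)"
      by (rule Ck_on_SucE) (rule that)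
    have "f' x = D x" if "x \<in> X" for x
      using spread_derivative_unique[OF assms(2) that f'(1)[OF that] D(1)[OF that]] .
    then show ?thesis by (intro Ck_on_transform[OF D(2)[of v]]) simp
  qed
  then have "smooth_on X (\<lambda>x. f' x v)" for v by (simp add: smooth_on_def)
  then show thesis using f'(1) that by blast
qed

lemma smooth_on_open_derivative:
  assumes "smooth_on X f" "open X"
  shows "x \<in> X \<Longrightarrow> (f has_derivative frechet_derivative f (at x)) (at x)"
    and "smooth_on X (\<lambda>x. frechet_derivative f (at x) v)"
proof -
  obtain f' where f': "\<And>x. x \<in> X \<Longrightarrow> (f has_derivative f' x) (at x within X)"
      "\<And>v. smooth_on X (\<lambda>x. f' x v)"
    by (rule smooth_on_derivativeE[OF assms(1) spread_open[OF assms(2)]]) (rule that)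
  have *: "(f has_derivative f' x) (at x)" if "x \<in> X" for x
    using f'(1)[OF that] at_within_open[OF that assms(2)] by simp
  have eq: "frechet_derivative f (at x) = f' x" if "x \<in> X" for x
    using frechet_derivative_at[OF *[OF that]] by (rule sym)
  show "(f has_derivative frechet_derivative f (at x)) (at x)" if "x \<in> X"
    using *[OF that] eq[OF that] by simp
  show "smooth_on X (\<lambda>x. frechet_derivative f (at x) v)"
    using f'(2)[of v] by (rule smooth_on_transform) (simp only: eq)
qed

section \<open>Curves: vector derivatives and autonomous equations\<close>

lemma spread_real_at_within:
  fixes x :: real
  assumes "spread X" "x \<in> X"
  shows "at x within X \<noteq> bot"
proof -
  have "x islimpt X" unfolding islimpt_approachable
  proof (intro allI impI)
    fix e :: real assume "e > 0"
    then obtain d where "0 < \<bar>d\<bar>" "\<bar>d\<bar> < e" "x + d \<in> X"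
      using assms unfolding spread_def by force
    then show "\<exists>x'\<in>X. x' \<noteq> x \<and> dist x' x < e"
      by (intro bexI[of _ "x + d"]) (auto simp: dist_real_def)
  qed
  then show ?thesis by (simp add: trivial_limit_within)
qed

lemma smooth_on_vector_derivative:
  fixes f :: "real \<Rightarrow> 'b::real_normed_vector"
  assumes "smooth_on X f" "spread X"
  shows "x \<in> X \<Longrightarrow> (f has_vector_derivative vector_derivative f (at x within X)) (at x within X)"
    and "smooth_on X (\<lambda>x. vector_derivative f (at x within X))"
proof -
  obtain f' where f': "\<And>x. x \<in> X \<Longrightarrow> (f has_derivative f' x) (at x within X)"
      "\<And>v. smooth_on X (\<lambda>x. f' x v)"
    by (rule smooth_on_derivativeE[OF assms]) (rule that)
  have *: "(f has_vector_derivative f' x 1) (at x within X)" if "x \<in> X" for x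
  proof -
    have "f' x h = h *\<^sub>R f' x 1" for h
      using linear_scale[OF has_derivative_linear[OF f'(1)[OF that]], of h 1] by simp
    then have "f' x = (\<lambda>h. h *\<^sub>R f' x 1)" by blast
    then show ?thesis using f'(1)[OF that] unfolding has_vector_derivative_def by metis
  qed
  have eq: "vector_derivative f (at x within X) = f' x 1" if "x \<in> X" for x
    using vector_derivative_within[OF spread_real_at_within[OF assms(2) that] *[OF that]] .
  show "(f has_vector_derivative vector_derivative f (at x within X)) (at x within X)" if "x \<in> X"
    using *[OF that] eq[OF that] by simp
  show "smooth_on X (\<lambda>x. vector_derivative f (at x within X))"
    using f'(2)[of 1] by (rule smooth_on_transform) (simp only: eq)
qed

text \<open>Bootstrapping: if h is of class n, so is the right-hand side k(h), hence h is of class n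
  + 1. This makes the reparametrization with h' = 1 / D(h) smooth.\<close>

lemma smooth_on_autonomous:
  fixes h :: "real \<Rightarrow> 'b::euclidean_space"
  assumes "\<And>s. s \<in> X \<Longrightarrow> (h has_vector_derivative k (h s)) (at s within X)"
    and "h ` X \<subseteq> Y" "smooth_on Y k"
  shows "smooth_on X h"
proof -
  have "Ck_on n X h" for n
  proof (induction n)
    case 0
    then show ?case using assms(1)
      by (auto simp: continuous_on_eq_continuous_within intro: has_vector_derivative_continuous)
  next
    case (Suc n)
    have "Ck_on n X (\<lambda>s. v *\<^sub>R k (h s))" for v
      using Suc assms by (intro Ck_on_scaleR Ck_on_const Ck_on_compose[of n X h Y k])
        (auto simp: smooth_on_def)
    then show ?case
      by (intro Ck_on_SucI[OF assms(1)[unfolded has_vector_derivative_def]])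
  qed
  then show ?thesis by (simp add: smooth_on_def)
qed

text \<open>The functions x^(-n) e^(-1/x), extended by 0 to the left. The power is carried along
  because differentiating e^(-1/x) produces such powers; the linear span of the family is closed
  under differentiation.\<close>

definition flat_exp :: "nat \<Rightarrow> real \<Rightarrow> real" where
  "flat_exp n x = (if x > 0 then inverse x ^ n * exp (- inverse x) else 0)"

lemma flat_exp_tendsto_0: "(flat_exp n \<longlongrightarrow> 0) (at 0)"
proof -
  have "((\<lambda>x::real. inverse x ^ n / exp (inverse x)) \<longlongrightarrow> 0) (at_right 0)"
    using filterlim_compose[OF tendsto_power_div_exp_0 filterlim_inverse_at_top_right] .
  moreover have "\<forall>\<^sub>F x in at_right 0. inverse x ^ n / exp (inverse x) = flat_exp n x"
    by (auto simp: eventually_at_filter flat_exp_def exp_minus divide_inverse)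
  ultimately have "(flat_exp n \<longlongrightarrow> 0) (at_right 0)" by (rule Lim_transform_eventually)
  moreover have "(flat_exp n \<longlongrightarrow> 0) (at_left 0)"
    by (rule Lim_transform_eventually[OF tendsto_const])
      (auto simp: eventually_at_filter flat_exp_def)
  ultimately show ?thesis by (simp add: filterlim_split_at)
qed

lemma flat_exp_has_derivative:
  "(flat_exp n has_real_derivative flat_exp (n + 2) x - real n * flat_exp (n + 1) x) (at x)"
proof -
  consider "x > 0" | "x < 0" | "x = 0" by linarith
  then show ?thesis
  proof cases
    case 1
    have "((\<lambda>x. inverse x ^ n * exp (- inverse x)) has_real_derivative
        flat_exp (n + 2) x - real n * flat_exp (n + 1) x) (at x)"
    proof -
      have inv: "(inverse has_real_derivative - (inverse x)\<^sup>2) (at x)"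
        using DERIV_inverse[of x UNIV] 1 by (simp add: numeral_2_eq_2)
      have "(((\<lambda>x. inverse x ^ n) has_real_derivative
          real n * (- (inverse x)\<^sup>2 * inverse x ^ (n - Suc 0))) (at x))"
        using DERIV_power[OF inv, of n] by simp
      from DERIV_mult[OF this DERIV_chain2[OF DERIV_exp DERIV_minus[OF inv]]]
      have "((\<lambda>x. inverse x ^ n * exp (- inverse x)) has_real_derivative
          real n * (- (inverse x)\<^sup>2 * inverse x ^ (n - Suc 0)) * exp (- inverse x)
          + exp (- inverse x) * (inverse x)\<^sup>2 * inverse x ^ n) (at x)" by simp
      moreover have "real n * (- (inverse x)\<^sup>2 * inverse x ^ (n - Suc 0)) * exp (- inverse x)
          + exp (- inverse x) * (inverse x)\<^sup>2 * inverse x ^ n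
          = flat_exp (n + 2) x - real n * flat_exp (n + 1) x"
        using 1 by (cases n) (simp_all add: flat_exp_def power2_eq_square algebra_simps)
      ultimately show ?thesis by simp
    qed
    from has_field_derivative_transform_within_open[OF this open_greaterThan[of 0]] show ?thesis
      using 1 by (auto simp: flat_exp_def)
  next
    case 2
    have "((\<lambda>x. 0) has_real_derivative flat_exp (n + 2) x - real n * flat_exp (n + 1) x) (at x)"
      using 2 by (auto simp: flat_exp_def)
    from has_field_derivative_transform_within_open[OF this open_lessThan[of 0]] show ?thesis
      using 2 by (auto simp: flat_exp_def)
  next
    case 3
    \<comment> \<open>At the origin the difference quotient of member n is member n + 1, so the
      limit already found gives the derivative 0.\<close>
    have "(\<lambda>h. (flat_exp n (0 + h) - flat_exp n 0) / h) = flat_exp (n + 1)"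
      by (auto simp: flat_exp_def field_simps)
    then show ?thesis using flat_exp_tendsto_0 3 by (simp add: DERIV_def flat_exp_def)
  qed
qed

lemma smooth_on_flat_exp: "smooth_on UNIV (flat_exp n)"
proof -
  have "Ck_on k UNIV (flat_exp n)" for k n
  proof (induction k arbitrary: n)
    case 0
    then show ?case
      using flat_exp_has_derivative by (auto intro!: DERIV_continuous_on)
  next
    case (Suc k)
    show ?case
      by (rule Ck_on_SucI[OF flat_exp_has_derivative[THEN has_field_derivative_imp_has_derivative,
              THEN has_derivative_at_withinI]])
        (intro Ck_on_mult Ck_on_diff Ck_on_const Suc)
  qed
  then show ?thesis by (simp add: smooth_on_def)
qed

lemma smooth_bump:
  fixes l r :: real
  shows "\<exists>\<phi> :: real \<Rightarrow> real. smooth_on UNIV \<phi> \<and> (\<forall>s. l < s \<and> s < r \<longrightarrow> \<phi> s > 0) \<and>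
    (\<forall>s. s \<le> l \<or> r \<le> s \<longrightarrow> \<phi> s = 0)"
proof (intro exI conjI)
  \<comment> \<open>One factor is flat at l and positive to its right, the other is flat at r and
    positive to its left.\<close>
  show "smooth_on UNIV (\<lambda>s. flat_exp 0 (s - l) * flat_exp 0 (r - s))"
    by (intro smooth_on_mult smooth_on_compose[OF smooth_on_flat_exp] smooth_on_diff
        smooth_on_const smooth_on_linear bounded_linear_ident) auto
qed (auto simp: flat_exp_def)

section \<open>Smooth tensor fields on open sets\<close>

lemma linear_expand:
  fixes f :: "'e::euclidean_space \<Rightarrow> real"
  assumes "linear f"
  shows "f v = (\<Sum>b\<in>Basis. (v \<bullet> b) * f b)"
proof -
  have "f (\<Sum>b\<in>Basis. (v \<bullet> b) *\<^sub>R b) = (\<Sum>b\<in>Basis. (v \<bullet> b) * f b)"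
    using assms by (simp add: linear_sum linear_scale)
  then show ?thesis by (simp add: euclidean_representation)
qed

text \<open>The vector argument moves along with the base point, so the hypothesis for constant
  arguments is applied to basis vectors, with the components as coefficients.\<close>

lemma linear_field_smooth:
  fixes w :: "'q::euclidean_space \<Rightarrow> 'e::euclidean_space \<Rightarrow> real"
  assumes lin: "\<And>q. q \<in> \<Omega> \<Longrightarrow> linear (w q)" and sm: "\<And>v. smooth_on \<Omega> (\<lambda>q. w q v)"
    and "smooth_on X \<xi>" "smooth_on X \<eta>" "\<xi> ` X \<subseteq> \<Omega>"
  shows "smooth_on X (\<lambda>s. w (\<xi> s) (\<eta> s))"
proof (rule smooth_on_transform)
  show "smooth_on X (\<lambda>s. \<Sum>b\<in>Basis. (\<eta> s \<bullet> b) * w (\<xi> s) b)"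
    by (intro smooth_on_sum smooth_on_mult smooth_on_linear_compose[OF bounded_linear_inner_left]
        assms(4) smooth_on_compose[OF sm assms(3,5)])
  show "w (\<xi> s) (\<eta> s) = (\<Sum>b\<in>Basis. (\<eta> s \<bullet> b) * w (\<xi> s) b)" if "s \<in> X" for s
    using assms(5) that by (intro linear_expand lin) blast
qed

lemma bilinear_field_smooth:
  fixes B :: "'q::euclidean_space \<Rightarrow> 'e::euclidean_space \<Rightarrow> 'f::euclidean_space \<Rightarrow> real"
  assumes lin: "\<And>q v. q \<in> \<Omega> \<Longrightarrow> linear (B q v)" "\<And>q u. q \<in> \<Omega> \<Longrightarrow> linear (\<lambda>v. B q v u)"
    and sm: "\<And>v u. smooth_on \<Omega> (\<lambda>q. B q v u)"
    and "smooth_on X \<xi>" "smooth_on X \<eta>" "smooth_on X \<zeta>" "\<xi> ` X \<subseteq> \<Omega>"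
  shows "smooth_on X (\<lambda>s. B (\<xi> s) (\<eta> s) (\<zeta> s))"
proof (rule smooth_on_transform)
  show "smooth_on X (\<lambda>s. \<Sum>b\<in>Basis. (\<eta> s \<bullet> b) * B (\<xi> s) b (\<zeta> s))"
    using linear_field_smooth[where w = "\<lambda>q. B q _", OF lin(1) sm assms(4,6,7)]
    by (intro smooth_on_sum smooth_on_mult smooth_on_linear_compose[OF bounded_linear_inner_left]
        assms(5))
  show "B (\<xi> s) (\<eta> s) (\<zeta> s) = (\<Sum>b\<in>Basis. (\<eta> s \<bullet> b) * B (\<xi> s) b (\<zeta> s))" if "s \<in> X" for s
    using assms(7) that by (intro linear_expand[of "\<lambda>v. B (\<xi> s) v (\<zeta> s)"] lin(2)) blast
qed

text \<open>Additivity and homogeneity hold at every q of the open set, so they survive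
  differentiation in q. Hence the coordinate derivatives of multilinear fields are multilinear
  fields again, to which the same lemmas apply.\<close>

lemma linear_field_derivative_linear:
  fixes w :: "'q::euclidean_space \<Rightarrow> 'e::euclidean_space \<Rightarrow> real"
  assumes "open \<Omega>" and lin: "\<And>q. q \<in> \<Omega> \<Longrightarrow> linear (w q)"
    and sm: "\<And>v. smooth_on \<Omega> (\<lambda>q. w q v)" and q: "q \<in> \<Omega>"
  shows "linear (\<lambda>v. frechet_derivative (\<lambda>q. w q v) (at q) z)"
proof -
  note D = smooth_on_open_derivative(1)[OF sm \<open>open \<Omega>\<close> q]
  have "frechet_derivative (\<lambda>q. w q (x + y)) (at q) =
    (\<lambda>z. frechet_derivative (\<lambda>q. w q x) (at q) z + frechet_derivative (\<lambda>q. w q y) (at q) z)" for x y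
    by (rule frechet_derivative_at[symmetric],
        rule has_derivative_transform_within_open[OF has_derivative_add[OF D D] \<open>open \<Omega>\<close> q])
      (simp add: lin linear_add)
  moreover have "frechet_derivative (\<lambda>q. w q (c *\<^sub>R x)) (at q) =
    (\<lambda>z. c *\<^sub>R frechet_derivative (\<lambda>q. w q x) (at q) z)" for c x
    by (rule frechet_derivative_at[symmetric],
        rule has_derivative_transform_within_open[OF has_derivative_scaleR_right[OF D] \<open>open \<Omega>\<close> q])
      (simp add: lin linear_scale)
  ultimately show ?thesis by (intro linearI) simp_all
qed

lemma has_real_derivative_transform_eventually:
  assumes "(f has_real_derivative D) (at s within I)" "\<forall>\<^sub>F x in nhds s. x \<in> I \<longrightarrow> f x = g x" "f s = g s"
  shows "(g has_real_derivative D) (at s within I)"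
  using has_vector_derivative_cong_ev[OF assms(2,3)] assms(1)
  by (simp add: has_real_derivative_iff_has_vector_derivative)

lemma eventually_nhds_within_open:
  assumes "continuous (at s within I) \<xi>" "open \<Omega>" "\<xi> s \<in> \<Omega>"
  shows "\<forall>\<^sub>F x in nhds s. x \<in> I \<longrightarrow> \<xi> x \<in> \<Omega>"
proof -
  have "(\<xi> \<longlongrightarrow> \<xi> s) (at s within I)" using assms(1) by (simp add: continuous_within)
  then have "\<forall>\<^sub>F x in at s within I. \<xi> x \<in> \<Omega>" using assms(2,3) topological_tendstoD by blast
  then show ?thesis using assms(3)
    unfolding eventually_at_filter by (auto elim: eventually_mono)
qed

lemma has_derivative_along:
  assumes "(\<xi> has_vector_derivative v) (at s within I)" "(f has_derivative D) (at (\<xi> s))"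
  shows "((\<lambda>s. f (\<xi> s)) has_real_derivative D v) (at s within I)"
proof -
  have "((f \<circ> \<xi>) has_derivative (D \<circ> (\<lambda>h. h *\<^sub>R v))) (at s within I)"
    using assms unfolding has_vector_derivative_def
    by (intro diff_chain_within) (auto intro: has_derivative_at_withinI)
  moreover have "D \<circ> (\<lambda>h. h *\<^sub>R v) = (*) (D v)"
    using linear_scale[OF has_derivative_linear[OF assms(2)]] by (auto simp: fun_eq_iff)
  ultimately show ?thesis unfolding has_field_derivative_def comp_def by simp
qed

lemma linear_field_derivative:
  fixes w :: "'q::euclidean_space \<Rightarrow> 'e::euclidean_space \<Rightarrow> real"
  assumes "open \<Omega>" and lin: "\<And>q. q \<in> \<Omega> \<Longrightarrow> linear (w q)"
    and sm: "\<And>v. smooth_on \<Omega> (\<lambda>q. w q v)" and "\<xi> s \<in> \<Omega>"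
    and \<xi>: "(\<xi> has_vector_derivative v) (at s within I)"
    and \<eta>: "(\<eta> has_vector_derivative y) (at s within I)"
  shows "((\<lambda>s. w (\<xi> s) (\<eta> s)) has_real_derivative
    frechet_derivative (\<lambda>q. w q (\<eta> s)) (at (\<xi> s)) v + w (\<xi> s) y) (at s within I)"
proof -
  have w: "((\<lambda>s. w (\<xi> s) b) has_real_derivative frechet_derivative (\<lambda>q. w q b) (at (\<xi> s)) v)
      (at s within I)" for b
    by (rule has_derivative_along[OF \<xi> smooth_on_open_derivative(1)[OF sm \<open>open \<Omega>\<close> \<open>\<xi> s \<in> \<Omega>\<close>]])
  have e: "((\<lambda>s. \<eta> s \<bullet> b) has_real_derivative (y \<bullet> b)) (at s within I)" for b
    using bounded_linear.has_vector_derivative[OF bounded_linear_inner_left \<eta>]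
    by (simp add: has_real_derivative_iff_has_vector_derivative)
  have fr: "frechet_derivative (\<lambda>q. w q (\<eta> s)) (at (\<xi> s)) v
      = (\<Sum>b\<in>Basis. (\<eta> s \<bullet> b) * frechet_derivative (\<lambda>q. w q b) (at (\<xi> s)) v)"
    by (rule linear_expand[OF linear_field_derivative_linear[OF assms(1-4)]])
  have wy: "w (\<xi> s) y = (\<Sum>b\<in>Basis. (y \<bullet> b) * w (\<xi> s) b)"
    by (rule linear_expand[OF lin[OF \<open>\<xi> s \<in> \<Omega>\<close>]])
  have "((\<lambda>s. \<Sum>b\<in>Basis. (\<eta> s \<bullet> b) * w (\<xi> s) b) has_real_derivative
      (\<Sum>b\<in>Basis. (y \<bullet> b) * w (\<xi> s) b
        + frechet_derivative (\<lambda>q. w q b) (at (\<xi> s)) v * (\<eta> s \<bullet> b))) (at s within I)"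
    by (intro DERIV_sum DERIV_mult e w)
  then have "((\<lambda>s. \<Sum>b\<in>Basis. (\<eta> s \<bullet> b) * w (\<xi> s) b) has_real_derivative
      frechet_derivative (\<lambda>q. w q (\<eta> s)) (at (\<xi> s)) v + w (\<xi> s) y) (at s within I)"
    unfolding fr wy sum.distrib by (simp only: mult.commute add.commute)
  \<comment> \<open>The basis expansion is valid only while the curve is in \<Omega>. By continuity
    this is so near s within I, which suffices for a derivative at s.\<close>
  then show ?thesis
  proof (rule has_real_derivative_transform_eventually)
    have "\<forall>\<^sub>F x in nhds s. x \<in> I \<longrightarrow> \<xi> x \<in> \<Omega>"
      by (rule eventually_nhds_within_open[OF has_vector_derivative_continuous[OF \<xi>] assms(1,4)])
    then show "\<forall>\<^sub>F x in nhds s. x \<in> I \<longrightarrow> (\<Sum>b\<in>Basis. (\<eta> x \<bullet> b) * w (\<xi> x) b) = w (\<xi> x) (\<eta> x)"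
      by (rule eventually_mono) (intro impI linear_expand[symmetric] lin, blast)
    show "(\<Sum>b\<in>Basis. (\<eta> s \<bullet> b) * w (\<xi> s) b) = w (\<xi> s) (\<eta> s)"
      by (rule linear_expand[OF lin[OF \<open>\<xi> s \<in> \<Omega>\<close>], symmetric])
  qed
qed

text \<open>With a basis vector frozen in the first slot this is the case of a linear field; the
  moving components of the first argument contribute the remaining term.\<close>

lemma bilinear_field_derivative:
  fixes B :: "'q::euclidean_space \<Rightarrow> 'e::euclidean_space \<Rightarrow> 'f::euclidean_space \<Rightarrow> real"
  assumes "open \<Omega>" and lin: "\<And>q v. q \<in> \<Omega> \<Longrightarrow> linear (B q v)" "\<And>q u. q \<in> \<Omega> \<Longrightarrow> linear (\<lambda>v. B q v u)"
    and sm: "\<And>v u. smooth_on \<Omega> (\<lambda>q. B q v u)" and "\<xi> s \<in> \<Omega>"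
    and \<xi>: "(\<xi> has_vector_derivative v) (at s within I)"
    and \<eta>: "(\<eta> has_vector_derivative y) (at s within I)"
    and \<zeta>: "(\<zeta> has_vector_derivative z) (at s within I)"
  shows "((\<lambda>s. B (\<xi> s) (\<eta> s) (\<zeta> s)) has_real_derivative
    frechet_derivative (\<lambda>q. B q (\<eta> s) (\<zeta> s)) (at (\<xi> s)) v + B (\<xi> s) y (\<zeta> s) + B (\<xi> s) (\<eta> s) z)
    (at s within I)"
proof -
  have w: "((\<lambda>s. B (\<xi> s) b (\<zeta> s)) has_real_derivative
      frechet_derivative (\<lambda>q. B q b (\<zeta> s)) (at (\<xi> s)) v + B (\<xi> s) b z) (at s within I)" for b
    by (rule linear_field_derivative[of \<Omega> "\<lambda>q. B q b", OF \<open>open \<Omega>\<close> lin(1) sm \<open>\<xi> s \<in> \<Omega>\<close> \<xi> \<zeta>])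
  have e: "((\<lambda>s. \<eta> s \<bullet> b) has_real_derivative (y \<bullet> b)) (at s within I)" for b
    using bounded_linear.has_vector_derivative[OF bounded_linear_inner_left \<eta>]
    by (simp add: has_real_derivative_iff_has_vector_derivative)
  have fr: "frechet_derivative (\<lambda>q. B q (\<eta> s) (\<zeta> s)) (at (\<xi> s)) v
      = (\<Sum>b\<in>Basis. (\<eta> s \<bullet> b) * frechet_derivative (\<lambda>q. B q b (\<zeta> s)) (at (\<xi> s)) v)"
    by (rule linear_expand[OF linear_field_derivative_linear[of \<Omega> "\<lambda>q v. B q v (\<zeta> s)",
          OF \<open>open \<Omega>\<close> lin(2) sm \<open>\<xi> s \<in> \<Omega>\<close>]])
  have By: "B (\<xi> s) y (\<zeta> s) = (\<Sum>b\<in>Basis. (y \<bullet> b) * B (\<xi> s) b (\<zeta> s))"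
    and Bz: "B (\<xi> s) (\<eta> s) z = (\<Sum>b\<in>Basis. (\<eta> s \<bullet> b) * B (\<xi> s) b z)"
    by (rule linear_expand[OF lin(2)[OF \<open>\<xi> s \<in> \<Omega>\<close>]])+
  have "((\<lambda>s. \<Sum>b\<in>Basis. (\<eta> s \<bullet> b) * B (\<xi> s) b (\<zeta> s)) has_real_derivative
      (\<Sum>b\<in>Basis. (y \<bullet> b) * B (\<xi> s) b (\<zeta> s)
        + (frechet_derivative (\<lambda>q. B q b (\<zeta> s)) (at (\<xi> s)) v + B (\<xi> s) b z) * (\<eta> s \<bullet> b)))
      (at s within I)"
    by (intro DERIV_sum DERIV_mult e w)
  then have "((\<lambda>s. \<Sum>b\<in>Basis. (\<eta> s \<bullet> b) * B (\<xi> s) b (\<zeta> s)) has_real_derivative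
      frechet_derivative (\<lambda>q. B q (\<eta> s) (\<zeta> s)) (at (\<xi> s)) v + B (\<xi> s) y (\<zeta> s) + B (\<xi> s) (\<eta> s) z)
      (at s within I)"
    unfolding fr By Bz sum.distrib distrib_right
    by (simp only: mult.commute add.commute add.left_commute)
  then show ?thesis
  proof (rule has_real_derivative_transform_eventually)
    have "\<forall>\<^sub>F x in nhds s. x \<in> I \<longrightarrow> \<xi> x \<in> \<Omega>"
      by (rule eventually_nhds_within_open[OF has_vector_derivative_continuous[OF \<xi>] assms(1,5)])
    then show "\<forall>\<^sub>F x in nhds s. x \<in> I \<longrightarrow>
        (\<Sum>b\<in>Basis. (\<eta> x \<bullet> b) * B (\<xi> x) b (\<zeta> x)) = B (\<xi> x) (\<eta> x) (\<zeta> x)"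
      by (rule eventually_mono) (intro impI linear_expand[symmetric] lin(2), blast)
    show "(\<Sum>b\<in>Basis. (\<eta> s \<bullet> b) * B (\<xi> s) b (\<zeta> s)) = B (\<xi> s) (\<eta> s) (\<zeta> s)"
      by (rule linear_expand[OF lin(2)[OF \<open>\<xi> s \<in> \<Omega>\<close>], symmetric])
  qed
qed

section \<open>The Fermat metric on an open set\<close>

text \<open>\<open>christoffel\<close> is a definite description and says nothing until existence
  and uniqueness hold. Nondegeneracy gives uniqueness and, as an injective endomorphism in finite
  dimension is onto, existence. The vector equation then turns into one that is tested by pairing,
  without inverting the metric.\<close>

lemma nondegenerate_form_the:
  fixes B :: "'v::euclidean_space \<Rightarrow> 'v \<Rightarrow> real"
  assumes lin1: "\<And>z. linear (\<lambda>a. B a z)" and lin2: "\<And>a. linear (B a)"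
    and nondeg: "\<And>a. (\<And>z. B a z = 0) \<Longrightarrow> a = 0" and "linear \<Lambda>"
  shows "y + (THE A. \<forall>z. 2 * B A z = \<Lambda> z) = 0 \<longleftrightarrow> (\<forall>z. 2 * B y z + \<Lambda> z = 0)"
proof -
  \<comment> \<open>The linear map representing the form: component i of R(a) is the value of B(a,
    .) on the basis vector i.\<close>
  define R where "R a = (\<Sum>i\<in>Basis. B a i *\<^sub>R i)" for a
  have R: "R a \<bullet> i = B a i" if "i \<in> Basis" for a i
    unfolding R_def using that by simp
  have "linear R" unfolding R_def
    by (intro linearI) (simp_all add: linear_add[OF lin1] linear_scale[OF lin1] scaleR_left_distrib
        sum.distrib scaleR_sum_right)
  moreover have "a = 0" if "R a = 0" for a
  proof (rule nondeg)
    show "B a z = 0" for z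
      using linear_expand[OF lin2, of a z] R[of _ a] that by simp
  qed
  ultimately have "surj R"
    using linear_injective_imp_surjective linear_injective_0 by blast
  then obtain A where A: "R A = (\<Sum>i\<in>Basis. (\<Lambda> i / 2) *\<^sub>R i)" by (metis surj_def)
  have A: "2 * B A z = \<Lambda> z" for z
  proof -
    have "2 * B A i = \<Lambda> i" if "i \<in> Basis" for i
      using R[OF that, of A] that unfolding A by simp
    then have "2 * ((z \<bullet> i) * B A i) = (z \<bullet> i) * \<Lambda> i" if "i \<in> Basis" for i
      using that by (metis mult.left_commute)
    then show ?thesis
      unfolding linear_expand[OF lin2, of A z] linear_expand[OF \<open>linear \<Lambda>\<close>, of z]
      unfolding sum_distrib_left by (intro sum.cong) auto
  qed
  have uniq: "A' = A" if "\<And>z. 2 * B A' z = \<Lambda> z" for A'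
  proof -
    have "B (A' - A) z = 0" for z
      using linear_diff[OF lin1, of A' A z] that[of z] A[of z] by simp
    then show ?thesis using nondeg[of "A' - A"] by simp
  qed
  have the: "(THE A. \<forall>z. 2 * B A z = \<Lambda> z) = A"
    using A uniq by (intro the_equality) auto
  show ?thesis
  proof
    assume "y + (THE A. \<forall>z. 2 * B A z = \<Lambda> z) = 0"
    then have y: "y = - A" unfolding the by (simp add: eq_neg_iff_add_eq_0)
    show "\<forall>z. 2 * B y z + \<Lambda> z = 0"
      using A linear_neg[OF lin1] unfolding y by (metis add.left_inverse mult_minus_right)
  next
    assume *: "\<forall>z. 2 * B y z + \<Lambda> z = 0"
    have "2 * B (- y) z = \<Lambda> z" for z
      using *[rule_format, of z] linear_neg[OF lin1, of y z] by simp
    then have "- y = A" by (rule uniq)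
    then show "y + (THE A. \<forall>z. 2 * B A z = \<Lambda> z) = 0" unfolding the by auto
  qed
qed

text \<open>A single chart: \<Omega> is its image, and b, w, g are the components of \<beta>,
  \<omega> and \<open>g\<^sub>0\<close> there.\<close>

locale fermat_model =
  fixes \<Omega> :: "'e::euclidean_space set" and b :: "'e \<Rightarrow> real" and w :: "'e \<Rightarrow> 'e \<Rightarrow> real"
    and g :: "'e \<Rightarrow> 'e \<Rightarrow> 'e \<Rightarrow> real" and \<sigma> :: real
  assumes open_\<Omega>: "open \<Omega>"
    and b_smooth: "smooth_on \<Omega> b" and b_pos: "\<And>q. q \<in> \<Omega> \<Longrightarrow> b q > 0"
    and w_linear: "\<And>q. q \<in> \<Omega> \<Longrightarrow> linear (w q)" and w_smooth: "\<And>v. smooth_on \<Omega> (\<lambda>q. w q v)"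
    and g_linear: "\<And>q v. q \<in> \<Omega> \<Longrightarrow> linear (g q v)" and g_smooth: "\<And>v u. smooth_on \<Omega> (\<lambda>q. g q v u)"
    and g_sym: "\<And>q v u. q \<in> \<Omega> \<Longrightarrow> g q v u = g q u v"
    and g_pos: "\<And>q v. q \<in> \<Omega> \<Longrightarrow> v \<noteq> 0 \<Longrightarrow> g q v v > 0"
    and \<sigma>_sq: "\<sigma> * \<sigma> = 1"
begin

definition Db where "Db q z = frechet_derivative b (at q) z"
definition Dw where "Dw q z v = frechet_derivative (\<lambda>q. w q v) (at q) z"
definition Dg where "Dg q z v u = frechet_derivative (\<lambda>q. g q v u) (at q) z"

definition FL where "FL q v = \<sigma> * w q v / b q + sqrt (g q v v / b q + (w q v)\<^sup>2 / (b q)\<^sup>2)"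
definition DL where "DL q v = b q - \<sigma> * w q v"
text \<open>The total derivative of \<open>DL\<close> along a curve with velocity v and acceleration
  a; \<open>pLdot\<close> is likewise that of \<open>pL\<close> paired with a constant field
  z.\<close>

definition DLdot where "DLdot q v a = Db q v - \<sigma> * Dw q v v - \<sigma> * w q a"
definition pL where "pL q v z = \<sigma> * w q z + g q v z"
definition pLdot where "pLdot q v a z = \<sigma> * Dw q v z + Dg q v v z + g q a z"
definition NL where "NL q v z = - Db q z + 2 * \<sigma> * Dw q z v + Dg q z v v"

text \<open>By homogeneity, \<open>\<partial>\<^sub>v FL = pL / DL\<close> and \<open>\<partial>\<^sub>q FL = NL / (2 DL)\<close> on the
  indicatrix \<open>FL = 1\<close>; \<open>res / DL\<^sup>2\<close> is the Euler-Lagrange expression of \<open>FL\<close> along a curve with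
  position \<open>q\<close>, velocity \<open>v\<close> and acceleration \<open>a\<close>.\<close>

definition res where
  "res q v a z = NL q v z * DL q v / 2 - (pLdot q v a z * DL q v - pL q v z * DLdot q v a)"

lemma g_linear1:
  assumes "q \<in> \<Omega>"
  shows "linear (\<lambda>v. g q v u)"
proof -
  have "(\<lambda>v. g q v u) = g q u" using g_sym[OF assms] by (rule ext)
  then show ?thesis using g_linear[OF assms] by simp
qed

lemma Db_linear: "q \<in> \<Omega> \<Longrightarrow> linear (Db q)"
  unfolding Db_def
  using has_derivative_linear[OF smooth_on_open_derivative(1)[OF b_smooth open_\<Omega>]] .

lemma Dw_linear: "q \<in> \<Omega> \<Longrightarrow> linear (Dw q z)" "q \<in> \<Omega> \<Longrightarrow> linear (\<lambda>z. Dw q z v)"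
  unfolding Dw_def
  using linear_field_derivative_linear[OF open_\<Omega> w_linear w_smooth]
    has_derivative_linear[OF smooth_on_open_derivative(1)[OF w_smooth open_\<Omega>]] by blast+

lemma Dg_linear: "q \<in> \<Omega> \<Longrightarrow> linear (Dg q z v)" "q \<in> \<Omega> \<Longrightarrow> linear (\<lambda>z. Dg q z v u)"
    "q \<in> \<Omega> \<Longrightarrow> linear (\<lambda>v. Dg q z v u)"
  unfolding Dg_def
  using linear_field_derivative_linear[where w = "\<lambda>q. g q v", OF open_\<Omega> g_linear g_smooth]
    linear_field_derivative_linear[where w = "\<lambda>q v. g q v u", OF open_\<Omega> g_linear1 g_smooth]
    has_derivative_linear[OF smooth_on_open_derivative(1)[OF g_smooth open_\<Omega>]] by blast+

lemma Db_smooth: "smooth_on \<Omega> (\<lambda>q. Db q z)"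
  and Dw_smooth: "smooth_on \<Omega> (\<lambda>q. Dw q z v)"
  and Dg_smooth: "smooth_on \<Omega> (\<lambda>q. Dg q z v u)"
  unfolding Db_def Dw_def Dg_def
  by (rule smooth_on_open_derivative(2)[OF _ open_\<Omega>], rule b_smooth w_smooth g_smooth)+

section \<open>Smoothness along maps into the chart\<close>

context
  fixes X :: "'x::euclidean_space set" and \<xi> \<eta> :: "'x \<Rightarrow> 'e"
  assumes sm: "smooth_on X \<xi>" "smooth_on X \<eta>" and sub: "\<xi> ` X \<subseteq> \<Omega>"
begin

lemma b_along_smooth: "smooth_on X (\<lambda>s. b (\<xi> s))"
  by (rule smooth_on_compose[OF b_smooth sm(1) sub])

lemma w_along_smooth: "smooth_on X (\<lambda>s. w (\<xi> s) (\<eta> s))"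
  by (rule linear_field_smooth[OF w_linear w_smooth sm sub])

lemma g_along_smooth: "smooth_on X \<zeta> \<Longrightarrow> smooth_on X (\<lambda>s. g (\<xi> s) (\<eta> s) (\<zeta> s))"
  by (rule bilinear_field_smooth[OF g_linear g_linear1 g_smooth sm _ sub])

lemma DL_along_smooth: "smooth_on X (\<lambda>s. DL (\<xi> s) (\<eta> s))"
  unfolding DL_def by (intro smooth_on_diff smooth_on_mult smooth_on_const b_along_smooth w_along_smooth)

lemma radicand_along_smooth:
  "smooth_on X (\<lambda>s. g (\<xi> s) (\<eta> s) (\<eta> s) / b (\<xi> s) + (w (\<xi> s) (\<eta> s))\<^sup>2 / (b (\<xi> s))\<^sup>2)"
  unfolding power2_eq_square using b_pos sub
  by (intro smooth_on_add smooth_on_divide smooth_on_mult b_along_smooth w_along_smooth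
      g_along_smooth sm) (auto simp: image_subset_iff)

text \<open>Continuity survives at zero velocity because the square root is continuous at 0. It is
  applied to a whole variation before its velocities are known to be nonzero.\<close>

lemma FL_along_continuous: "continuous_on X (\<lambda>s. FL (\<xi> s) (\<eta> s))"
proof -
  have "continuous_on X (\<lambda>s. \<sigma> * w (\<xi> s) (\<eta> s) / b (\<xi> s))"
    using b_pos sub
    by (intro smooth_on_imp_continuous_on smooth_on_divide smooth_on_mult smooth_on_const
        b_along_smooth w_along_smooth) (auto simp: image_subset_iff)
  moreover have "continuous_on X (\<lambda>s. sqrt (g (\<xi> s) (\<eta> s) (\<eta> s) / b (\<xi> s) + (w (\<xi> s) (\<eta> s))\<^sup>2 / (b (\<xi> s))\<^sup>2))"
    by (intro continuous_on_real_sqrt smooth_on_imp_continuous_on radicand_along_smooth)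
  ultimately show ?thesis unfolding FL_def by (rule continuous_on_add)
qed

text \<open>On nonzero vectors the radicand is positive by definiteness of g, and there the square
  root is smooth.\<close>

lemma FL_along_smooth:
  assumes "\<And>s. s \<in> X \<Longrightarrow> \<eta> s \<noteq> 0"
  shows "smooth_on X (\<lambda>s. FL (\<xi> s) (\<eta> s))"
proof -
  have "smooth_on X (\<lambda>s. \<sigma> * w (\<xi> s) (\<eta> s) / b (\<xi> s))"
    using b_pos sub
    by (intro smooth_on_divide smooth_on_mult smooth_on_const
        b_along_smooth w_along_smooth) (auto simp: image_subset_iff)
  moreover have "g (\<xi> s) (\<eta> s) (\<eta> s) / b (\<xi> s) + (w (\<xi> s) (\<eta> s))\<^sup>2 / (b (\<xi> s))\<^sup>2 > 0" if "s \<in> X" for s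
    using assms[OF that] b_pos[of "\<xi> s"] g_pos[of "\<xi> s" "\<eta> s"] sub that
    by (intro add_pos_nonneg) (auto simp: image_subset_iff)
  then have "smooth_on X (\<lambda>s. sqrt (g (\<xi> s) (\<eta> s) (\<eta> s) / b (\<xi> s) + (w (\<xi> s) (\<eta> s))\<^sup>2 / (b (\<xi> s))\<^sup>2))"
    by (intro smooth_on_sqrt radicand_along_smooth)
  ultimately show ?thesis unfolding FL_def by (rule smooth_on_add)
qed

lemma res_along_smooth:
  assumes "smooth_on X \<alpha>"
  shows "smooth_on X (\<lambda>s. res (\<xi> s) (\<eta> s) (\<alpha> s) z)"
proof -
  note bf = bilinear_field_smooth[where X = X and \<xi> = \<xi> and \<Omega> = \<Omega>, OF _ _ _ sm(1) _ _ sub]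
  note lf = linear_field_smooth[where X = X and \<xi> = \<xi> and \<Omega> = \<Omega>, OF _ _ sm(1) _ sub]
  have "smooth_on X (\<lambda>s. Db (\<xi> s) z)"
    by (rule smooth_on_compose[OF Db_smooth sm(1) sub])
  moreover have "smooth_on X (\<lambda>s. Db (\<xi> s) (\<eta> s))"
    by (rule lf[OF Db_linear Db_smooth sm(2)])
  moreover have "smooth_on X (\<lambda>s. Dw (\<xi> s) z (\<eta> s))"
    by (rule lf[where w = "\<lambda>q. Dw q z", OF Dw_linear(1) Dw_smooth sm(2)])
  moreover have "smooth_on X (\<lambda>s. Dw (\<xi> s) (\<eta> s) z)"
    by (rule lf[where w = "\<lambda>q v. Dw q v z", OF Dw_linear(2) Dw_smooth sm(2)])
  moreover have "smooth_on X (\<lambda>s. Dw (\<xi> s) (\<eta> s) (\<eta> s))"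
    by (rule bf[where B = Dw, OF Dw_linear(1,2) Dw_smooth sm(2) sm(2)])
  moreover have "smooth_on X (\<lambda>s. Dg (\<xi> s) z (\<eta> s) (\<eta> s))"
    by (rule bf[where B = "\<lambda>q. Dg q z", OF Dg_linear(1,3) Dg_smooth sm(2) sm(2)])
  moreover have "smooth_on X (\<lambda>s. Dg (\<xi> s) (\<eta> s) (\<eta> s) z)"
    by (rule bf[where B = "\<lambda>q x y. Dg q x y z", OF Dg_linear(3,2) Dg_smooth sm(2) sm(2)])
  moreover have "smooth_on X (\<lambda>s. w (\<xi> s) z)"
    by (rule smooth_on_compose[OF w_smooth sm(1) sub])
  moreover have "smooth_on X (\<lambda>s. w (\<xi> s) (\<alpha> s))"
    by (rule lf[OF w_linear w_smooth assms])
  moreover have "smooth_on X (\<lambda>s. g (\<xi> s) (\<eta> s) z)"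
    by (rule lf[where w = "\<lambda>q v. g q v z", OF g_linear1 g_smooth sm(2)])
  moreover have "smooth_on X (\<lambda>s. g (\<xi> s) (\<alpha> s) z)"
    by (rule lf[where w = "\<lambda>q v. g q v z", OF g_linear1 g_smooth assms])
  moreover note DL_along_smooth
  ultimately show ?thesis
    unfolding res_def NL_def pLdot_def pL_def DLdot_def minus_real_def[symmetric]
    unfolding uminus_add_conv_diff divide_inverse
    by (intro smooth_on_add smooth_on_diff smooth_on_mult smooth_on_const) 
qed

end

section \<open>The quadratic equation of the Fermat metric\<close>

lemma FL_zero: "q \<in> \<Omega> \<Longrightarrow> FL q 0 = 0"
  using w_linear[of q] g_linear[of q 0] by (simp add: FL_def linear_0)

lemma FL_quadratic:
  assumes "q \<in> \<Omega>"
  shows "b q * (FL q v)\<^sup>2 = 2 * \<sigma> * w q v * FL q v + g q v v"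
proof -
  define R where "R = sqrt (g q v v / b q + (w q v)\<^sup>2 / (b q)\<^sup>2)"
  have "g q v v \<ge> 0"
    using g_pos[OF assms, of v] g_linear[OF assms, of v] by (cases "v = 0") (auto simp: linear_0)
  then have R: "R\<^sup>2 = g q v v / b q + (w q v)\<^sup>2 / (b q)\<^sup>2"
    unfolding R_def using b_pos[OF assms] by simp
  \<comment> \<open>Clearing denominators isolates the square root R as b F - \<sigma> w = b R;
    squaring this and using \<sigma>^2 = 1 gives the equation multiplied by b.\<close>
  have bR: "b q * b q * R\<^sup>2 = b q * g q v v + (w q v)\<^sup>2"
    unfolding R using b_pos[OF assms] by (simp add: field_simps power2_eq_square)
  have F: "b q * FL q v = \<sigma> * w q v + b q * R"
    unfolding FL_def R_def using b_pos[OF assms] by (simp add: field_simps)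
  have "b q * (b q * (FL q v)\<^sup>2) = (b q * FL q v) * (b q * FL q v)" by (simp add: power2_eq_square)
  also have "\<dots> = 2 * \<sigma> * w q v * (b q * FL q v) - \<sigma> * \<sigma> * (w q v)\<^sup>2 + b q * b q * R\<^sup>2"
    unfolding F by (simp add: algebra_simps power2_eq_square)
  also have "\<dots> = b q * (2 * \<sigma> * w q v * FL q v + g q v v)"
    unfolding bR \<sigma>_sq by (simp add: algebra_simps)
  finally show ?thesis using b_pos[OF assms] by simp
qed

text \<open>The second condition says that 1 is a root of the quadratic equation, and the sign of
  \<open>DL\<close> excludes that F is the other root.\<close>

lemma FL_unit_iff:
  assumes "q \<in> \<Omega>"
  shows "FL q v = 1 \<longleftrightarrow> DL q v > 0 \<and> b q = 2 * \<sigma> * w q v + g q v v"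
proof -
  define R where "R = sqrt (g q v v / b q + (w q v)\<^sup>2 / (b q)\<^sup>2)"
  have gnn: "g q v v \<ge> 0"
    using g_pos[OF assms, of v] g_linear[OF assms, of v] by (cases "v = 0") (auto simp: linear_0)
  have R0: "R \<ge> 0" unfolding R_def using gnn b_pos[OF assms] by simp
  have F: "b q * FL q v = \<sigma> * w q v + b q * R"
    unfolding FL_def R_def using b_pos[OF assms] by (simp add: field_simps)
  note Q = FL_quadratic[OF assms, of v]
  show ?thesis
  proof
    assume 1: "FL q v = 1"
    then have eq: "b q = 2 * \<sigma> * w q v + g q v v" using Q by simp
    have D: "DL q v = b q * R" using F 1 unfolding DL_def by simp
    have "DL q v \<noteq> 0"
    proof
      assume "DL q v = 0"
      then have "b q = \<sigma> * w q v" by (simp add: DL_def)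
      then have "b q = 2 * b q + g q v v" using eq by simp
      then show False using gnn b_pos[OF assms] by linarith
    qed
    moreover have "DL q v \<ge> 0" unfolding D using R0 b_pos[OF assms] by simp
    ultimately show "DL q v > 0 \<and> b q = 2 * \<sigma> * w q v + g q v v" using eq by simp
  next
    assume *: "DL q v > 0 \<and> b q = 2 * \<sigma> * w q v + g q v v"
    define f where "f = FL q v"
    \<comment> \<open>Subtracting the equation of the root 1 from that of f leaves the factor f - 1;
      its cofactor is b R + \<open>DL\<close>, which is positive.\<close>
    have "b q * (f * f) - b q - 2 * \<sigma> * w q v * (f - 1) = 0"
      using Q * unfolding f_def by (simp add: power2_eq_square algebra_simps)
    then have "(f - 1) * (b q * f + DL q v - \<sigma> * w q v) = 0"
      unfolding DL_def by (simp add: algebra_simps)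
    moreover have "b q * f + DL q v - \<sigma> * w q v > 0"
    proof -
      have "b q * f - \<sigma> * w q v = b q * R" using F by (simp add: f_def)
      then show ?thesis using * R0 b_pos[OF assms] by (smt (verit) mult_nonneg_nonneg)
    qed
    ultimately show "FL q v = 1" unfolding f_def by simp
  qed
qed

text \<open>Implicit differentiation of the quadratic equation. Where F = 1, the coefficient of the
  unknown derivative is 2 b - 2 \<sigma> w, that is, twice \<open>DL\<close>.\<close>

lemma FL_variation:
  assumes "q \<epsilon> \<in> \<Omega>" and q: "(q has_vector_derivative U) (at \<epsilon>)" and v: "(v has_vector_derivative V) (at \<epsilon>)"
    and F: "((\<lambda>e. FL (q e) (v e)) has_real_derivative \<Phi>) (at \<epsilon>)" and "FL (q \<epsilon>) (v \<epsilon>) = 1"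
  shows "\<Phi> = (NL (q \<epsilon>) (v \<epsilon>) U / 2 + pL (q \<epsilon>) (v \<epsilon>) V) / DL (q \<epsilon>) (v \<epsilon>)"
proof -
  let ?q = "q \<epsilon>" and ?v = "v \<epsilon>"
  have D: "DL ?q ?v > 0" using FL_unit_iff[OF assms(1)] assms(5) by blast
  have b: "((\<lambda>e. b (q e)) has_real_derivative Db ?q U) (at \<epsilon>)"
    using has_derivative_along[OF q smooth_on_open_derivative(1)[OF b_smooth open_\<Omega> assms(1)]]
    by (simp add: Db_def)
  have w: "((\<lambda>e. w (q e) (v e)) has_real_derivative Dw ?q U ?v + w ?q V) (at \<epsilon>)"
    using linear_field_derivative[OF open_\<Omega> w_linear w_smooth assms(1) q v] by (simp add: Dw_def)
  have g: "((\<lambda>e. g (q e) (v e) (v e)) has_real_derivative Dg ?q U ?v ?v + g ?q V ?v + g ?q ?v V) (at \<epsilon>)"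
    using bilinear_field_derivative[OF open_\<Omega> g_linear g_linear1 g_smooth assms(1) q v v]
    by (simp add: Dg_def)
  have L: "((\<lambda>e. b (q e) * (FL (q e) (v e) * FL (q e) (v e))) has_real_derivative
      Db ?q U * (1 * 1) + (\<Phi> * 1 + \<Phi> * 1) * b ?q) (at \<epsilon>)"
    using DERIV_mult[OF b DERIV_mult[OF F F]] unfolding assms(5) .
  have R: "((\<lambda>e. 2 * \<sigma> * (w (q e) (v e) * FL (q e) (v e)) + g (q e) (v e) (v e)) has_real_derivative
      2 * \<sigma> * ((Dw ?q U ?v + w ?q V) * 1 + \<Phi> * w ?q ?v) + (Dg ?q U ?v ?v + g ?q V ?v + g ?q ?v V)) (at \<epsilon>)"
    using DERIV_add[OF DERIV_cmult[OF DERIV_mult[OF w F]] g] unfolding assms(5) .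
  have "\<forall>\<^sub>F e in nhds \<epsilon>. e \<in> UNIV \<longrightarrow> q e \<in> \<Omega>"
    using eventually_nhds_within_open[OF has_vector_derivative_continuous[OF q] open_\<Omega> assms(1)] .
  then have ev: "\<forall>\<^sub>F e in nhds \<epsilon>. e \<in> UNIV \<longrightarrow> 2 * \<sigma> * (w (q e) (v e) * FL (q e) (v e)) + g (q e) (v e) (v e)
      = b (q e) * (FL (q e) (v e) * FL (q e) (v e))"
  proof (rule eventually_mono)
    fix e assume "e \<in> UNIV \<longrightarrow> q e \<in> \<Omega>"
    then show "e \<in> UNIV \<longrightarrow> 2 * \<sigma> * (w (q e) (v e) * FL (q e) (v e)) + g (q e) (v e) (v e)
      = b (q e) * (FL (q e) (v e) * FL (q e) (v e))"
      using FL_quadratic[of "q e" "v e"] by (simp add: power2_eq_square)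
  qed
  have "Db ?q U * (1 * 1) + (\<Phi> * 1 + \<Phi> * 1) * b ?q =
     2 * \<sigma> * ((Dw ?q U ?v + w ?q V) * 1 + \<Phi> * w ?q ?v) + (Dg ?q U ?v ?v + g ?q V ?v + g ?q ?v V)"
    by (rule DERIV_unique[OF L has_real_derivative_transform_eventually[OF R ev]])
      (use FL_quadratic[OF assms(1), of ?v] in \<open>simp add: power2_eq_square\<close>)
  then have "2 * (DL ?q ?v * \<Phi>) = NL ?q ?v U + 2 * pL ?q ?v V"
    unfolding DL_def NL_def pL_def using g_sym[OF assms(1), of V ?v] by (simp add: algebra_simps)
  then show ?thesis using D by (simp add: field_simps)
qed

lemma DL_derivative:
  assumes "\<xi> s \<in> \<Omega>" and \<xi>: "(\<xi> has_vector_derivative v s) (at s within I)"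
    and v: "(v has_vector_derivative a) (at s within I)"
  shows "((\<lambda>t. DL (\<xi> t) (v t)) has_real_derivative DLdot (\<xi> s) (v s) a) (at s within I)"
proof -
  have b: "((\<lambda>e. b (\<xi> e)) has_real_derivative Db (\<xi> s) (v s)) (at s within I)"
    using has_derivative_along[OF \<xi> smooth_on_open_derivative(1)[OF b_smooth open_\<Omega> assms(1)]]
    by (simp add: Db_def)
  have w: "((\<lambda>e. w (\<xi> e) (v e)) has_real_derivative Dw (\<xi> s) (v s) (v s) + w (\<xi> s) a) (at s within I)"
    using linear_field_derivative[OF open_\<Omega> w_linear w_smooth assms(1) \<xi> v] by (simp add: Dw_def)
  show ?thesis using DERIV_diff[OF b DERIV_cmult[OF w, of \<sigma>]]
    unfolding DL_def DLdot_def by (simp add: algebra_simps)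
qed

text \<open>Integration by parts on the level of integrands. The first summand is the derivative of
  F from \<open>FL_variation\<close> when the velocity varies by U', so it differs from the total
  derivative of the paired momentum by the residual alone.\<close>

lemma momentum_derivative:
  assumes "\<xi> s \<in> \<Omega>" and \<xi>: "(\<xi> has_vector_derivative v s) (at s within I)"
    and v: "(v has_vector_derivative a) (at s within I)"
    and U: "(U has_vector_derivative U') (at s within I)" and "DL (\<xi> s) (v s) > 0"
  shows "((\<lambda>t. pL (\<xi> t) (v t) (U t) / DL (\<xi> t) (v t)) has_real_derivative
     (NL (\<xi> s) (v s) (U s) / 2 + pL (\<xi> s) (v s) U') / DL (\<xi> s) (v s)
       - res (\<xi> s) (v s) a (U s) / (DL (\<xi> s) (v s))\<^sup>2) (at s within I)"
proof -
  have w: "((\<lambda>e. w (\<xi> e) (U e)) has_real_derivative Dw (\<xi> s) (v s) (U s) + w (\<xi> s) U') (at s within I)"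
    using linear_field_derivative[OF open_\<Omega> w_linear w_smooth assms(1) \<xi> U] by (simp add: Dw_def)
  have g: "((\<lambda>e. g (\<xi> e) (v e) (U e)) has_real_derivative
      Dg (\<xi> s) (v s) (v s) (U s) + g (\<xi> s) a (U s) + g (\<xi> s) (v s) U') (at s within I)"
    using bilinear_field_derivative[OF open_\<Omega> g_linear g_linear1 g_smooth assms(1) \<xi> v U]
    by (simp add: Dg_def)
  have p: "((\<lambda>t. pL (\<xi> t) (v t) (U t)) has_real_derivative
      pLdot (\<xi> s) (v s) a (U s) + pL (\<xi> s) (v s) U') (at s within I)"
    using DERIV_add[OF DERIV_cmult[OF w, of \<sigma>] g]
    unfolding pL_def pLdot_def by (simp add: algebra_simps)
  \<comment> \<open>The quotient rule with n / 2 added and subtracted, where n stands for the value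
    of \<open>NL\<close>.\<close>
  have alg: "((pd + pu) * d - p * dd) / (d * d)
      = (n / 2 + pu) / d - (n * d / 2 - (pd * d - p * dd)) / d\<^sup>2"
    if "d > 0" for pd pu d p dd n :: real
    using that by (simp add: field_simps power2_eq_square)
  show ?thesis
    unfolding res_def alg[OF assms(5), symmetric]
    by (rule DERIV_divide[OF p DL_derivative[OF assms(1) \<xi> v]]) (use assms(5) in simp)
qed

text \<open>Used with the multiplier -1 to choose the sign of a nonzero residual, with the values of
  a bump function, and with 0 off its support.\<close>

lemma res_scale:
  assumes "q \<in> \<Omega>"
  shows "res q v a (c *\<^sub>R z) = c * res q v a z"
  unfolding res_def NL_def pLdot_def pL_def
  using linear_scale[OF Db_linear[OF assms]] linear_scale[OF Dw_linear(1)[OF assms]]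
    linear_scale[OF Dw_linear(2)[OF assms]] linear_scale[OF Dg_linear(1)[OF assms]]
    linear_scale[OF Dg_linear(2)[OF assms]] linear_scale[OF w_linear[OF assms]]
    linear_scale[OF g_linear[OF assms]]
  by (simp add: algebra_simps)

text \<open>The spacetime metric in a product chart. The time coordinate \<open>fst u\<close> does
  not occur, which is stationarity; accordingly \<open>DGm\<close> takes only the space part of a
  direction.\<close>

definition Gm :: "real \<times> 'e \<Rightarrow> real \<times> 'e \<Rightarrow> real \<times> 'e \<Rightarrow> real" where
  "Gm u V Z = - b (snd u) * fst V * fst Z + w (snd u) (snd V) * fst Z + fst V * w (snd u) (snd Z)
     + g (snd u) (snd V) (snd Z)"

definition DGm :: "'e \<Rightarrow> 'e \<Rightarrow> real \<times> 'e \<Rightarrow> real \<times> 'e \<Rightarrow> real" where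
  "DGm q x V Z = - Db q x * fst V * fst Z + Dw q x (snd V) * fst Z + fst V * Dw q x (snd Z)
     + Dg q x (snd V) (snd Z)"

lemma Gm_derivative:
  assumes "q \<in> \<Omega>"
  shows "((\<lambda>u. Gm u V Z) has_derivative (\<lambda>W. DGm q (snd W) V Z)) (at (t, q))"
proof -
  have c: "((\<lambda>u. f (snd u)) has_derivative (\<lambda>W. frechet_derivative f (at q) (snd W))) (at (t, q))"
    if "smooth_on \<Omega> f" for f :: "'e \<Rightarrow> real"
  proof -
    have "(f has_derivative frechet_derivative f (at q)) (at (snd (t, q)))"
      using smooth_on_open_derivative(1)[OF that open_\<Omega> assms] by simp
    then show ?thesis
      by (rule has_derivative_compose[OF has_derivative_snd[OF has_derivative_ident]])
  qed
  note [derivative_intros] = c[OF b_smooth] c[OF w_smooth[of "snd V"]] c[OF w_smooth[of "snd Z"]]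
    c[OF g_smooth[of "snd V" "snd Z"]]
  show ?thesis unfolding Gm_def DGm_def Db_def Dw_def Dg_def
    by (intro has_derivative_add has_derivative_mult_left has_derivative_mult_right
        has_derivative_minus derivative_intros)
qed

text \<open>Testing with (1, 0) gives w(v) = b \<tau>, and testing with (0, v) then gives b \<tau>^2
  + g(v, v) = 0, a sum of nonnegative terms although the metric itself is indefinite.\<close>

lemma Gm_nondegenerate:
  assumes "q \<in> \<Omega>" and "\<And>Z. Gm (t, q) V Z = 0"
  shows "V = 0"
proof -
  obtain \<tau> v where V: "V = (\<tau>, v)" by (cases V)
  have 1: "- b q * \<tau> + w q v = 0"
    using assms(2)[of "(1, 0)"] linear_0[OF w_linear[OF assms(1)]] linear_0[OF g_linear[OF assms(1)]]
    by (simp add: Gm_def V)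
  have 2: "\<tau> * w q v + g q v v = 0" using assms(2)[of "(0, v)"] by (simp add: Gm_def V)
  have "w q v = b q * \<tau>" using 1 by simp
  then have 3: "b q * \<tau>\<^sup>2 + g q v v = 0" using 2 by (simp add: power2_eq_square algebra_simps)
  have "v = 0"
  proof (rule ccontr)
    assume "v \<noteq> 0"
    then have "g q v v > 0" using g_pos[OF assms(1)] by blast
    moreover have "b q * \<tau>\<^sup>2 \<ge> 0" using b_pos[OF assms(1)] by simp
    ultimately show False using 3 by linarith
  qed
  then show ?thesis
    using 3 linear_0[OF g_linear[OF assms(1)]] b_pos[OF assms(1)] by (simp add: V zero_prod_def)
qed

text \<open>This is the geodesic equation of \<open>s \<mapsto> (k + \<sigma> h(s), x(h(s)))\<close>, with \<open>m = h'(s)\<close>, \<open>n = h''(s)\<close> and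
  \<open>q\<close>, \<open>v\<close>, \<open>a\<close> the position, velocity and acceleration of \<open>x\<close> at \<open>h(s)\<close>. Its time component says that
  \<open>h' DL\<close> is conserved; given this, its space components are the Euler-Lagrange equations of \<open>FL\<close>.\<close>

lemma geodesic_equation_iff:
  assumes "q \<in> \<Omega>" "m \<noteq> 0" "DL q v > 0"
    and M: "\<And>u V Z. snd u \<in> \<Omega> \<Longrightarrow> M u V Z = Gm u V Z" and V: "V = (\<sigma> * m, m *\<^sub>R v)"
  shows "(\<sigma> * n, n *\<^sub>R v + (m * m) *\<^sub>R a) + (THE A. \<forall>z. 2 * M (t, q) A z =
        frechet_derivative (\<lambda>u. M u V z) (at (t, q)) V + frechet_derivative (\<lambda>u. M u V z) (at (t, q)) V
        - frechet_derivative (\<lambda>u. M u V V) (at (t, q)) z) = 0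
    \<longleftrightarrow> n * DL q v + m * m * DLdot q v a = 0 \<and> (\<forall>z. res q v a z = 0)"
    (is "?Y + ?\<Gamma> = 0 \<longleftrightarrow> ?R")
proof -
  note lins = w_linear[OF assms(1)] g_linear[OF assms(1)] g_linear1[OF assms(1)]
    Db_linear[OF assms(1)] Dw_linear[OF assms(1)] Dg_linear[OF assms(1)]
  note adds = lins[THEN linear_add] lins[THEN linear_scale]
  \<comment> \<open>M is prescribed only over \<Omega>; agreement on the open cylinder over it
    transfers the derivatives of \<open>Gm\<close>.\<close>
  have "open (UNIV \<times> \<Omega> :: (real \<times> 'e) set)" by (intro open_Times open_UNIV open_\<Omega>)
  then have D: "frechet_derivative (\<lambda>u. M u V Z) (at (t, q)) = (\<lambda>W. DGm q (snd W) V Z)" for V Z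
  proof -
    have "((\<lambda>u. M u V Z) has_derivative (\<lambda>W. DGm q (snd W) V Z)) (at (t, q))"
      by (rule has_derivative_transform_within_open[OF Gm_derivative[OF assms(1)]
            \<open>open (UNIV \<times> \<Omega>)\<close>]) (use assms(1) in \<open>simp, metis M mem_Times_iff\<close>)
    then show ?thesis by (rule frechet_derivative_at[symmetric])
  qed
  have MG: "M (t, q) A z = Gm (t, q) A z" for A z using M assms(1) by simp
  define \<Lambda> where "\<Lambda> z = 2 * DGm q (snd V) V z - DGm q (snd z) V V" for z
  have \<Gamma>: "?\<Gamma> = (THE A. \<forall>z. 2 * Gm (t, q) A z = \<Lambda> z)"
    unfolding D MG \<Lambda>_def by simp
  have "linear \<Lambda>" unfolding \<Lambda>_def DGm_def
    by (intro linearI) (simp_all add: adds algebra_simps)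
  have lin: "linear (\<lambda>A. Gm (t, q) A z)" "linear (Gm (t, q) A)" for z A
    by (intro linearI; simp add: Gm_def adds algebra_simps)+
  have "?Y + ?\<Gamma> = 0 \<longleftrightarrow> (\<forall>z. 2 * Gm (t, q) ?Y z + \<Lambda> z = 0)"
    unfolding \<Gamma>
    by (rule nondegenerate_form_the[OF lin Gm_nondegenerate[OF assms(1)] \<open>linear \<Lambda>\<close>]) blast
  moreover have "2 * Gm (t, q) ?Y (\<tau>, x) + \<Lambda> (\<tau>, x) =
      - 2 * \<sigma> * \<tau> * (n * DL q v + m * m * DLdot q v a)
      + (2 * (n * pL q v x + m * m * pLdot q v a x) - m * m * NL q v x)" for \<tau> x
  proof -
    have \<sigma>: "\<sigma> * (\<sigma> * y) = y" for y using \<sigma>_sq by (simp add: mult.assoc[symmetric])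
    show ?thesis
      unfolding Gm_def \<Lambda>_def DGm_def V DL_def DLdot_def pL_def pLdot_def NL_def
      by (simp add: adds algebra_simps \<sigma>)
  qed
  moreover have "(\<forall>\<tau> x. - 2 * \<sigma> * \<tau> * (n * DL q v + m * m * DLdot q v a)
      + (2 * (n * pL q v x + m * m * pLdot q v a x) - m * m * NL q v x) = 0) \<longleftrightarrow> ?R" (is "?E \<longleftrightarrow> ?R")
  proof -
    \<comment> \<open>Multiplying the space component by \<open>DL\<close> lets the conservation law
      absorb the term with n; what remains is the residual.\<close>
    have key: "DL q v * (2 * (n * pL q v x + m * m * pLdot q v a x) - m * m * NL q v x)
      = 2 * pL q v x * (n * DL q v + m * m * DLdot q v a) - 2 * (m * m) * res q v a x" for x
      unfolding res_def by (simp add: algebra_simps)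
    have "\<sigma> \<noteq> 0" using \<sigma>_sq by auto
    show ?thesis
    proof
      assume E: ?E
      \<comment> \<open>Taking \<tau> = 0 isolates the space components; after that \<tau> = 1 gives
        the time component.\<close>
      have x: "2 * (n * pL q v x + m * m * pLdot q v a x) - m * m * NL q v x = 0" for x
        using E[rule_format, of 0 x] by simp
      then have 1: "n * DL q v + m * m * DLdot q v a = 0"
        using E[rule_format, of 1 0] \<open>\<sigma> \<noteq> 0\<close> by simp
      have "res q v a x = 0" for x using key[of x] unfolding x 1 using assms(2) by simp
      then show ?R using 1 by blast
    next
      assume R: ?R
      then have "DL q v * (2 * (n * pL q v x + m * m * pLdot q v a x) - m * m * NL q v x) = 0" for x
        using key[of x] by simp
      then have "2 * (n * pL q v x + m * m * pLdot q v a x) - m * m * NL q v x = 0" for x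
        using assms(3) by (metis less_irrefl mult_eq_0_iff)
      then show ?E using R by simp
    qed
  qed
  ultimately show ?thesis by simp
qed

end

section \<open>Charts, velocities and the product manifold\<close>

lemma eventually_openin:
  assumes "openin (top_of_set X) J" "s \<in> J"
  shows "\<forall>\<^sub>F r in nhds s. r \<in> X \<longrightarrow> r \<in> J"
proof -
  obtain U where "open U" "J = X \<inter> U" using assms openin_open by metis
  then have "\<forall>\<^sub>F r in nhds s. r \<in> U" using assms(2) by (intro eventually_nhds_in_open) auto
  then show ?thesis by (rule eventually_mono) (use \<open>J = X \<inter> U\<close> in blast)
qed

lemma cinv_cmap: "inj_on (cmap c) (cdom c) \<Longrightarrow> p \<in> cdom c \<Longrightarrow> cinv c (cmap c p) = p"
  by (simp add: cinv_def)

lemma cmap_cinv: "u \<in> cimage c \<Longrightarrow> cmap c (cinv c u) = u"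
  by (simp add: cinv_def f_inv_into_f)

lemma cinv_in_cdom: "u \<in> cimage c \<Longrightarrow> cinv c u \<in> cdom c"
  by (simp add: cinv_def inv_into_into)

lemma fst_coord_vec [simp]: "fst (coord_vec A c p v) = p"
  by (simp add: coord_vec_def)

lemma snd_coord_vec_self:
  assumes "c \<in> A" "p \<in> cdom c" "open (cimage c)"
  shows "snd (coord_vec A c p v) c = v"
proof -
  have "((cmap c \<circ> cinv c) has_derivative (\<lambda>v. v)) (at (cmap c p))"
    by (rule has_derivative_transform_within_open[OF has_derivative_ident assms(3)])
      (use assms(2) in \<open>auto simp: cmap_cinv\<close>)
  from frechet_derivative_at[OF this, symmetric] assms show ?thesis by (simp add: coord_vec_def)
qed

text \<open>A velocity stores one component per chart, and the chain rule through the transition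
  maps recovers them all from the chart c. As the curve is in c only near s, it is compared with the
  composite for nearby parameters in I.\<close>

lemma velocity_eq_coord_vec:
  assumes "c \<in> A" "inj_on (cmap c) (cdom c)" "x s \<in> cdom c"
    and tr: "\<And>d. d \<in> A \<Longrightarrow> x s \<in> cdom d \<Longrightarrow> (cmap d \<circ> cinv c) differentiable at (cmap c (x s))"
    and ev: "\<forall>\<^sub>F r in nhds s. r \<in> I \<longrightarrow> x r \<in> cdom c" and "at s within I \<noteq> bot"
    and v: "((cmap c \<circ> x) has_vector_derivative v) (at s within I)"
  shows "velocity A I x s = coord_vec A c (x s) v"
proof -
  have "vector_derivative (cmap d \<circ> x) (at s within I)
      = frechet_derivative (cmap d \<circ> cinv c) (at (cmap c (x s))) v"
    if d: "d \<in> A" "x s \<in> cdom d" for d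
  proof (rule vector_derivative_within[OF \<open>at s within I \<noteq> bot\<close>])
    have "((cmap d \<circ> cinv c) has_derivative frechet_derivative (cmap d \<circ> cinv c) (at (cmap c (x s))))
        (at ((cmap c \<circ> x) s))"
      using tr[OF d] by (simp add: frechet_derivative_works)
    then have *: "(((cmap d \<circ> cinv c) \<circ> (cmap c \<circ> x)) has_vector_derivative
        frechet_derivative (cmap d \<circ> cinv c) (at (cmap c (x s))) v) (at s within I)"
      by (rule vector_derivative_diff_chain_within[OF v has_derivative_at_withinI])
    have "\<forall>\<^sub>F r in nhds s. r \<in> I \<longrightarrow> ((cmap d \<circ> cinv c) \<circ> (cmap c \<circ> x)) r = (cmap d \<circ> x) r"
      using ev by (rule eventually_mono) (simp add: cinv_cmap assms(2))
    then show "((cmap d \<circ> x) has_vector_derivative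
        frechet_derivative (cmap d \<circ> cinv c) (at (cmap c (x s))) v) (at s within I)"
      using * assms(2,3) by (subst (asm) has_vector_derivative_cong_ev) (simp_all add: cinv_cmap)
  qed
  then show ?thesis unfolding velocity_def coord_vec_def by (auto simp: fun_eq_iff)
qed

section \<open>Charts and curves on one manifold\<close>

locale smooth_mfd =
  fixes S :: "'a topology" and A :: "('a, 'e::euclidean_space) chart set"
  assumes mfd: "smooth_manifold S A"
begin

lemma chart_openin: "c \<in> A \<Longrightarrow> openin S (cdom c)"
  and chart_open: "c \<in> A \<Longrightarrow> open (cimage c)"
  and chart_homeomorphic: "c \<in> A \<Longrightarrow>
    homeomorphic_map (subtopology S (cdom c)) (top_of_set (cimage c)) (cmap c)"
  and transition_smooth: "c \<in> A \<Longrightarrow> d \<in> A \<Longrightarrow>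
    smooth_on (cmap c ` (cdom c \<inter> cdom d)) (cmap d \<circ> cinv c)"
  and chart_cover: "p \<in> topspace S \<Longrightarrow> \<exists>c\<in>A. p \<in> cdom c"
  using mfd unfolding smooth_manifold_def by blast+

lemma topspace_chart: "c \<in> A \<Longrightarrow> topspace (subtopology S (cdom c)) = cdom c"
  using openin_subset[OF chart_openin] by auto

lemma chart_inj: "c \<in> A \<Longrightarrow> inj_on (cmap c) (cdom c)"
  using homeomorphic_imp_injective_map[OF chart_homeomorphic] by (simp only: topspace_chart)

lemma chart_image_open:
  assumes "c \<in> A" "openin S U"
  shows "open (cmap c ` (cdom c \<inter> U))"
proof -
  have "openin (subtopology S (cdom c)) (cdom c \<inter> U)"
    using assms(2) by (auto simp: openin_subtopology)
  then have "openin (top_of_set (cimage c)) (cmap c ` (cdom c \<inter> U))"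
    using homeomorphic_imp_open_map[OF chart_homeomorphic[OF assms(1)]] unfolding open_map_def by blast
  then show ?thesis using chart_open[OF assms(1)] openin_open_eq by blast
qed

lemma transition_differentiable:
  assumes "c \<in> A" "d \<in> A" "p \<in> cdom c" "p \<in> cdom d"
  shows "(cmap d \<circ> cinv c) differentiable at (cmap c p)"
  using smooth_on_open_derivative(1)[OF transition_smooth[OF assms(1,2)]
      chart_image_open[OF assms(1) chart_openin[OF assms(2)]]] assms
  unfolding differentiable_def by blast

lemma coord_vec_scale:
  assumes "c \<in> A" "p \<in> cdom c"
  shows "coord_vec A c p (r *\<^sub>R v) = (p, \<lambda>d. r *\<^sub>R snd (coord_vec A c p v) d)"
proof -
  have "frechet_derivative (cmap d \<circ> cinv c) (at (cmap c p)) (r *\<^sub>R v)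
      = r *\<^sub>R frechet_derivative (cmap d \<circ> cinv c) (at (cmap c p)) v"
    if "d \<in> A" "p \<in> cdom d" for d
    using transition_differentiable[OF assms(1) that(1) assms(2) that(2)]
    by (intro linear_scale linear_frechet_derivative)
  then show ?thesis by (auto simp: coord_vec_def fun_eq_iff)
qed

lemma smooth_into_openin:
  assumes "smooth_into S A X x" "openin S U"
  shows "openin (top_of_set X) {s \<in> X. x s \<in> U}"
  using openin_continuous_map_preimage[of "top_of_set X" S x U] assms unfolding smooth_into_def by simp

lemma smooth_into_topspace: "smooth_into S A X x \<Longrightarrow> s \<in> X \<Longrightarrow> x s \<in> topspace S"
  unfolding smooth_into_def continuous_map_def by auto

lemma smooth_into_compose:
  assumes "smooth_into S A Y H" "smooth_on X f" "f ` X \<subseteq> Y"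
  shows "smooth_into S A X (\<lambda>s. H (f s))"
  unfolding smooth_into_def
proof (intro conjI ballI)
  have "continuous_map (top_of_set X) (top_of_set Y) f"
    using smooth_on_imp_continuous_on[OF assms(2)] assms(3) by (simp add: image_subset_iff_funcset)
  then show "continuous_map (top_of_set X) S (\<lambda>s. H (f s))"
    using continuous_map_compose[of _ _ f S H] assms(1) unfolding smooth_into_def comp_def by blast
  fix c assume "c \<in> A"
  then have "smooth_on {s\<in>Y. H s \<in> cdom c} (cmap c \<circ> H)" using assms(1) by (simp add: smooth_into_def)
  then show "smooth_on {s \<in> X. H (f s) \<in> cdom c} (cmap c \<circ> (\<lambda>s. H (f s)))"
    using smooth_on_compose[of _ "cmap c \<circ> H" "{s \<in> X. H (f s) \<in> cdom c}" f]
      smooth_on_subset[OF assms(2)] assms(3) by (auto simp: comp_def image_subset_iff)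
qed

text \<open>J is relatively open in X, so derivatives within J and within X agree. Thus velocity and
  acceleration can be taken within the whole interval, as the definitions of geodesics do, while
  smoothness is known on the part inside the chart.\<close>

lemma smooth_into_chart:
  fixes x :: "real \<Rightarrow> 'a"
  assumes x: "smooth_into S A X x" and "spread X" "c \<in> A"
  defines "J \<equiv> {s \<in> X. x s \<in> cdom c}"
    and "v \<equiv> \<lambda>s. vector_derivative (cmap c \<circ> x) (at s within X)"
  shows "openin (top_of_set X) J" "spread J" "smooth_on J (cmap c \<circ> x)" "smooth_on J v"
    "smooth_on J (\<lambda>s. vector_derivative v (at s within X))"
    "s \<in> J \<Longrightarrow> at s within J = at s within X"
    "s \<in> J \<Longrightarrow> at s within X \<noteq> bot"
    "s \<in> J \<Longrightarrow> ((cmap c \<circ> x) has_vector_derivative v s) (at s within X)"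
    "s \<in> J \<Longrightarrow> (v has_vector_derivative vector_derivative v (at s within X)) (at s within X)"
    "s \<in> J \<Longrightarrow> velocity A X x s = coord_vec A c (x s) (v s)"
    "(\<lambda>s. cmap c (x s)) ` J \<subseteq> cimage c"
proof -
  show J: "openin (top_of_set X) J"
    unfolding J_def by (rule smooth_into_openin[OF x chart_openin[OF \<open>c \<in> A\<close>]])
  show sp: "spread J" by (rule spread_openin[OF \<open>spread X\<close> J])
  show sx: "smooth_on J (cmap c \<circ> x)" using x \<open>c \<in> A\<close> by (simp add: smooth_into_def J_def)
  have at: "at s within J = at s within X" if "s \<in> J" for s by (rule at_within_openin[OF J that])
  have v': "smooth_on J (\<lambda>s. vector_derivative (cmap c \<circ> x) (at s within J))"
    by (rule smooth_on_vector_derivative(2)[OF sx sp])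
  show sv: "smooth_on J v" by (rule smooth_on_transform[OF v']) (simp add: v_def at)
  have a': "smooth_on J (\<lambda>s. vector_derivative v (at s within J))"
    by (rule smooth_on_vector_derivative(2)[OF sv sp])
  show "smooth_on J (\<lambda>s. vector_derivative v (at s within X))"
    by (rule smooth_on_transform[OF a']) (simp add: at)
  show "at s within J = at s within X" if "s \<in> J" using that by (rule at)
  show nb: "at s within X \<noteq> bot" if "s \<in> J"
    using spread_real_at_within[OF \<open>spread X\<close>, of s] that by (simp add: J_def)
  show vd: "((cmap c \<circ> x) has_vector_derivative v s) (at s within X)" if "s \<in> J"
    using smooth_on_vector_derivative(1)[OF sx sp that] at[OF that] by (simp add: v_def)
  show "(v has_vector_derivative vector_derivative v (at s within X)) (at s within X)" if "s \<in> J"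
    using smooth_on_vector_derivative(1)[OF sv sp that] at[OF that] by simp
  show "velocity A X x s = coord_vec A c (x s) (v s)" if "s \<in> J"
  proof (rule velocity_eq_coord_vec[OF \<open>c \<in> A\<close> chart_inj[OF \<open>c \<in> A\<close>] _ _ _ nb[OF that] vd[OF that]])
    show xs: "x s \<in> cdom c" using that by (simp add: J_def)
    show "(cmap d \<circ> cinv c) differentiable at (cmap c (x s))" if "d \<in> A" "x s \<in> cdom d" for d
      by (rule transition_differentiable[OF \<open>c \<in> A\<close> that(1) xs that(2)])
    show "\<forall>\<^sub>F r in nhds s. r \<in> X \<longrightarrow> x r \<in> cdom c"
      using eventually_openin[OF J that] by (rule eventually_mono) (simp add: J_def)
  qed
  show "(\<lambda>s. cmap c (x s)) ` J \<subseteq> cimage c" by (auto simp: J_def)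
qed

section \<open>The product with the real line\<close>

abbreviation "LA \<equiv> line_product_atlas A"
abbreviation "lpc \<equiv> line_product_chart"

lemma cdom_line_product [simp]: "cdom (lpc c) = UNIV \<times> cdom c"
  and cmap_line_product [simp]: "cmap (lpc c) (t, p) = (t, cmap c p)"
  and cimage_line_product: "cimage (lpc c) = UNIV \<times> cimage c"
  by (auto simp: line_product_chart_def image_iff)

lemma line_product_inj: "c \<in> A \<Longrightarrow> inj_on (cmap (lpc c)) (cdom (lpc c))"
  using chart_inj[of c] by (auto simp: inj_on_def)

lemma cinv_line_product:
  assumes "c \<in> A" "u \<in> cimage c"
  shows "cinv (lpc c) (t, u) = (t, cinv c u)"
  using cinv_cmap[OF line_product_inj[OF assms(1)], of "(t, cinv c u)"] cinv_in_cdom[OF assms(2)]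
    cmap_cinv[OF assms(2)] by simp

lemma open_line_product: "c \<in> A \<Longrightarrow> open (cimage (lpc c))"
  unfolding cimage_line_product by (intro open_Times open_UNIV chart_open)

lemma line_product_atlas_mem: "c \<in> A \<Longrightarrow> lpc c \<in> LA"
  by (simp add: line_product_atlas_def)

lemma line_product_transition:
  assumes "c \<in> A" "d \<in> A" "p \<in> cdom c" "p \<in> cdom d"
  shows "((cmap (lpc d) \<circ> cinv (lpc c)) has_derivative
    (\<lambda>V. (fst V, frechet_derivative (cmap d \<circ> cinv c) (at (cmap c p)) (snd V)))) (at (t, cmap c p))"
proof -
  have "((cmap d \<circ> cinv c) has_derivative frechet_derivative (cmap d \<circ> cinv c) (at (cmap c p)))
      (at (snd (t, cmap c p)))"
    using transition_differentiable[OF assms] by (simp add: frechet_derivative_works)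
  then have "((\<lambda>V. (cmap d \<circ> cinv c) (snd V)) has_derivative
      (\<lambda>V. frechet_derivative (cmap d \<circ> cinv c) (at (cmap c p)) (snd V))) (at (t, cmap c p))"
    by (rule has_derivative_compose[OF has_derivative_snd[OF has_derivative_ident]])
  from has_derivative_Pair[OF has_derivative_fst[OF has_derivative_ident] this]
  show ?thesis
  proof (rule has_derivative_transform_within_open[OF _ open_line_product[OF assms(1)]])
    show "(t, cmap c p) \<in> cimage (lpc c)" unfolding cimage_line_product using assms(3) by blast
    show "(fst z, (cmap d \<circ> cinv c) (snd z)) = (cmap (lpc d) \<circ> cinv (lpc c)) z"
      if "z \<in> cimage (lpc c)" for z
      using that cinv_line_product[OF assms(1), of "snd z" "fst z"]
      by (cases z) (auto simp: cimage_line_product)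
  qed
qed

text \<open>The choice behind \<open>chart_at\<close> is opaque: it is known only to be some product
  chart around the point, so the differentials of the projections are computed for an arbitrary such
  d.\<close>

lemma chart_at_line_product:
  assumes "c \<in> A" "p \<in> cdom c"
  shows "\<exists>d\<in>A. p \<in> cdom d \<and> chart_at LA (t, p) = lpc d"
proof -
  have "lpc c \<in> LA \<and> (t, p) \<in> cdom (lpc c)" using assms line_product_atlas_mem by simp
  then have "chart_at LA (t, p) \<in> LA \<and> (t, p) \<in> cdom (chart_at LA (t, p))"
    unfolding chart_at_def by (rule someI)
  then show ?thesis by (auto simp: line_product_atlas_def)
qed

lemma snd_coord_vec_line_product:
  assumes "c \<in> A" "d \<in> A" "p \<in> cdom c" "p \<in> cdom d"
  shows "snd (coord_vec LA (lpc c) (t, p) V) (lpc d)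
    = (fst V, frechet_derivative (cmap d \<circ> cinv c) (at (cmap c p)) (snd V))"
  using frechet_derivative_at[OF line_product_transition[OF assms, of t], symmetric] assms
  by (simp add: coord_vec_def line_product_atlas_mem)

lemma differential_fst:
  assumes "c \<in> A" "p \<in> cdom c"
  shows "differential LA fst (coord_vec LA (lpc c) (t, p) V) = fst V"
proof -
  obtain d where d: "d \<in> A" "p \<in> cdom d" "chart_at LA (t, p) = lpc d"
    using chart_at_line_product[OF assms] by blast
  have "((fst \<circ> cinv (lpc d)) has_derivative fst) (at (t, cmap d p))"
  proof (rule has_derivative_transform_within_open[OF has_derivative_fst[OF has_derivative_ident]
        open_line_product[OF d(1)]])
    show "(t, cmap d p) \<in> cimage (lpc d)" unfolding cimage_line_product using d(2) by blast
    show "fst z = (fst \<circ> cinv (lpc d)) z" if "z \<in> cimage (lpc d)" for z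
      using that cinv_line_product[OF d(1), of "snd z" "fst z"]
      by (cases z) (auto simp: cimage_line_product)
  qed
  from frechet_derivative_at[OF this, symmetric] show ?thesis
    unfolding differential_def fst_coord_vec Let_def d(3)
    using snd_coord_vec_line_product[OF assms(1) d(1) assms(2) d(2)] by simp
qed

text \<open>Independence of the chosen chart is the cocycle rule: the transition from c to d
  followed by that from d to e is the transition from c to e near the point.\<close>

lemma tangent_map_snd:
  assumes "c \<in> A" "p \<in> cdom c"
  shows "tangent_map LA A snd (coord_vec LA (lpc c) (t, p) V) = coord_vec A c p (snd V)"
proof -
  obtain d where d: "d \<in> A" "p \<in> cdom d" "chart_at LA (t, p) = lpc d"
    using chart_at_line_product[OF assms] by blast
  have "frechet_derivative (cmap e \<circ> snd \<circ> cinv (lpc d)) (at (t, cmap d p))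
        (fst V, frechet_derivative (cmap d \<circ> cinv c) (at (cmap c p)) (snd V))
      = frechet_derivative (cmap e \<circ> cinv c) (at (cmap c p)) (snd V)"
    if e: "e \<in> A" "p \<in> cdom e" for e
  proof -
    let ?De = "frechet_derivative (cmap e \<circ> cinv d) (at (cmap d p))"
    let ?Dd = "frechet_derivative (cmap d \<circ> cinv c) (at (cmap c p))"
    have De: "((cmap e \<circ> cinv d) has_derivative ?De) (at (cmap d p))"
      and Dd: "((cmap d \<circ> cinv c) has_derivative ?Dd) (at (cmap c p))"
      using transition_differentiable[OF d(1) e(1) d(2) e(2)]
        transition_differentiable[OF assms(1) d(1) assms(2) d(2)]
      by (simp_all add: frechet_derivative_works)
    have "((\<lambda>z. (cmap e \<circ> cinv d) (snd z)) has_derivative (\<lambda>W. ?De (snd W))) (at (t, cmap d p))"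
      by (rule has_derivative_compose[OF has_derivative_snd[OF has_derivative_ident]])
        (simp only: snd_conv De)
    then have "((cmap e \<circ> snd \<circ> cinv (lpc d)) has_derivative (\<lambda>W. ?De (snd W))) (at (t, cmap d p))"
    proof (rule has_derivative_transform_within_open[OF _ open_line_product[OF d(1)]])
      show "(t, cmap d p) \<in> cimage (lpc d)" unfolding cimage_line_product using d(2) by blast
      show "(cmap e \<circ> cinv d) (snd z) = (cmap e \<circ> snd \<circ> cinv (lpc d)) z" if "z \<in> cimage (lpc d)" for z
        using that cinv_line_product[OF d(1), of "snd z" "fst z"]
        by (cases z) (auto simp: cimage_line_product)
    qed
    note 1 = frechet_derivative_at[OF this, symmetric]
    have "((cmap d \<circ> cinv c) (cmap c p)) = cmap d p"
      using cinv_cmap[OF chart_inj[OF assms(1)] assms(2)] by simp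
    then have "((cmap e \<circ> cinv d) \<circ> (cmap d \<circ> cinv c) has_derivative ?De \<circ> ?Dd) (at (cmap c p))"
      using De by (intro diff_chain_at[OF Dd]) simp
    then have "((cmap e \<circ> cinv c) has_derivative ?De \<circ> ?Dd) (at (cmap c p))"
    proof (rule has_derivative_transform_within_open[OF _
          chart_image_open[OF assms(1) chart_openin[OF d(1)]]])
      show "cmap c p \<in> cmap c ` (cdom c \<inter> cdom d)" using assms(2) d(2) by blast
      show "((cmap e \<circ> cinv d) \<circ> (cmap d \<circ> cinv c)) u = (cmap e \<circ> cinv c) u"
        if "u \<in> cmap c ` (cdom c \<inter> cdom d)" for u
        using that cinv_cmap[OF chart_inj[OF assms(1)]] cinv_cmap[OF chart_inj[OF d(1)]] by auto
    qed
    note 2 = frechet_derivative_at[OF this, symmetric]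
    show ?thesis unfolding 1 2 by simp
  qed
  then show ?thesis
    unfolding tangent_map_def fst_coord_vec Let_def d(3)
    using snd_coord_vec_line_product[OF assms(1) d(1) assms(2) d(2)]
    by (auto simp: coord_vec_def fun_eq_iff)
qed

lemma stationary_metric_coord:
  assumes "c \<in> A" "p \<in> cdom c"
  shows "stationary_metric A \<beta> \<omega> g\<^sub>0 (coord_vec LA (lpc c) (t, p) V) (coord_vec LA (lpc c) (t, p) Z)
    = - \<beta> p * fst V * fst Z + \<omega> (coord_vec A c p (snd V)) * fst Z + fst V * \<omega> (coord_vec A c p (snd Z))
      + g\<^sub>0 (coord_vec A c p (snd V)) (coord_vec A c p (snd Z))"
  unfolding stationary_metric_def Let_def differential_fst[OF assms] tangent_map_snd[OF assms] by simp

lemma velocity_line_product: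
  assumes "c \<in> A" "x s \<in> cdom c"
    and ev: "\<forall>\<^sub>F r in nhds s. r \<in> I \<longrightarrow> x r \<in> cdom c" and "at s within I \<noteq> bot"
    and \<tau>: "(\<tau> has_vector_derivative \<tau>') (at s within I)"
    and v: "((cmap c \<circ> x) has_vector_derivative v) (at s within I)"
  shows "velocity LA I (\<lambda>s. (\<tau> s, x s)) s = coord_vec LA (lpc c) (\<tau> s, x s) (\<tau>', v)"
proof (rule velocity_eq_coord_vec[OF line_product_atlas_mem[OF assms(1)] line_product_inj[OF assms(1)]
      _ _ _ assms(4)])
  show "(\<tau> s, x s) \<in> cdom (lpc c)" using assms(2) by simp
  show "(cmap d \<circ> cinv (lpc c)) differentiable at (cmap (lpc c) (\<tau> s, x s))"
    if d: "d \<in> LA" "(\<tau> s, x s) \<in> cdom d" for d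
  proof -
    obtain e where "d = lpc e" "e \<in> A" using d(1) by (auto simp: line_product_atlas_def)
    then show ?thesis
      using line_product_transition[OF assms(1) \<open>e \<in> A\<close> assms(2), of "\<tau> s"] d(2)
      unfolding differentiable_def by auto
  qed
  show "\<forall>\<^sub>F r in nhds s. r \<in> I \<longrightarrow> (\<tau> r, x r) \<in> cdom (lpc c)" using ev by simp
  have "cmap (lpc c) \<circ> (\<lambda>s. (\<tau> s, x s)) = (\<lambda>s. (\<tau> s, (cmap c \<circ> x) s))" by auto
  then show "((cmap (lpc c) \<circ> (\<lambda>s. (\<tau> s, x s))) has_vector_derivative (\<tau>', v)) (at s within I)"
    using has_vector_derivative_Pair[OF \<tau> v] by simp
qed

lemma time_field_coord:
  assumes "c \<in> A" "p \<in> cdom c"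
  shows "time_field A (t, p) = coord_vec LA (lpc c) (t, p) (1, 0)"
proof -
  have "velocity LA UNIV (\<lambda>s. (s, p)) t = coord_vec LA (lpc c) (t, p) (1, 0)"
    using assms has_vector_derivative_id[of "at t within UNIV"]
    by (intro velocity_line_product[where \<tau> = "\<lambda>s. s" and x = "\<lambda>s. p"])
      (simp_all add: comp_def id_def)
  then show ?thesis by (simp add: time_field_def)
qed

lemma smooth_into_line_product:
  assumes "smooth_on X \<tau>"
  shows "smooth_into (line_product S) LA X (\<lambda>s. (\<tau> s, x s)) \<longleftrightarrow> smooth_into S A X x"
proof -
  have "continuous_map (top_of_set X) (line_product S) (\<lambda>s. (\<tau> s, x s)) \<longleftrightarrow>
      continuous_map (top_of_set X) S x"
    unfolding line_product_def continuous_map_paired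
    using smooth_on_imp_continuous_on[OF assms] by simp
  moreover have "smooth_on {s \<in> X. (\<tau> s, x s) \<in> cdom (lpc c)} (cmap (lpc c) \<circ> (\<lambda>s. (\<tau> s, x s)))
      \<longleftrightarrow> smooth_on {s \<in> X. x s \<in> cdom c} (cmap c \<circ> x)" for c :: "('a, 'e) chart"
  proof -
    let ?J = "{s \<in> X. x s \<in> cdom c}"
    have eq: "{s \<in> X. (\<tau> s, x s) \<in> cdom (lpc c)} = ?J"
      "cmap (lpc c) \<circ> (\<lambda>s. (\<tau> s, x s)) = (\<lambda>s. (\<tau> s, (cmap c \<circ> x) s))" by auto
    have "smooth_on ?J \<tau>" by (rule smooth_on_subset[OF assms]) auto
    then show ?thesis unfolding eq
      using smooth_on_Pair[of ?J \<tau> "cmap c \<circ> x"]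
        smooth_on_linear_compose[OF bounded_linear_snd, of ?J "\<lambda>s. (\<tau> s, (cmap c \<circ> x) s)"]
      unfolding snd_conv comp_def by blast
  qed
  ultimately show ?thesis unfolding smooth_into_def line_product_atlas_def by simp
qed

end

section \<open>Lightlike geodesics in terms of the Fermat metric\<close>

text \<open>The formula for F is imposed on vectors of the form \<open>coord_vec\<close>, where
  \<omega> and \<open>g\<^sub>0\<close> are linear. The Fermat metric satisfies it with \<sigma> =
  1, and by this linearity the reverse metric does with \<sigma> = -1.\<close>

locale fermat_spacetime = smooth_mfd S A
  for S :: "'a topology" and A :: "('a, 'e::euclidean_space) chart set" +
  fixes \<beta> :: "'a \<Rightarrow> real" and \<omega> :: "('a, 'e) tvec \<Rightarrow> real"
    and g\<^sub>0 :: "('a, 'e) tvec \<Rightarrow> ('a, 'e) tvec \<Rightarrow> real" and \<sigma> :: real and F :: "('a, 'e) tvec \<Rightarrow> real"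
  assumes riem: "riemannian_metric A g\<^sub>0" and one_form: "smooth_one_form A \<omega>"
    and \<beta>_smooth: "smooth_function A \<beta>" and \<beta>_pos: "p \<in> topspace S \<Longrightarrow> \<beta> p > 0"
    and sigma_sq: "\<sigma> * \<sigma> = 1"
    and F_coord: "c \<in> A \<Longrightarrow> p \<in> cdom c \<Longrightarrow> F (coord_vec A c p v) =
      \<sigma> * \<omega> (coord_vec A c p v) / \<beta> p + sqrt (g\<^sub>0 (coord_vec A c p v) (coord_vec A c p v) / \<beta> p
        + (\<omega> (coord_vec A c p v))\<^sup>2 / (\<beta> p)\<^sup>2)"
begin

abbreviation "bC c \<equiv> \<beta> \<circ> cinv c"
abbreviation "wC c \<equiv> \<lambda>q v. \<omega> (coord_vec A c (cinv c q) v)"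
abbreviation "gC c \<equiv> metric_rep A g\<^sub>0 c"
abbreviation "FC c \<equiv> fermat_model.FL (bC c) (wC c) (gC c) \<sigma>"
abbreviation "DC c \<equiv> fermat_model.DL (bC c) (wC c) \<sigma>"
abbreviation "DdotC c \<equiv> fermat_model.DLdot (bC c) (wC c) \<sigma>"
abbreviation "pC c \<equiv> fermat_model.pL (wC c) (gC c) \<sigma>"
abbreviation "resC c \<equiv> fermat_model.res (bC c) (wC c) (gC c) \<sigma>"
abbreviation "g \<equiv> stationary_metric A \<beta> \<omega> g\<^sub>0"

lemma chart_model:
  assumes "c \<in> A"
  shows "fermat_model (cimage c) (bC c) (wC c) (gC c) \<sigma>"
proof (rule fermat_model.intro)
  show "open (cimage c)" by (rule chart_open[OF assms])
  show "smooth_on (cimage c) (bC c)" using \<beta>_smooth assms by (simp add: smooth_function_def)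
  show "bC c q > 0" if "q \<in> cimage c" for q
    using \<beta>_pos cinv_in_cdom[OF that] openin_subset[OF chart_openin[OF assms]] by auto
  show "linear (wC c q)" if "q \<in> cimage c" for q
    using one_form assms cinv_in_cdom[OF that] by (simp add: smooth_one_form_def)
  show "smooth_on (cimage c) (\<lambda>q. wC c q v)" for v
    using one_form assms by (simp add: smooth_one_form_def)
  show "linear (gC c q v)" if "q \<in> cimage c" for q v
    using riem assms that unfolding riemannian_metric_def by blast
  show "gC c q v u = gC c q u v" if "q \<in> cimage c" for q v u
    using riem assms that unfolding riemannian_metric_def by blast
  show "gC c q v v > 0" if "q \<in> cimage c" "v \<noteq> 0" for q v
    using riem assms that unfolding riemannian_metric_def by blast
  show "smooth_on (cimage c) (\<lambda>q. gC c q v u)" for v u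
    using riem assms unfolding riemannian_metric_def by blast
  show "\<sigma> * \<sigma> = 1" by (rule sigma_sq)
qed

lemma coord_forms:
  assumes "c \<in> A" "p \<in> cdom c"
  shows "\<omega> (coord_vec A c p v) = wC c (cmap c p) v"
    "g\<^sub>0 (coord_vec A c p v) (coord_vec A c p u) = gC c (cmap c p) v u"
  using cinv_cmap[OF chart_inj[OF assms(1)] assms(2)] by (simp_all add: metric_rep_def)

lemma F_coord_FC:
  assumes "c \<in> A" "p \<in> cdom c"
  shows "F (coord_vec A c p v) = FC c (cmap c p) v"
  unfolding F_coord[OF assms] fermat_model.FL_def[OF chart_model[OF assms(1)]] coord_forms[OF assms]
  by (simp add: cinv_cmap[OF chart_inj[OF assms(1)] assms(2)])

lemma metric_rep_Gm:
  assumes "c \<in> A" "snd u \<in> cimage c"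
  shows "metric_rep LA g (lpc c) u V Z = fermat_model.Gm (bC c) (wC c) (gC c) u V Z"
proof -
  obtain t q where u: "u = (t, q)" "q \<in> cimage c" using assms(2) by (cases u) auto
  show ?thesis
    unfolding metric_rep_def[of LA] u(1) cinv_line_product[OF assms(1) u(2)]
      stationary_metric_coord[OF assms(1) cinv_in_cdom[OF u(2)]]
      fermat_model.Gm_def[OF chart_model[OF assms(1)]]
    by (simp add: metric_rep_def)
qed

text \<open>The quantity D without charts; up to the factor -\<sigma> it is the product of the
  spacetime velocity with the time field. Living on the whole interval, it can be integrated to
  produce the reparametrization.\<close>

definition speed_defect :: "real set \<Rightarrow> (real \<Rightarrow> 'a) \<Rightarrow> real \<Rightarrow> real" where
  "speed_defect I x s = \<beta> (x s) - \<sigma> * \<omega> (velocity A I x s)"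

end

locale fermat_curve = fermat_spacetime S A \<beta> \<omega> g\<^sub>0 \<sigma> F
  for S :: "'a topology" and A :: "('a, 'e::euclidean_space) chart set"
    and \<beta> \<omega> g\<^sub>0 \<sigma> F +
  fixes a b :: real and x :: "real \<Rightarrow> 'a" and I :: "real set"
  assumes ab: "a < b" and I: "I = {a..b}" and x_smooth: "smooth_into S A I x"
begin

abbreviation "\<xi> c \<equiv> cmap c \<circ> x"
abbreviation "\<nu> c \<equiv> \<lambda>s. vector_derivative (cmap c \<circ> x) (at s within I)"
abbreviation "acc c \<equiv> \<lambda>s. vector_derivative (\<nu> c) (at s within I)"
abbreviation "J c \<equiv> {s \<in> I. x s \<in> cdom c}"

lemma spread_I: "spread I"
  unfolding I by (rule spread_Icc[OF ab])

lemmas x_chart = smooth_into_chart[OF x_smooth spread_I]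

lemma chart_exists: "s \<in> I \<Longrightarrow> \<exists>c\<in>A. s \<in> J c"
  using chart_cover[OF smooth_into_topspace[OF x_smooth]] by blast

lemma \<xi>_in:
  assumes "s \<in> J c"
  shows "\<xi> c s \<in> cimage c"
  using assms by simp

lemma velocity_chart: "c \<in> A \<Longrightarrow> s \<in> J c \<Longrightarrow> velocity A I x s = coord_vec A c (x s) (\<nu> c s)"
  by (rule x_chart(10))

lemma F_velocity:
  assumes "c \<in> A" "s \<in> J c"
  shows "F (velocity A I x s) = FC c (\<xi> c s) (\<nu> c s)"
  unfolding velocity_chart[OF assms] using assms by (simp add: F_coord_FC)

lemma speed_defect_chart:
  assumes "c \<in> A" "s \<in> J c"
  shows "speed_defect I x s = DC c (\<xi> c s) (\<nu> c s)"
proof -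
  have xs: "x s \<in> cdom c" using assms(2) by simp
  show ?thesis
    unfolding speed_defect_def velocity_chart[OF assms] fermat_model.DL_def[OF chart_model[OF assms(1)]]
      coord_forms(1)[OF assms(1) xs]
    by (simp add: cinv_cmap[OF chart_inj[OF assms(1)] xs])
qed

lemma speed_defect_smooth: "smooth_on I (speed_defect I x)"
proof (rule smooth_on_local[OF spread_I])
  fix s assume "s \<in> I"
  then obtain c where c: "c \<in> A" "s \<in> J c" using chart_exists by blast
  have "smooth_on (J c) (\<lambda>s. DC c (\<xi> c s) (\<nu> c s))"
    using x_chart(11)[OF c(1)]
    by (intro fermat_model.DL_along_smooth[OF chart_model[OF c(1)]] x_chart(3,4)[OF c(1)]) simp
  then have "smooth_on (J c) (speed_defect I x)"
    by (rule smooth_on_transform) (rule speed_defect_chart[OF c(1)])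
  then show "\<exists>Y. openin (top_of_set I) Y \<and> s \<in> Y \<and> smooth_on Y (speed_defect I x)"
    using x_chart(1)[OF c(1)] c(2) by blast
qed

lemma speed_defect_derivative:
  assumes "c \<in> A" "s \<in> J c"
  shows "(speed_defect I x has_real_derivative DdotC c (\<xi> c s) (\<nu> c s) (acc c s)) (at s within I)"
proof (rule has_real_derivative_transform_eventually)
  show "((\<lambda>s. DC c (\<xi> c s) (\<nu> c s)) has_real_derivative DdotC c (\<xi> c s) (\<nu> c s) (acc c s)) (at s within I)"
    by (rule fermat_model.DL_derivative[OF chart_model[OF assms(1)] \<xi>_in[OF assms(2)]
          x_chart(8)[OF assms] x_chart(9)[OF assms]])
  show "\<forall>\<^sub>F r in nhds s. r \<in> I \<longrightarrow> DC c (\<xi> c r) (\<nu> c r) = speed_defect I x r"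
    using eventually_openin[OF x_chart(1)[OF assms(1)] assms(2)]
    by (rule eventually_mono) (intro impI speed_defect_chart[OF assms(1), symmetric], blast)
  show "DC c (\<xi> c s) (\<nu> c s) = speed_defect I x s"
    by (rule speed_defect_chart[OF assms, symmetric])
qed

text \<open>In a chart V is (\<sigma>, x'), which is nonzero as \<sigma> is. Its square vanishes
  exactly when 1 is a root of the quadratic equation, and \<sigma> times its product with the time
  field is the negative of \<open>DL\<close>, so the claim is \<open>FL_unit_iff\<close>.\<close>

lemma unit_speed_iff:
  fixes k :: real
  assumes "s \<in> I"
  defines "V \<equiv> velocity LA I (\<lambda>t. (k + \<sigma> * t, x t)) s"
  shows "F (velocity A I x s) = 1 \<longleftrightarrow>
    V \<noteq> tzero (k + \<sigma> * s, x s) \<and> g V V = 0 \<and> \<sigma> * g V (time_field A (k + \<sigma> * s, x s)) < 0"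
    and "F (velocity A I x s) = 1 \<Longrightarrow> speed_defect I x s > 0"
    and "fst V = (k + \<sigma> * s, x s)"
proof -
  obtain c where c: "c \<in> A" "s \<in> J c" using chart_exists[OF assms(1)] by blast
  have xs: "x s \<in> cdom c" using c(2) by simp
  interpret M: fermat_model "cimage c" "bC c" "wC c" "gC c" \<sigma> by (rule chart_model[OF c(1)])
  have ev: "\<forall>\<^sub>F r in nhds s. r \<in> I \<longrightarrow> x r \<in> cdom c"
    using eventually_openin[OF x_chart(1)[OF c(1)] c(2)] by (rule eventually_mono) simp
  have "((\<lambda>t. k + \<sigma> * t) has_vector_derivative \<sigma>) (at s within I)"
    by (auto intro!: derivative_eq_intros)
  then have V: "V = coord_vec LA (lpc c) (k + \<sigma> * s, x s) (\<sigma>, \<nu> c s)"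
    unfolding V_def
    by (rule velocity_line_product[OF c(1) xs ev x_chart(7)[OF c] _ x_chart(8)[OF c]])
  show "fst V = (k + \<sigma> * s, x s)" unfolding V by simp
  have "snd V (lpc c) = (\<sigma>, \<nu> c s)"
    unfolding V using xs
    by (intro snd_coord_vec_self line_product_atlas_mem c(1) open_line_product) simp
  then have nz: "V \<noteq> tzero (k + \<sigma> * s, x s)"
    using sigma_sq by (auto simp: tzero_def zero_prod_def)
  have in\<Omega>: "\<xi> c s \<in> cimage c" by (rule \<xi>_in[OF c(2)])
  have gVV: "g V V = - bC c (\<xi> c s) + 2 * \<sigma> * wC c (\<xi> c s) (\<nu> c s) + gC c (\<xi> c s) (\<nu> c s) (\<nu> c s)"
  proof -
    have "g V V = - (\<sigma> * \<sigma>) * bC c (\<xi> c s) + 2 * \<sigma> * wC c (\<xi> c s) (\<nu> c s) + gC c (\<xi> c s) (\<nu> c s) (\<nu> c s)"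
      unfolding V stationary_metric_coord[OF c(1) xs] coord_forms[OF c(1) xs]
      by (simp add: cinv_cmap[OF chart_inj[OF c(1)] xs])
    then show ?thesis unfolding sigma_sq by simp
  qed
  have gVt: "\<sigma> * g V (time_field A (k + \<sigma> * s, x s)) = - DC c (\<xi> c s) (\<nu> c s)"
  proof -
    have "g V (time_field A (k + \<sigma> * s, x s)) = - bC c (\<xi> c s) * \<sigma> + wC c (\<xi> c s) (\<nu> c s)"
      unfolding V time_field_coord[OF c(1) xs] stationary_metric_coord[OF c(1) xs]
        coord_forms[OF c(1) xs]
      using linear_0[OF M.w_linear[OF in\<Omega>]] linear_0[OF M.g_linear[OF in\<Omega>]]
      by (simp add: cinv_cmap[OF chart_inj[OF c(1)] xs])
    then have "\<sigma> * g V (time_field A (k + \<sigma> * s, x s))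
        = - (\<sigma> * \<sigma>) * bC c (\<xi> c s) + \<sigma> * wC c (\<xi> c s) (\<nu> c s)"
      by (simp only:) (simp add: algebra_simps)
    then show ?thesis unfolding M.DL_def sigma_sq by simp
  qed
  show "F (velocity A I x s) = 1 \<longleftrightarrow>
    V \<noteq> tzero (k + \<sigma> * s, x s) \<and> g V V = 0 \<and> \<sigma> * g V (time_field A (k + \<sigma> * s, x s)) < 0"
    unfolding F_velocity[OF c] M.FL_unit_iff[OF in\<Omega>] gVV gVt using nz by auto
  show "speed_defect I x s > 0" if "F (velocity A I x s) = 1"
    using that unfolding F_velocity[OF c] M.FL_unit_iff[OF in\<Omega>] speed_defect_chart[OF c] by simp
qed

section \<open>Reparametrized curves\<close>

context
  fixes a' b' :: real and h :: "real \<Rightarrow> real" and I' :: "real set"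
  assumes ab': "a' < b'" and I': "I' = {a'..b'}" and h: "smooth_on I' h" "h ` I' \<subseteq> I"
begin

abbreviation "h' \<equiv> \<lambda>s. vector_derivative h (at s within I')"
abbreviation "h'' \<equiv> \<lambda>s. vector_derivative h' (at s within I')"

lemma spread_I': "spread I'"
  unfolding I' by (rule spread_Icc[OF ab'])

lemma reparametrized_smooth: "smooth_into S A I' (x \<circ> h)"
  using smooth_into_compose[OF x_smooth h] by (simp add: comp_def)

text \<open>By the chain rule the curve has velocity (\<sigma> h', h' x') and acceleration (\<sigma>
  h'', h'' x' + h'^2 x''), the input of \<open>geodesic_equation_iff\<close> with m = h' and n =
  h''.\<close>

lemma reparametrized_geodesic_at_iff:
  fixes k :: real
  assumes c: "c \<in> A" and s: "s \<in> I'" "x (h s) \<in> cdom c" and "h' s \<noteq> 0" "speed_defect I x (h s) > 0"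
  defines "y \<equiv> \<lambda>r. vector_derivative (cmap (lpc c) \<circ> ((\<lambda>t. (k + \<sigma> * t, x t)) \<circ> h)) (at r within I')"
  shows "vector_derivative y (at s within I') +
      christoffel LA g (lpc c) (cmap (lpc c) (((\<lambda>t. (k + \<sigma> * t, x t)) \<circ> h) s)) (y s) (y s) = 0
    \<longleftrightarrow> h'' s * DC c (\<xi> c (h s)) (\<nu> c (h s)) + h' s * h' s * DdotC c (\<xi> c (h s)) (\<nu> c (h s)) (acc c (h s)) = 0
      \<and> (\<forall>z. resC c (\<xi> c (h s)) (\<nu> c (h s)) (acc c (h s)) z = 0)"
proof -
  let ?J = "{r \<in> I'. (x \<circ> h) r \<in> cdom c}"
  interpret M: fermat_model "cimage c" "bC c" "wC c" "gC c" \<sigma> by (rule chart_model[OF c])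
  note X = smooth_into_chart[OF reparametrized_smooth spread_I' c]
  have hd: "(h has_vector_derivative h' r) (at r within I')" if "r \<in> I'" for r
    by (rule smooth_on_vector_derivative(1)[OF h(1) spread_I' that])
  have hd2: "(h' has_vector_derivative h'' r) (at r within I')" if "r \<in> I'" for r
    by (rule smooth_on_vector_derivative(1)[OF smooth_on_vector_derivative(2)[OF h(1) spread_I'] spread_I' that])
  have hJ: "h r \<in> J c" if "r \<in> ?J" for r using that h(2) by auto
  have chain: "((f \<circ> h) has_vector_derivative h' r *\<^sub>R D) (at r within I')"
    if "r \<in> I'" "(f has_vector_derivative D) (at (h r) within I)" for f :: "real \<Rightarrow> 'e" and D r
    by (rule vector_diff_chain_within[OF hd[OF that(1)]
          has_vector_derivative_within_subset[OF that(2) h(2)]])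
  have y: "y r = (\<sigma> * h' r, h' r *\<^sub>R \<nu> c (h r))" if "r \<in> ?J" for r
  proof -
    have rI: "r \<in> I'" using that by simp
    have e: "cmap (lpc c) \<circ> ((\<lambda>t. (k + \<sigma> * t, x t)) \<circ> h) = (\<lambda>r. (k + \<sigma> * h r, (\<xi> c \<circ> h) r))" by auto
    have "((\<lambda>r. k + \<sigma> * h r) has_vector_derivative (\<sigma> * h' r)) (at r within I')"
      using hd[OF rI] by (auto simp: has_real_derivative_iff_has_vector_derivative[symmetric]
          intro!: derivative_eq_intros)
    from has_vector_derivative_Pair[OF this chain[OF rI x_chart(8)[OF c hJ[OF that]]]]
    show ?thesis unfolding y_def e by (rule vector_derivative_within[OF X(7)[OF that]])
  qed
  have sJ: "s \<in> ?J" using s by simp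
  have "((\<lambda>r. (\<sigma> * h' r, h' r *\<^sub>R (\<nu> c \<circ> h) r)) has_vector_derivative
      (\<sigma> * h'' s, h' s *\<^sub>R (h' s *\<^sub>R acc c (h s)) + h'' s *\<^sub>R (\<nu> c \<circ> h) s)) (at s within I')"
    by (intro has_vector_derivative_Pair has_vector_derivative_mult_right hd2 s(1)
        has_vector_derivative_scaleR[OF _ chain[OF s(1) x_chart(9)[OF c hJ[OF sJ]]]])
      (simp add: has_real_derivative_iff_has_vector_derivative hd2 s(1))
  moreover have "\<forall>\<^sub>F r in nhds s. r \<in> I' \<longrightarrow> (\<sigma> * h' r, h' r *\<^sub>R (\<nu> c \<circ> h) r) = y r"
    using eventually_openin[OF X(1) sJ] by (rule eventually_mono) (simp add: y comp_def)
  ultimately have "(y has_vector_derivative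
      (\<sigma> * h'' s, h'' s *\<^sub>R \<nu> c (h s) + (h' s * h' s) *\<^sub>R acc c (h s))) (at s within I')"
    by (subst (asm) has_vector_derivative_cong_ev) (simp_all add: y[OF sJ] add.commute)
  then have y': "vector_derivative y (at s within I')
      = (\<sigma> * h'' s, h'' s *\<^sub>R \<nu> c (h s) + (h' s * h' s) *\<^sub>R acc c (h s))"
    by (rule vector_derivative_within[OF X(7)[OF sJ]])
  have pos: "DC c (\<xi> c (h s)) (\<nu> c (h s)) > 0"
    using assms(5) speed_defect_chart[OF c hJ[OF sJ]] by simp
  have u: "cmap (lpc c) (((\<lambda>t. (k + \<sigma> * t, x t)) \<circ> h) s) = (k + \<sigma> * h s, \<xi> c (h s))" by simp
  show ?thesis unfolding y' u y[OF sJ] christoffel_def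
    by (rule M.geodesic_equation_iff[OF \<xi>_in[OF hJ[OF sJ]] assms(4) pos metric_rep_Gm[OF c] refl])
qed

lemma reparametrized_geodesic_iff:
  assumes "\<forall>s\<in>I'. h' s \<noteq> 0" "\<forall>s\<in>I. speed_defect I x s > 0"
  shows "metric_geodesic (line_product S) LA g a' b' ((\<lambda>t. (k + \<sigma> * t, x t)) \<circ> h) \<longleftrightarrow>
    (\<forall>c\<in>A. \<forall>s\<in>I'. x (h s) \<in> cdom c \<longrightarrow>
      h'' s * DC c (\<xi> c (h s)) (\<nu> c (h s)) + h' s * h' s * DdotC c (\<xi> c (h s)) (\<nu> c (h s)) (acc c (h s)) = 0
      \<and> (\<forall>z. resC c (\<xi> c (h s)) (\<nu> c (h s)) (acc c (h s)) z = 0))"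
proof -
  have "smooth_on I' (\<lambda>s. k + \<sigma> * h s)" by (intro smooth_on_add smooth_on_mult smooth_on_const h(1))
  from smooth_into_line_product[OF this, of "x \<circ> h"] reparametrized_smooth
  have sm: "smooth_into (line_product S) LA {a'..b'} ((\<lambda>t. (k + \<sigma> * t, x t)) \<circ> h)"
    by (simp add: comp_def I')
  have pt: "vector_derivative (\<lambda>r. vector_derivative (cmap (lpc c) \<circ> ((\<lambda>t. (k + \<sigma> * t, x t)) \<circ> h)) (at r within I'))
          (at s within I') +
        christoffel LA g (lpc c) (cmap (lpc c) (((\<lambda>t. (k + \<sigma> * t, x t)) \<circ> h) s))
          (vector_derivative (cmap (lpc c) \<circ> ((\<lambda>t. (k + \<sigma> * t, x t)) \<circ> h)) (at s within I'))
          (vector_derivative (cmap (lpc c) \<circ> ((\<lambda>t. (k + \<sigma> * t, x t)) \<circ> h)) (at s within I')) = 0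
      \<longleftrightarrow> h'' s * DC c (\<xi> c (h s)) (\<nu> c (h s)) + h' s * h' s * DdotC c (\<xi> c (h s)) (\<nu> c (h s)) (acc c (h s)) = 0
      \<and> (\<forall>z. resC c (\<xi> c (h s)) (\<nu> c (h s)) (acc c (h s)) z = 0)"
    if "c \<in> A" "s \<in> I'" "x (h s) \<in> cdom c" for c s
    using that h(2) assms by (intro reparametrized_geodesic_at_iff) auto
  have dom: "((\<lambda>t. (k + \<sigma> * t, x t)) \<circ> h) s \<in> cdom (lpc c) \<longleftrightarrow> x (h s) \<in> cdom c" for c s
    by simp
  have atlas: "(\<forall>C\<in>LA. P C) \<longleftrightarrow> (\<forall>c\<in>A. P (lpc c))" for P
    by (simp add: line_product_atlas_def)
  have "metric_geodesic (line_product S) LA g a' b' ((\<lambda>t. (k + \<sigma> * t, x t)) \<circ> h) \<longleftrightarrow>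
      (\<forall>c\<in>A. \<forall>s\<in>I'. x (h s) \<in> cdom c \<longrightarrow>
        vector_derivative (\<lambda>r. vector_derivative (cmap (lpc c) \<circ> ((\<lambda>t. (k + \<sigma> * t, x t)) \<circ> h)) (at r within I'))
          (at s within I') +
        christoffel LA g (lpc c) (cmap (lpc c) (((\<lambda>t. (k + \<sigma> * t, x t)) \<circ> h) s))
          (vector_derivative (cmap (lpc c) \<circ> ((\<lambda>t. (k + \<sigma> * t, x t)) \<circ> h)) (at s within I'))
          (vector_derivative (cmap (lpc c) \<circ> ((\<lambda>t. (k + \<sigma> * t, x t)) \<circ> h)) (at s within I')) = 0)"
    unfolding metric_geodesic_def Let_def atlas dom I' using sm ab' by (simp only: simp_thms)
  also have "\<dots> \<longleftrightarrow> (\<forall>c\<in>A. \<forall>s\<in>I'. x (h s) \<in> cdom c \<longrightarrow>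
      h'' s * DC c (\<xi> c (h s)) (\<nu> c (h s)) + h' s * h' s * DdotC c (\<xi> c (h s)) (\<nu> c (h s)) (acc c (h s)) = 0
      \<and> (\<forall>z. resC c (\<xi> c (h s)) (\<nu> c (h s)) (acc c (h s)) z = 0))"
    by (intro ball_cong refl imp_cong pt)
  finally show ?thesis .
qed

end

end

section \<open>Mixed partial derivatives\<close>

lemma partial_snd:
  fixes u :: "real \<times> real \<Rightarrow> 'b::real_normed_vector"
  assumes "(u has_derivative D) (at (e, s) within Y)" "(\<lambda>r. (e, r)) ` T \<subseteq> Y"
  shows "((\<lambda>r. u (e, r)) has_vector_derivative D (0, 1)) (at s within T)"
proof -
  have "((\<lambda>r. (e, r)) has_derivative (\<lambda>h. (0, h))) (at s within T)"
    by (intro has_derivative_Pair has_derivative_const has_derivative_ident)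
  from has_derivative_in_compose[OF this has_derivative_subset[OF assms]]
  have "((\<lambda>r. u (e, r)) has_derivative (\<lambda>h. D (0, h))) (at s within T)" .
  moreover have "(\<lambda>h. D (0, h)) = (\<lambda>h. h *\<^sub>R D (0, 1))"
  proof
    show "D (0, h) = h *\<^sub>R D (0, 1)" for h
      using linear_scale[OF has_derivative_linear[OF assms(1)], of h "(0, 1)"] by simp
  qed
  ultimately show ?thesis unfolding has_vector_derivative_def by metis
qed

lemma partial_fst:
  fixes u :: "real \<times> real \<Rightarrow> 'b::real_normed_vector"
  assumes "(u has_derivative D) (at (e, s) within Y)" "(\<lambda>r. (r, s)) ` T \<subseteq> Y"
  shows "((\<lambda>r. u (r, s)) has_vector_derivative D (1, 0)) (at e within T)"
proof -
  have "((\<lambda>r. (r, s)) has_derivative (\<lambda>h. (h, 0))) (at e within T)"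
    by (intro has_derivative_Pair has_derivative_const has_derivative_ident)
  from has_derivative_in_compose[OF this has_derivative_subset[OF assms]]
  have "((\<lambda>r. u (r, s)) has_derivative (\<lambda>h. D (h, 0))) (at e within T)" .
  moreover have "(\<lambda>h. D (h, 0)) = (\<lambda>h. h *\<^sub>R D (1, 0))"
  proof
    show "D (h, 0) = h *\<^sub>R D (1, 0)" for h
      using linear_scale[OF has_derivative_linear[OF assms(1)], of h "(1, 0)"] by simp
  qed
  ultimately show ?thesis unfolding has_vector_derivative_def by metis
qed

text \<open>Differentiating under the integral sign instead of using second difference quotients also
  covers the boundary points of \<open>{a..b}\<close>.\<close>

lemma mixed_partials:
  fixes u :: "real \<times> real \<Rightarrow> 'b::euclidean_space"
  assumes Y: "openin (top_of_set (E \<times> {a..b})) Y" and "open E" "a < b" and z: "(e0, s0) \<in> Y"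
    and u': "\<And>z. z \<in> Y \<Longrightarrow> (u has_derivative u' z) (at z within Y)"
      "continuous_on Y (\<lambda>z. u' z (0, 1))"
    and f': "\<And>z. z \<in> Y \<Longrightarrow> ((\<lambda>z. u' z (0, 1)) has_derivative f' z) (at z within Y)"
      "continuous_on Y (\<lambda>z. f' z (1, 0))"
  shows "((\<lambda>s. u' (e0, s) (1, 0)) has_vector_derivative f' (e0, s0) (1, 0)) (at s0 within {a..b})"
proof -
  obtain W where W: "open W" "Y = (E \<times> {a..b}) \<inter> W" using Y openin_open by metis
  have s0: "s0 \<in> {a..b}" using z W by auto
  have "open (W \<inter> (E \<times> UNIV))" using W(1) \<open>open E\<close> by (intro open_Int open_Times open_UNIV)
  moreover have "(e0, s0) \<in> W \<inter> (E \<times> UNIV)" using z W by auto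
  ultimately obtain A B where AB: "open A" "open B" "e0 \<in> A" "s0 \<in> B" "A \<times> B \<subseteq> W \<inter> (E \<times> UNIV)"
    by (rule open_prod_elim) auto
  obtain \<eta>1 where \<eta>1: "\<eta>1 > 0" "ball e0 \<eta>1 \<subseteq> A" using AB openE by blast
  obtain \<eta>2 where \<eta>2: "\<eta>2 > 0" "cball s0 \<eta>2 \<subseteq> B" using AB open_contains_cball by blast
  \<comment> \<open>Cutting off at a and b keeps the box in Y when s0 is near an endpoint, and the
    interval still contains every point of {a..b} close to s0.\<close>
  define l r where "l = max a (s0 - \<eta>2)" and "r = min b (s0 + \<eta>2)"
  have lr: "l < r" "s0 \<in> {l..r}" "{l..r} \<subseteq> {a..b}"
    using s0 \<eta>2(1) \<open>a < b\<close> unfolding l_def r_def by auto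
  have "{l..r} \<subseteq> cball s0 \<eta>2"
    unfolding l_def r_def by (auto simp: dist_real_def)
  then have box: "ball e0 \<eta>1 \<times> {l..r} \<subseteq> Y"
  proof -
    have "ball e0 \<eta>1 \<times> {l..r} \<subseteq> A \<times> B" using \<eta>1(2) \<eta>2(2) \<open>{l..r} \<subseteq> cball s0 \<eta>2\<close> by blast
    then have "ball e0 \<eta>1 \<times> {l..r} \<subseteq> W \<inter> (E \<times> UNIV)" using AB(5) by blast
    then show ?thesis using lr(3) unfolding W(2) by blast
  qed
  define f where "f z = u' z (0, 1)" for z
  define k where "k s = f' (e0, s) (1, 0)" for s
  have e0: "e0 \<in> ball e0 \<eta>1" using \<eta>1 by simp
  have k_cont: "continuous_on {l..r} k" unfolding k_def
    by (rule continuous_on_compose2[OF f'(2)]) (use box e0 in \<open>auto intro!: continuous_intros\<close>)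
  have f_cont: "continuous_on {l..s} (\<lambda>t. f (e, t))" if "e \<in> ball e0 \<eta>1" "s \<in> {l..r}" for e s
    unfolding f_def
    by (rule continuous_on_compose2[OF u'(2)]) (use box that in \<open>auto intro!: continuous_intros\<close>)
  \<comment> \<open>Both sides are the derivative in e of u(e, s), the right one after writing u(e,
    s) as u(e, l) plus the integral of its s-derivative over [l, s].\<close>
  have key: "u' (e0, s) (1, 0) = u' (e0, l) (1, 0) + integral {l..s} k" if s: "s \<in> {l..r}" for s
  proof -
    have FTC: "integral {l..s} (\<lambda>t. f (e, t)) = u (e, s) - u (e, l)" if e: "e \<in> ball e0 \<eta>1" for e
    proof (rule integral_unique, rule fundamental_theorem_of_calculus)
      show "l \<le> s" using s by simp
      show "((\<lambda>t. u (e, t)) has_vector_derivative f (e, t)) (at t within {l..s})" if "t \<in> {l..s}" for t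
        unfolding f_def using box e s that
        by (intro partial_snd[of u "u' (e, t)" e t Y] u'(1)) auto
    qed
    have "((\<lambda>e. integral (cbox l s) (\<lambda>t. f (e, t))) has_vector_derivative integral (cbox l s) k)
        (at e0 within ball e0 \<eta>1)"
      unfolding k_def
    proof (rule leibniz_rule_vector_derivative)
      show "((\<lambda>e. f (e, t)) has_vector_derivative f' (e, t) (1, 0)) (at e within ball e0 \<eta>1)"
        if "e \<in> ball e0 \<eta>1" "t \<in> cbox l s" for e t
        unfolding f_def using box s that
        by (intro partial_fst[of _ "f' (e, t)" e t Y] f'(1)) auto
      show "(\<lambda>t. f (e, t)) integrable_on cbox l s" if "e \<in> ball e0 \<eta>1" for e
        using integrable_continuous_real[OF f_cont[OF that s]] by simp
      have "continuous_on (ball e0 \<eta>1 \<times> cbox l s) (\<lambda>z. f' z (1, 0))"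
        by (rule continuous_on_subset[OF f'(2)]) (use box s in auto)
      then show "continuous_on (ball e0 \<eta>1 \<times> cbox l s) (\<lambda>(e, t). f' (e, t) (1, 0))"
        by (simp add: case_prod_beta)
    qed (use e0 in auto)
    then have "((\<lambda>e. u (e, s) - u (e, l)) has_vector_derivative integral (cbox l s) k)
        (at e0 within ball e0 \<eta>1)"
      by (rule has_vector_derivative_transform[OF e0, rotated]) (simp add: FTC)
    moreover have "((\<lambda>e. u (e, s) - u (e, l)) has_vector_derivative u' (e0, s) (1, 0) - u' (e0, l) (1, 0))
        (at e0 within ball e0 \<eta>1)"
      using box e0 s lr(1)
      by (intro has_vector_derivative_diff partial_fst[of u _ e0 _ Y] u'(1)) auto
    moreover have "at e0 within ball e0 \<eta>1 \<noteq> bot"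
      using at_within_open[OF e0 open_ball] by simp
    ultimately have "integral (cbox l s) k = u' (e0, s) (1, 0) - u' (e0, l) (1, 0)"
      by (metis vector_derivative_unique_within)
    then show ?thesis by simp
  qed
  have "((\<lambda>s. u' (e0, l) (1, 0) + integral {l..s} k) has_vector_derivative 0 + k s0) (at s0 within {l..r})"
    by (intro has_vector_derivative_add has_vector_derivative_const
        integral_has_vector_derivative[OF k_cont lr(2)])
  then have "((\<lambda>s. u' (e0, s) (1, 0)) has_vector_derivative k s0) (at s0 within {l..r})"
    by (intro has_vector_derivative_transform[OF lr(2) key]) simp_all
  moreover have "at s0 within {l..r} = at s0 within {a..b}"
    by (rule at_within_nhd[of s0 "ball s0 \<eta>2"])
      (use \<eta>2(1) in \<open>auto simp: l_def r_def dist_real_def\<close>)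
  ultimately show ?thesis by (simp add: k_def)
qed

section \<open>The first variation of the Fermat energy\<close>

context fermat_curve
begin

section \<open>A variation with fixed ends\<close>

context
  fixes \<delta> :: real and H :: "real \<times> real \<Rightarrow> 'a"
  assumes H: "fixed_end_variation S A a b x \<delta> H" and unit: "\<And>s. s \<in> I \<Longrightarrow> F (velocity A I x s) = 1"
begin

abbreviation "E \<equiv> {- \<delta><..<\<delta>}"
abbreviation "Y \<equiv> E \<times> I"
abbreviation "YC c \<equiv> {z \<in> Y. H z \<in> cdom c}"

lemma \<delta>: "\<delta> > 0"
  and H_smooth: "smooth_into S A Y H"
  and H_0: "s \<in> I \<Longrightarrow> H (0, s) = x s"
  and H_ends: "\<epsilon> \<in> E \<Longrightarrow> H (\<epsilon>, a) = x a" "\<epsilon> \<in> E \<Longrightarrow> H (\<epsilon>, b) = x b"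
  using H unfolding fixed_end_variation_def I by auto

lemma spread_E: "spread E"
  by (rule spread_open) simp

lemma spread_Y: "spread Y"
  by (rule spread_Times[OF spread_E spread_I])

lemma H_slice_snd:
  assumes "\<epsilon> \<in> E"
  shows "smooth_into S A I (\<lambda>s. H (\<epsilon>, s))"
  by (rule smooth_into_compose[OF H_smooth smooth_on_Pair[OF smooth_on_const
          smooth_on_linear[OF bounded_linear_ident]]]) (use assms in auto)

lemma H_slice_fst:
  assumes "s \<in> I"
  shows "smooth_into S A E (\<lambda>\<epsilon>. H (\<epsilon>, s))"
  by (rule smooth_into_compose[OF H_smooth smooth_on_Pair[OF
          smooth_on_linear[OF bounded_linear_ident] smooth_on_const]]) (use assms in auto)

text \<open>In one chart \<open>u'\<close> on (0, 1) is the velocity, on (1, 0) the variation field,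
  and \<open>f'\<close> on (1, 0) the change of the velocity with \<epsilon>. Exchanging the
  derivatives makes the last also the derivative of the variation field along the curve.\<close>

lemma variation_chart:
  assumes c: "c \<in> A"
  obtains u' f' where "\<And>z. z \<in> YC c \<Longrightarrow> ((cmap c \<circ> H) has_derivative u' z) (at z within YC c)"
    and "\<And>v. smooth_on (YC c) (\<lambda>z. u' z v)"
    and "\<And>z. z \<in> YC c \<Longrightarrow> ((\<lambda>z. u' z (0, 1)) has_derivative f' z) (at z within YC c)"
    and "\<And>\<epsilon> s. (\<epsilon>, s) \<in> YC c \<Longrightarrow>
      velocity A I (\<lambda>s. H (\<epsilon>, s)) s = coord_vec A c (H (\<epsilon>, s)) (u' (\<epsilon>, s) (0, 1))"
    and "\<And>\<epsilon> s. (\<epsilon>, s) \<in> YC c \<Longrightarrow>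
      velocity A E (\<lambda>\<epsilon>. H (\<epsilon>, s)) \<epsilon> = coord_vec A c (H (\<epsilon>, s)) (u' (\<epsilon>, s) (1, 0))"
    and "\<And>\<epsilon> s. (\<epsilon>, s) \<in> YC c \<Longrightarrow>
      vector_derivative (\<lambda>\<epsilon>. cmap c (H (\<epsilon>, s))) (at \<epsilon> within E) = u' (\<epsilon>, s) (1, 0)"
    and "\<And>\<epsilon> s. (\<epsilon>, s) \<in> YC c \<Longrightarrow>
      ((\<lambda>s. u' (\<epsilon>, s) (1, 0)) has_vector_derivative f' (\<epsilon>, s) (1, 0)) (at s within I)"
    and "\<And>\<epsilon> s. (\<epsilon>, s) \<in> YC c \<Longrightarrow> vector_derivative (cmap c \<circ> (\<lambda>s. H (\<epsilon>, s))) (at s within I)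
      = u' (\<epsilon>, s) (0, 1)"
proof -
  have YC: "openin (top_of_set Y) (YC c)"
    by (rule smooth_into_openin[OF H_smooth chart_openin[OF c]])
  have spread_YC: "spread (YC c)" by (rule spread_openin[OF spread_Y YC])
  have "smooth_on (YC c) (cmap c \<circ> H)" using H_smooth c by (simp add: smooth_into_def)
  then obtain u' where u': "\<And>z. z \<in> YC c \<Longrightarrow> ((cmap c \<circ> H) has_derivative u' z) (at z within YC c)"
      "\<And>v. smooth_on (YC c) (\<lambda>z. u' z v)"
    by (rule smooth_on_derivativeE[OF _ spread_YC]) (rule that)
  obtain f' where f': "\<And>z. z \<in> YC c \<Longrightarrow> ((\<lambda>z. u' z (0, 1)) has_derivative f' z) (at z within YC c)"
      "\<And>v. smooth_on (YC c) (\<lambda>z. f' z v)"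
    by (rule smooth_on_derivativeE[OF u'(2) spread_YC]) (rule that)
  have vs: "velocity A I (\<lambda>s. H (\<epsilon>, s)) s = coord_vec A c (H (\<epsilon>, s)) (u' (\<epsilon>, s) (0, 1))"
    "vector_derivative (cmap c \<circ> (\<lambda>s. H (\<epsilon>, s))) (at s within I) = u' (\<epsilon>, s) (0, 1)"
    if z: "(\<epsilon>, s) \<in> YC c" for \<epsilon> s
  proof -
    have \<epsilon>: "\<epsilon> \<in> E" using z by simp
    note X = smooth_into_chart[OF H_slice_snd[OF \<epsilon>] spread_I c]
    have s: "s \<in> {r \<in> I. H (\<epsilon>, r) \<in> cdom c}" using z by simp
    have "((\<lambda>r. (cmap c \<circ> H) (\<epsilon>, r)) has_vector_derivative u' (\<epsilon>, s) (0, 1))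
        (at s within {r \<in> I. H (\<epsilon>, r) \<in> cdom c})"
      by (rule partial_snd[OF u'(1)[OF z]]) (use \<epsilon> in auto)
    then have "((cmap c \<circ> (\<lambda>r. H (\<epsilon>, r))) has_vector_derivative u' (\<epsilon>, s) (0, 1)) (at s within I)"
      unfolding X(6)[OF s] by (simp add: comp_def)
    then show eq: "vector_derivative (cmap c \<circ> (\<lambda>s. H (\<epsilon>, s))) (at s within I) = u' (\<epsilon>, s) (0, 1)"
      by (rule vector_derivative_within[OF X(7)[OF s]])
    show "velocity A I (\<lambda>s. H (\<epsilon>, s)) s = coord_vec A c (H (\<epsilon>, s)) (u' (\<epsilon>, s) (0, 1))"
      unfolding X(10)[OF s] eq ..
  qed
  have ve: "velocity A E (\<lambda>\<epsilon>. H (\<epsilon>, s)) \<epsilon> = coord_vec A c (H (\<epsilon>, s)) (u' (\<epsilon>, s) (1, 0))"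
    "vector_derivative (\<lambda>\<epsilon>. cmap c (H (\<epsilon>, s))) (at \<epsilon> within E) = u' (\<epsilon>, s) (1, 0)"
    if z: "(\<epsilon>, s) \<in> YC c" for \<epsilon> s
  proof -
    have s: "s \<in> I" using z by simp
    note X = smooth_into_chart[OF H_slice_fst[OF s] spread_E c]
    have \<epsilon>: "\<epsilon> \<in> {r \<in> E. H (r, s) \<in> cdom c}" using z by simp
    have "((\<lambda>r. (cmap c \<circ> H) (r, s)) has_vector_derivative u' (\<epsilon>, s) (1, 0))
        (at \<epsilon> within {r \<in> E. H (r, s) \<in> cdom c})"
      by (rule partial_fst[OF u'(1)[OF z]]) (use s in auto)
    then have "((\<lambda>r. cmap c (H (r, s))) has_vector_derivative u' (\<epsilon>, s) (1, 0)) (at \<epsilon> within E)"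
      unfolding X(6)[OF \<epsilon>] by (simp add: comp_def)
    then show eq: "vector_derivative (\<lambda>\<epsilon>. cmap c (H (\<epsilon>, s))) (at \<epsilon> within E) = u' (\<epsilon>, s) (1, 0)"
      by (rule vector_derivative_within[OF X(7)[OF \<epsilon>]])
    show "velocity A E (\<lambda>\<epsilon>. H (\<epsilon>, s)) \<epsilon> = coord_vec A c (H (\<epsilon>, s)) (u' (\<epsilon>, s) (1, 0))"
      unfolding X(10)[OF \<epsilon>] using eq by (simp add: comp_def)
  qed
  have mix: "((\<lambda>s. u' (\<epsilon>, s) (1, 0)) has_vector_derivative f' (\<epsilon>, s) (1, 0)) (at s within I)"
    if "(\<epsilon>, s) \<in> YC c" for \<epsilon> s
    unfolding I
    by (rule mixed_partials[OF YC[unfolded I] _ ab that[unfolded I] u'(1)[unfolded I]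
          smooth_on_imp_continuous_on[OF u'(2)[unfolded I]] f'(1)[unfolded I]
          smooth_on_imp_continuous_on[OF f'(2)[unfolded I]]]) simp_all
  show thesis
    by (rule that[OF u' f'(1) vs(1) ve mix vs(2)])
qed

definition \<Phi> :: "real \<times> real \<Rightarrow> real" where
  "\<Phi> z = F (velocity A I (\<lambda>s. H (fst z, s)) (snd z))"

text \<open>No more than continuity can be expected on all of Y, since the varied curves may have
  zero velocities away from \<epsilon> = 0.\<close>

lemma \<Phi>_continuous: "continuous_on Y \<Phi>"
proof -
  have "Ck_on 0 Y \<Phi>"
  proof (rule Ck_on_local[OF spread_Y])
    fix z assume z: "z \<in> Y"
    then obtain c where c: "c \<in> A" "H z \<in> cdom c"
      using chart_cover smooth_into_topspace[OF H_smooth] by blast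
    obtain u' f' where u': "\<And>v. smooth_on (YC c) (\<lambda>z. u' z v)"
      "\<And>\<epsilon> s. (\<epsilon>, s) \<in> YC c \<Longrightarrow>
        velocity A I (\<lambda>s. H (\<epsilon>, s)) s = coord_vec A c (H (\<epsilon>, s)) (u' (\<epsilon>, s) (0, 1))"
      by (rule variation_chart[OF c(1)]) (rule that)
    have "continuous_on (YC c) (\<lambda>z. FC c ((cmap c \<circ> H) z) (u' z (0, 1)))"
    proof (rule fermat_model.FL_along_continuous[OF chart_model[OF c(1)]])
      show "smooth_on (YC c) (cmap c \<circ> H)" using H_smooth c(1) by (simp add: smooth_into_def)
      show "(cmap c \<circ> H) ` YC c \<subseteq> cimage c" by auto
    qed (rule u'(1))
    then have "continuous_on (YC c) \<Phi>"
      by (rule continuous_on_eq) (auto simp: \<Phi>_def u'(2) F_coord_FC[OF c(1)])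
    then show "\<exists>Z. openin (top_of_set Y) Z \<and> z \<in> Z \<and> Ck_on 0 Z \<Phi>"
      using smooth_into_openin[OF H_smooth chart_openin[OF c(1)]] z c(2) by auto
  qed
  then show ?thesis by simp
qed

lemma \<Phi>_0: "s \<in> I \<Longrightarrow> \<Phi> (0, s) = 1"
proof -
  assume s: "s \<in> I"
  have "velocity A I (\<lambda>s. H (0, s)) s = velocity A I x s"
  proof -
    have eq: "vector_derivative (cmap d \<circ> (\<lambda>s. H (0, s))) (at s within I)
        = vector_derivative (cmap d \<circ> x) (at s within I)" for d
      using s by (intro vector_derivative_cong_eq) (auto simp: H_0)
    show ?thesis unfolding velocity_def H_0[OF s] eq ..
  qed
  then show ?thesis using unit[OF s] by (simp add: \<Phi>_def)
qed

text \<open>F vanishes on zero vectors, while \<Phi> is 1 on the original curve. Uniform continuity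
  on a compact rectangle keeps \<Phi> nonzero for small parameters, so the velocities there are
  nonzero and F is smooth along them.\<close>

lemma \<Phi>_smooth_near:
  obtains \<delta>' where "0 < \<delta>'" "\<delta>' < \<delta>" "smooth_on ({- \<delta>'<..<\<delta>'} \<times> I) \<Phi>"
proof -
  \<comment> \<open>Half of \<delta> gives a compact rectangle inside Y. The bound 1/2 below is
    chosen to be less than the value 1 at \<epsilon> = 0.\<close>
  define K where "K = {- (\<delta>/2)..\<delta>/2} \<times> I"
  have "compact K" unfolding K_def I by (intro compact_Times compact_Icc)
  moreover have "K \<subseteq> Y" unfolding K_def using \<delta> by auto
  ultimately have uc: "uniformly_continuous_on K \<Phi>"
    by (intro compact_uniformly_continuous continuous_on_subset[OF \<Phi>_continuous])
  have "(1/2 :: real) > 0" by simp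
  with uc obtain d where d: "d > 0" "\<And>z z'. z \<in> K \<Longrightarrow> z' \<in> K \<Longrightarrow> dist z' z < d \<Longrightarrow> dist (\<Phi> z') (\<Phi> z) < 1/2"
    by (rule uniformly_continuous_onE) blast
  define \<delta>' where "\<delta>' = min d (\<delta>/2)"
  let ?W = "{- \<delta>'<..<\<delta>'} \<times> I"
  have \<delta>': "0 < \<delta>'" "\<delta>' < \<delta>" using d(1) \<delta> by (auto simp: \<delta>'_def)
  have nz: "\<Phi> z \<noteq> 0" if "z \<in> ?W" for z
  proof -
    obtain \<epsilon> s where z: "z = (\<epsilon>, s)" "\<epsilon> \<in> {- \<delta>'<..<\<delta>'}" "s \<in> I" using \<open>z \<in> ?W\<close> by auto
    have "dist (\<Phi> (\<epsilon>, s)) (\<Phi> (0, s)) < 1/2"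
      using z(2,3) \<delta> by (intro d(2)) (auto simp: K_def \<delta>'_def dist_Pair_Pair dist_real_def)
    then show ?thesis using \<Phi>_0[OF z(3)] z(1) by (auto simp: dist_real_def)
  qed
  have "smooth_on ?W \<Phi>"
  proof (rule smooth_on_local[OF spread_Times[OF spread_open[OF open_greaterThanLessThan] spread_I]])
    fix z assume z: "z \<in> ?W"
    then have zY: "z \<in> Y" using \<delta>' by auto
    then obtain c where c: "c \<in> A" "H z \<in> cdom c"
      using chart_cover smooth_into_topspace[OF H_smooth] by blast
    obtain u' f' where u': "\<And>v. smooth_on (YC c) (\<lambda>z. u' z v)"
      "\<And>\<epsilon> s. (\<epsilon>, s) \<in> YC c \<Longrightarrow>
        velocity A I (\<lambda>s. H (\<epsilon>, s)) s = coord_vec A c (H (\<epsilon>, s)) (u' (\<epsilon>, s) (0, 1))"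
      by (rule variation_chart[OF c(1)]) (rule that)
    let ?Z = "?W \<inter> YC c"
    have sub: "?Z \<subseteq> YC c" by blast
    have F: "\<Phi> y = FC c ((cmap c \<circ> H) y) (u' y (0, 1))" if "y \<in> YC c" for y
      using that by (cases y) (auto simp: \<Phi>_def u'(2) F_coord_FC[OF c(1)])
    have "smooth_on ?Z (\<lambda>z. FC c ((cmap c \<circ> H) z) (u' z (0, 1)))"
    proof (rule fermat_model.FL_along_smooth[OF chart_model[OF c(1)]])
      show "smooth_on ?Z (cmap c \<circ> H)"
        using H_smooth c(1) by (intro smooth_on_subset[OF _ sub]) (simp add: smooth_into_def)
      show "smooth_on ?Z (\<lambda>z. u' z (0, 1))" by (rule smooth_on_subset[OF u'(1) sub])
      show "(cmap c \<circ> H) ` ?Z \<subseteq> cimage c" by auto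
      show "u' y (0, 1) \<noteq> 0" if "y \<in> ?Z" for y
      proof
        assume "u' y (0, 1) = 0"
        then have "\<Phi> y = 0"
          using F[of y] that fermat_model.FL_zero[OF chart_model[OF c(1)], of "(cmap c \<circ> H) y"] by simp
        then show False using nz[of y] that by blast
      qed
    qed
    then have "smooth_on ?Z \<Phi>" by (rule smooth_on_transform) (rule F, blast)
    moreover have "openin (top_of_set ?W) ?Z"
    proof -
      obtain U where "open U" "YC c = Y \<inter> U"
        using smooth_into_openin[OF H_smooth chart_openin[OF c(1)]] unfolding openin_open by blast
      moreover have "?W \<subseteq> Y" using \<delta>' by auto
      ultimately have "?Z = ?W \<inter> U" by blast
      then show ?thesis using \<open>open U\<close> unfolding openin_open by blast
    qed
    ultimately show "\<exists>Z. openin (top_of_set ?W) Z \<and> z \<in> Z \<and> smooth_on Z \<Phi>"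
      using z zY c(2) by blast
  qed
  then show thesis using that \<delta>' by blast
qed

text \<open>\<psi> is what the derivative of F leaves after subtracting the total derivative of the
  paired momentum; the fixed ends kill the integral of that total derivative.\<close>

lemma first_variation:
  obtains \<psi> where
    "((\<lambda>\<epsilon>. finsler_energy A F a b (\<lambda>s. H (\<epsilon>, s))) has_real_derivative 2 * integral I \<psi>) (at 0)"
    "\<And>c s. c \<in> A \<Longrightarrow> s \<in> J c \<Longrightarrow> \<psi> s = resC c (\<xi> c s) (\<nu> c s) (acc c s)
      (vector_derivative (\<lambda>\<epsilon>. cmap c (H (\<epsilon>, s))) (at 0 within E)) / (speed_defect I x s)\<^sup>2"
proof -
  obtain \<delta>' where \<delta>': "0 < \<delta>'" "\<delta>' < \<delta>" "smooth_on ({- \<delta>'<..<\<delta>'} \<times> I) \<Phi>"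
    by (rule \<Phi>_smooth_near)
  let ?E = "{- \<delta>'<..<\<delta>'}" let ?W = "?E \<times> I"
  have "spread ?W" by (rule spread_Times[OF spread_open[OF open_greaterThanLessThan] spread_I])
  then obtain \<Phi>' where \<Phi>': "\<And>z. z \<in> ?W \<Longrightarrow> (\<Phi> has_derivative \<Phi>' z) (at z within ?W)"
      "\<And>v. smooth_on ?W (\<lambda>z. \<Phi>' z v)"
    by (rule smooth_on_derivativeE[OF \<delta>'(3)]) (rule that)
  have z0: "0 \<in> ?E" "0 \<in> E" using \<delta>' by auto
  have d\<Phi>: "((\<lambda>e. \<Phi> (e, s)) has_real_derivative \<Phi>' (\<epsilon>, s) (1, 0)) (at \<epsilon> within ?E)"
    if "\<epsilon> \<in> ?E" "s \<in> I" for \<epsilon> s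
    unfolding has_real_derivative_iff_has_vector_derivative
    by (rule partial_fst[OF \<Phi>'(1)]) (use that in auto)
  have cont: "continuous_on ?W \<Phi>" "continuous_on ?W (\<lambda>z. \<Phi>' z (1, 0))"
    by (rule smooth_on_imp_continuous_on[OF \<delta>'(3)], rule smooth_on_imp_continuous_on[OF \<Phi>'(2)])
  have slice: "continuous_on I (\<lambda>s. f (\<epsilon>, s))" if "continuous_on ?W f" "\<epsilon> \<in> ?E"
    for f :: "real \<times> real \<Rightarrow> real" and \<epsilon>
    by (rule continuous_on_compose2[OF that(1)]) (use that(2) in \<open>auto intro!: continuous_intros\<close>)
  have "((\<lambda>\<epsilon>. integral (cbox a b) (\<lambda>s. (\<Phi> (\<epsilon>, s))\<^sup>2)) has_field_derivative
      integral (cbox a b) (\<lambda>s. 2 * \<Phi> (0, s) * \<Phi>' (0, s) (1, 0))) (at 0 within ?E)"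
  proof (rule leibniz_rule_field_derivative[where fx = "\<lambda>\<epsilon> s. 2 * \<Phi> (\<epsilon>, s) * \<Phi>' (\<epsilon>, s) (1, 0)"])
    show "((\<lambda>e. (\<Phi> (e, s))\<^sup>2) has_field_derivative 2 * \<Phi> (\<epsilon>, s) * \<Phi>' (\<epsilon>, s) (1, 0)) (at \<epsilon> within ?E)"
      if "\<epsilon> \<in> ?E" "s \<in> cbox a b" for \<epsilon> s
    proof -
      have "s \<in> I" using that(2) I by simp
      then show ?thesis by (auto intro!: derivative_eq_intros d\<Phi> that(1))
    qed
    show "(\<lambda>s. (\<Phi> (\<epsilon>, s))\<^sup>2) integrable_on cbox a b" if "\<epsilon> \<in> ?E" for \<epsilon>
      using slice[OF cont(1) that] unfolding I
      by (simp add: integrable_continuous_real continuous_on_power)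
    have "continuous_on ?W (\<lambda>z. 2 * \<Phi> z * \<Phi>' z (1, 0))"
      by (intro continuous_on_mult continuous_on_const cont)
    then show "continuous_on (?E \<times> cbox a b) (\<lambda>(\<epsilon>, s). 2 * \<Phi> (\<epsilon>, s) * \<Phi>' (\<epsilon>, s) (1, 0))"
      unfolding I by (simp add: case_prod_beta)
  qed (use z0 in auto)
  \<comment> \<open>Unit speed turns \<Phi>(0, s) into 1, so to first order the energy varies like
    twice the length.\<close>
  moreover have "integral (cbox a b) (\<lambda>s. 2 * \<Phi> (0, s) * \<Phi>' (0, s) (1, 0))
      = 2 * integral I (\<lambda>s. \<Phi>' (0, s) (1, 0))"
  proof -
    have cI: "cbox a b = I" by (simp add: I)
    have "integral (cbox a b) (\<lambda>s. 2 * \<Phi> (0, s) * \<Phi>' (0, s) (1, 0))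
        = integral I (\<lambda>s. 2 * \<Phi>' (0, s) (1, 0))"
      unfolding cI by (rule integral_cong) (simp add: \<Phi>_0)
    then show ?thesis by simp
  qed
  moreover have "finsler_energy A F a b (\<lambda>s. H (\<epsilon>, s)) = integral (cbox a b) (\<lambda>s. (\<Phi> (\<epsilon>, s))\<^sup>2)" for \<epsilon>
    by (simp add: finsler_energy_def \<Phi>_def I[symmetric])
  ultimately have dE: "((\<lambda>\<epsilon>. finsler_energy A F a b (\<lambda>s. H (\<epsilon>, s))) has_real_derivative
      2 * integral I (\<lambda>s. \<Phi>' (0, s) (1, 0))) (at 0)"
    using at_within_open[OF z0(1) open_greaterThanLessThan] by (simp only:)
  define Ut where "Ut s = velocity A E (\<lambda>\<epsilon>. H (\<epsilon>, s)) 0" for s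
  define B where "B s = (\<sigma> * \<omega> (Ut s) + g\<^sub>0 (velocity A I x s) (Ut s)) / speed_defect I x s" for s
  define \<psi> where "\<psi> s = \<Phi>' (0, s) (1, 0) - vector_derivative B (at s within I)" for s
  have main: "(B has_vector_derivative vector_derivative B (at s within I)) (at s within I) \<and>
      \<psi> s = resC c (\<xi> c s) (\<nu> c s) (acc c s)
        (vector_derivative (\<lambda>\<epsilon>. cmap c (H (\<epsilon>, s))) (at 0 within E)) / (speed_defect I x s)\<^sup>2"
    if c: "c \<in> A" and s: "s \<in> J c" for c s
  proof -
    interpret M: fermat_model "cimage c" "bC c" "wC c" "gC c" \<sigma> by (rule chart_model[OF c])
    obtain u' f' where u': "\<And>z. z \<in> YC c \<Longrightarrow> ((cmap c \<circ> H) has_derivative u' z) (at z within YC c)"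
      "\<And>v. smooth_on (YC c) (\<lambda>z. u' z v)"
      and f': "\<And>z. z \<in> YC c \<Longrightarrow> ((\<lambda>z. u' z (0, 1)) has_derivative f' z) (at z within YC c)"
      and vs: "\<And>\<epsilon> s. (\<epsilon>, s) \<in> YC c \<Longrightarrow>
        velocity A I (\<lambda>s. H (\<epsilon>, s)) s = coord_vec A c (H (\<epsilon>, s)) (u' (\<epsilon>, s) (0, 1))"
      and ve: "\<And>\<epsilon> s. (\<epsilon>, s) \<in> YC c \<Longrightarrow>
        velocity A E (\<lambda>\<epsilon>. H (\<epsilon>, s)) \<epsilon> = coord_vec A c (H (\<epsilon>, s)) (u' (\<epsilon>, s) (1, 0))"
      and vd: "\<And>\<epsilon> s. (\<epsilon>, s) \<in> YC c \<Longrightarrow>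
        vector_derivative (\<lambda>\<epsilon>. cmap c (H (\<epsilon>, s))) (at \<epsilon> within E) = u' (\<epsilon>, s) (1, 0)"
      and mix: "\<And>\<epsilon> s. (\<epsilon>, s) \<in> YC c \<Longrightarrow>
        ((\<lambda>s. u' (\<epsilon>, s) (1, 0)) has_vector_derivative f' (\<epsilon>, s) (1, 0)) (at s within I)"
      and vI: "\<And>\<epsilon> s. (\<epsilon>, s) \<in> YC c \<Longrightarrow> vector_derivative (cmap c \<circ> (\<lambda>s. H (\<epsilon>, s))) (at s within I)
        = u' (\<epsilon>, s) (0, 1)"
      by (rule variation_chart[OF c]) (rule that)
    have JY: "(0, r) \<in> YC c" if "r \<in> J c" for r using that z0 H_0 by auto
    have \<nu>: "u' (0, r) (0, 1) = \<nu> c r" if r: "r \<in> J c" for r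
    proof -
      have "vector_derivative (cmap c \<circ> (\<lambda>s. H (0, s))) (at r within I) = \<nu> c r"
        using r by (intro vector_derivative_cong_eq) (auto simp: H_0)
      then show ?thesis using vI[OF JY[OF r]] by simp
    qed
    let ?U = "\<lambda>s. u' (0, s) (1, 0)" let ?q = "\<xi> c s" let ?v = "\<nu> c s"
    have q: "?q \<in> cimage c" by (rule \<xi>_in[OF s])
    have sI: "s \<in> I" using s by simp
    have F1: "FC c ?q ?v = 1" using unit[OF sI] F_velocity[OF c s] by simp
    then have D: "DC c ?q ?v > 0" using M.FL_unit_iff[OF q] by blast
    \<comment> \<open>The parameters that keep the point at s in the chart form an open set around
      0, so the partial derivatives become the two-sided ones at 0 that \<open>FL_variation\<close>
      demands.\<close>
    define Es where "Es = {e \<in> E. H (e, s) \<in> cdom c}"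
    have "openin (top_of_set E) Es"
      unfolding Es_def by (rule smooth_into_openin[OF H_slice_fst[OF sI] chart_openin[OF c]])
    then have openEs: "open Es" using openin_open_eq[of E] by (simp add: open_greaterThanLessThan)
    have 0: "0 \<in> Es" unfolding Es_def using JY[OF s] by simp
    have subE: "(\<lambda>e. (e, s)) ` Es \<subseteq> YC c" using sI by (auto simp: Es_def)
    have at0: "at 0 within Es = at 0" by (rule at_within_open[OF 0 openEs])
    have dq: "((\<lambda>e. (cmap c \<circ> H) (e, s)) has_vector_derivative ?U s) (at 0)"
      using partial_fst[OF u'(1)[OF JY[OF s]] subE] unfolding at0 .
    have dv: "((\<lambda>e. u' (e, s) (0, 1)) has_vector_derivative f' (0, s) (1, 0)) (at 0)"
      using partial_fst[OF f'[OF JY[OF s]] subE] unfolding at0 .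
    have dF: "((\<lambda>e. FC c ((cmap c \<circ> H) (e, s)) (u' (e, s) (0, 1))) has_real_derivative \<Phi>' (0, s) (1, 0)) (at 0)"
    proof (rule has_field_derivative_transform_within_open)
      show "((\<lambda>e. \<Phi> (e, s)) has_real_derivative \<Phi>' (0, s) (1, 0)) (at 0)"
        using d\<Phi>[OF z0(1) sI] at_within_open[OF z0(1) open_greaterThanLessThan] by simp
      show "\<Phi> (e, s) = FC c ((cmap c \<circ> H) (e, s)) (u' (e, s) (0, 1))" if "e \<in> Es" for e
      proof -
        have z: "(e, s) \<in> YC c" using that subE by blast
        then have "H (e, s) \<in> cdom c" by simp
        then show ?thesis by (simp add: \<Phi>_def vs[OF z] F_coord_FC[OF c])
      qed
    qed (use openEs 0 in auto)
    have "(cmap c \<circ> H) (0, s) = ?q" using H_0[OF sI] by simp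
    with M.FL_variation[OF _ dq dv dF] have \<Phi>'_eq:
      "\<Phi>' (0, s) (1, 0) = (fermat_model.NL (bC c) (wC c) (gC c) \<sigma> ?q ?v (?U s) / 2
        + pC c ?q ?v (f' (0, s) (1, 0))) / DC c ?q ?v"
      using q F1 \<nu>[OF s] by simp
    have Bc: "B r = pC c (\<xi> c r) (\<nu> c r) (?U r) / DC c (\<xi> c r) (\<nu> c r)" if r: "r \<in> J c" for r
    proof -
      have rI: "r \<in> I" and xr: "x r \<in> cdom c" using r by auto
      have Ur: "Ut r = coord_vec A c (x r) (?U r)"
        unfolding Ut_def ve[OF JY[OF r]] H_0[OF rI] ..
      show ?thesis
        unfolding B_def Ur velocity_chart[OF c r] speed_defect_chart[OF c r] M.pL_def
          coord_forms[OF c xr] by simp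
    qed
    have dB: "(B has_real_derivative \<Phi>' (0, s) (1, 0)
        - resC c ?q ?v (acc c s) (?U s) / (DC c ?q ?v)\<^sup>2) (at s within I)"
    proof (rule has_real_derivative_transform_eventually)
      show "((\<lambda>r. pC c (\<xi> c r) (\<nu> c r) (?U r) / DC c (\<xi> c r) (\<nu> c r)) has_real_derivative \<Phi>' (0, s) (1, 0)
        - resC c ?q ?v (acc c s) (?U s) / (DC c ?q ?v)\<^sup>2) (at s within I)"
        unfolding \<Phi>'_eq
        by (rule M.momentum_derivative[OF q x_chart(8)[OF c s] x_chart(9)[OF c s] mix[OF JY[OF s]] D])
      show "\<forall>\<^sub>F r in nhds s. r \<in> I \<longrightarrow> pC c (\<xi> c r) (\<nu> c r) (?U r) / DC c (\<xi> c r) (\<nu> c r) = B r"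
        using eventually_openin[OF x_chart(1)[OF c] s]
        by (rule eventually_mono) (intro impI Bc[symmetric], blast)
    qed (rule Bc[OF s, symmetric])
    then have dB': "(B has_vector_derivative \<Phi>' (0, s) (1, 0)
        - resC c ?q ?v (acc c s) (?U s) / (DC c ?q ?v)\<^sup>2) (at s within I)"
      by (simp add: has_real_derivative_iff_has_vector_derivative)
    then have vB: "vector_derivative B (at s within I) = \<Phi>' (0, s) (1, 0)
        - resC c ?q ?v (acc c s) (?U s) / (DC c ?q ?v)\<^sup>2"
      by (rule vector_derivative_within[OF x_chart(7)[OF c s]])
    show ?thesis
    proof
      show "(B has_vector_derivative vector_derivative B (at s within I)) (at s within I)"
        unfolding vB by (rule dB')
      show "\<psi> s = resC c ?q ?v (acc c s)
        (vector_derivative (\<lambda>\<epsilon>. cmap c (H (\<epsilon>, s))) (at 0 within E)) / (speed_defect I x s)\<^sup>2"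
        unfolding \<psi>_def vB vd[OF JY[OF s]] speed_defect_chart[OF c s] by simp
    qed
  qed
  \<comment> \<open>At a fixed end the variation field is 0, hence so is its pairing with the
    momentum.\<close>
  have B_end: "B r = 0" if r: "r \<in> I" and const: "\<And>\<epsilon>. \<epsilon> \<in> E \<Longrightarrow> H (\<epsilon>, r) = x r" for r
  proof -
    obtain c where c: "c \<in> A" "r \<in> J c" using chart_exists[OF r] by blast
    have xr: "x r \<in> cdom c" using c(2) by simp
    interpret M: fermat_model "cimage c" "bC c" "wC c" "gC c" \<sigma> by (rule chart_model[OF c(1)])
    have 0: "0 \<in> {\<epsilon> \<in> E. H (\<epsilon>, r) \<in> cdom c}" using z0(2) const xr by simp
    note X = smooth_into_chart[OF H_slice_fst[OF r] spread_E c(1)]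
    have d0: "((cmap c \<circ> (\<lambda>\<epsilon>. H (\<epsilon>, r))) has_vector_derivative 0) (at 0 within E)"
      by (rule has_vector_derivative_transform[OF z0(2) _ has_vector_derivative_const[of "cmap c (x r)"]])
        (simp add: const)
    have "Ut r = coord_vec A c (x r) 0"
      unfolding Ut_def X(10)[OF 0] const[OF z0(2)] vector_derivative_within[OF X(7)[OF 0] d0] ..
    then show ?thesis
      unfolding B_def velocity_chart[OF c]
      using coord_forms[OF c(1) xr] linear_0[OF M.w_linear] linear_0[OF M.g_linear] xr
      by simp
  qed
  have aI: "a \<in> I" "b \<in> I" using ab I by auto
  have dB: "(B has_vector_derivative vector_derivative B (at s within {a..b})) (at s within {a..b})"
    if s: "s \<in> {a..b}" for s
  proof -
    obtain c where "c \<in> A" "s \<in> J c" using chart_exists s I by blast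
    then show ?thesis using main unfolding I by blast
  qed
  have "((\<lambda>s. vector_derivative B (at s within I)) has_integral B b - B a) I"
    unfolding I by (rule fundamental_theorem_of_calculus[OF less_imp_le[OF ab] dB])
  then have iB: "((\<lambda>s. vector_derivative B (at s within I)) has_integral 0) I"
    using B_end[OF aI(1) H_ends(1)] B_end[OF aI(2) H_ends(2)] by simp
  have "(\<lambda>s. \<Phi>' (0, s) (1, 0)) integrable_on I"
    using slice[OF cont(2) z0(1)] unfolding I by (rule integrable_continuous_real)
  from has_integral_diff[OF integrable_integral[OF this] iB]
  have "(\<psi> has_integral integral I (\<lambda>s. \<Phi>' (0, s) (1, 0))) I" unfolding \<psi>_def by simp
  then have "integral I \<psi> = integral I (\<lambda>s. \<Phi>' (0, s) (1, 0))" by (rule integral_unique)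
  then show thesis using that[of \<psi>] dE main by simp
qed

end

end

section \<open>The Euler-Lagrange equations\<close>

context smooth_mfd
begin

text \<open>For maps given by different formulas on overlapping patches, such as the bump variation:
  continuity and smoothness in each chart are local on a spread domain.\<close>

lemma smooth_into_local:
  assumes "spread Y" and loc: "\<And>z. z \<in> Y \<Longrightarrow> \<exists>N f. openin (top_of_set Y) N \<and> z \<in> N \<and> smooth_into S A N f \<and>
    (\<forall>y\<in>N. H y = f y)"
  shows "smooth_into S A Y H"
  unfolding smooth_into_def
proof (intro conjI ballI)
  have pre: "openin (top_of_set Y) {y \<in> Y. H y \<in> U}" if U: "openin S U" for U
  proof (subst openin_subopen, intro ballI)
    fix z assume z: "z \<in> {y \<in> Y. H y \<in> U}"
    then obtain N f where N: "openin (top_of_set Y) N" "z \<in> N" "smooth_into S A N f"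
      "\<And>y. y \<in> N \<Longrightarrow> H y = f y" using loc[of z] by blast
    have "openin (top_of_set Y) {y \<in> N. f y \<in> U}"
      using smooth_into_openin[OF N(3) U] N(1) openin_trans by blast
    moreover have "{y \<in> N. f y \<in> U} \<subseteq> {y \<in> Y. H y \<in> U}"
      using N(4) openin_imp_subset[OF N(1)] by auto
    ultimately show "\<exists>T. openin (top_of_set Y) T \<and> z \<in> T \<and> T \<subseteq> {y \<in> Y. H y \<in> U}"
      using N(2,4) z by (intro exI[of _ "{y \<in> N. f y \<in> U}"]) auto
  qed
  have top: "H y \<in> topspace S" if "y \<in> Y" for y
    using loc[OF that] smooth_into_topspace by metis
  show "continuous_map (top_of_set Y) S H"
    unfolding continuous_map_def using pre top by simp
  fix c assume c: "c \<in> A"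
  have J: "openin (top_of_set Y) {s \<in> Y. H s \<in> cdom c}" by (rule pre[OF chart_openin[OF c]])
  show "smooth_on {s \<in> Y. H s \<in> cdom c} (cmap c \<circ> H)"
  proof (rule smooth_on_local[OF spread_openin[OF \<open>spread Y\<close> J]])
    fix z assume z: "z \<in> {s \<in> Y. H s \<in> cdom c}"
    then obtain N f where N: "openin (top_of_set Y) N" "z \<in> N" "smooth_into S A N f"
      "\<And>y. y \<in> N \<Longrightarrow> H y = f y" using loc[of z] by blast
    let ?Z = "{s \<in> N. f s \<in> cdom c}"
    have "smooth_on ?Z (cmap c \<circ> f)" using N(3) c by (simp add: smooth_into_def)
    then have "smooth_on ?Z (cmap c \<circ> H)" by (rule smooth_on_transform) (simp add: N(4))
    moreover have "openin (top_of_set {s \<in> Y. H s \<in> cdom c}) ?Z"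
    proof (rule openin_subset_trans)
      show "openin (top_of_set Y) ?Z"
        using smooth_into_openin[OF N(3) chart_openin[OF c]] N(1) openin_trans by blast
      show "?Z \<subseteq> {s \<in> Y. H s \<in> cdom c}" using N(4) openin_imp_subset[OF N(1)] by auto
    qed auto
    ultimately show "\<exists>Z. openin (top_of_set {s \<in> Y. H s \<in> cdom c}) Z \<and> z \<in> Z \<and> smooth_on Z (cmap c \<circ> H)"
      using N(2,4) z by (intro exI[of _ ?Z]) auto
  qed
qed

text \<open>Continuity comes from the inverse k of the homeomorphism, which agrees with
  \<open>cinv\<close> on the chart image; smoothness in another chart is that of a transition
  map.\<close>

lemma smooth_into_cinv:
  assumes c: "c \<in> A" and w: "smooth_on X w" "w ` X \<subseteq> cimage c"
  shows "smooth_into S A X (\<lambda>z. cinv c (w z))"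
  unfolding smooth_into_def
proof (intro conjI ballI)
  have "homeomorphic_map (subtopology S (cdom c)) (top_of_set (cimage c)) (cmap c)"
    by (rule chart_homeomorphic[OF c])
  then obtain k where k: "homeomorphic_maps (subtopology S (cdom c)) (top_of_set (cimage c)) (cmap c) k"
    unfolding homeomorphic_map_maps by blast
  have kc: "k u = cinv c u" if "u \<in> cimage c" for u
  proof -
    obtain p where p: "p \<in> cdom c" "u = cmap c p" using \<open>u \<in> cimage c\<close> by blast
    have "k (cmap c p) = p"
      using k p(1) topspace_chart[OF c] unfolding homeomorphic_maps_def by blast
    then show ?thesis using p cinv_cmap[OF chart_inj[OF c] p(1)] by simp
  qed
  have "continuous_map (top_of_set (cimage c)) (subtopology S (cdom c)) k"
    using k unfolding homeomorphic_maps_def by blast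
  then have "continuous_map (top_of_set (cimage c)) S k" by (rule continuous_map_into_fulltopology)
  moreover have "continuous_map (top_of_set X) (top_of_set (cimage c)) w"
    using smooth_on_imp_continuous_on[OF w(1)] w(2) by (simp add: image_subset_iff_funcset)
  ultimately have "continuous_map (top_of_set X) S (k \<circ> w)" using continuous_map_compose by blast
  moreover have "(k \<circ> w) z = cinv c (w z)" if "z \<in> topspace (top_of_set X)" for z
    using kc w(2) that by auto
  ultimately show "continuous_map (top_of_set X) S (\<lambda>z. cinv c (w z))"
    by (rule continuous_map_eq)
  fix d assume d: "d \<in> A"
  let ?X = "{z \<in> X. cinv c (w z) \<in> cdom d}"
  have "w ` ?X \<subseteq> cmap c ` (cdom c \<inter> cdom d)"
  proof
    fix u assume "u \<in> w ` ?X"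
    then obtain z where z: "z \<in> X" "cinv c (w z) \<in> cdom d" "u = w z" by blast
    have "w z \<in> cimage c" using w(2) z(1) by blast
    then show "u \<in> cmap c ` (cdom c \<inter> cdom d)"
      using z cinv_in_cdom cmap_cinv by (metis IntI image_eqI)
  qed
  then have "smooth_on ?X (\<lambda>z. (cmap d \<circ> cinv c) (w z))"
    by (intro smooth_on_compose[OF transition_smooth[OF c d]] smooth_on_subset[OF w(1)]) auto
  then show "smooth_on ?X (cmap d \<circ> (\<lambda>z. cinv c (w z)))" by (simp add: comp_def)
qed

end

text \<open>A symmetric interval around s is cut off at a and b; it keeps positive length even if s
  is an endpoint.\<close>

lemma openin_Icc_subinterval:
  fixes a b :: real
  assumes "a < b" "openin (top_of_set {a..b}) P" "s \<in> P"
  obtains l r where "l < r" "{l..r} \<subseteq> P"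
proof -
  obtain U where U: "open U" "P = {a..b} \<inter> U" using assms(2) unfolding openin_open by blast
  then obtain \<eta> where \<eta>: "\<eta> > 0" "cball s \<eta> \<subseteq> U" using assms(3) open_contains_cball by blast
  have s: "s \<in> {a..b}" using assms(3) U by blast
  show thesis
  proof
    show "max a (s - \<eta>) < min b (s + \<eta>)" using assms(1) s \<eta>(1) by auto
    have "{max a (s - \<eta>)..min b (s + \<eta>)} \<subseteq> cball s \<eta>" by (auto simp: dist_real_def)
    then show "{max a (s - \<eta>)..min b (s + \<eta>)} \<subseteq> P" using \<eta>(2) unfolding U(2) by auto
  qed
qed

section \<open>Critical curves of the energy\<close>

context fermat_curve
begin

lemma speed_defect_pos: "s \<in> I \<Longrightarrow> F (velocity A I x s) = 1 \<Longrightarrow> speed_defect I x s > 0"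
  by (rule unit_speed_iff(2))

lemma energy_critical_if_res:
  assumes "\<forall>s\<in>I. F (velocity A I x s) = 1"
    and res: "\<And>c s z. c \<in> A \<Longrightarrow> s \<in> J c \<Longrightarrow> resC c (\<xi> c s) (\<nu> c s) (acc c s) z = 0"
  shows "energy_critical S A F a b x"
  unfolding energy_critical_def
proof (intro allI impI)
  fix \<delta> H assume H: "fixed_end_variation S A a b x \<delta> H"
  have unit: "\<And>s. s \<in> I \<Longrightarrow> F (velocity A I x s) = 1" using assms(1) by blast
  obtain \<psi> where \<psi>: "((\<lambda>\<epsilon>. finsler_energy A F a b (\<lambda>s. H (\<epsilon>, s))) has_real_derivative 2 * integral I \<psi>) (at 0)"
    "\<And>c s. c \<in> A \<Longrightarrow> s \<in> J c \<Longrightarrow> \<psi> s = resC c (\<xi> c s) (\<nu> c s) (acc c s)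
      (vector_derivative (\<lambda>\<epsilon>. cmap c (H (\<epsilon>, s))) (at 0 within {- \<delta><..<\<delta>})) / (speed_defect I x s)\<^sup>2"
    by (rule first_variation[OF H unit]) (assumption, rule that)
  have "\<psi> s = 0" if s: "s \<in> I" for s
  proof -
    obtain c where c: "c \<in> A" "s \<in> J c" using chart_exists[OF s] by blast
    show ?thesis unfolding \<psi>(2)[OF c] res[OF c] by simp
  qed
  then have "integral I \<psi> = 0" by (rule integral_unique[OF has_integral_is_0])
  then show "((\<lambda>\<epsilon>. finsler_energy A F a b (\<lambda>s. H (\<epsilon>, s))) has_real_derivative 0) (at 0)"
    using \<psi>(1) by simp
qed

text \<open>The curve is moved by \<epsilon> \<phi>(s) z in the chart c and left alone elsewhere. As
  \<phi> vanishes outside [l, r], where the curve is in the chart, this is smooth on the whole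
  interval.\<close>

lemma bump_variation:
  fixes \<phi> :: "real \<Rightarrow> real"
  assumes c: "c \<in> A" and lr: "l < r" "{l..r} \<subseteq> J c"
    and \<phi>: "smooth_on UNIV \<phi>" "\<And>s. s \<le> l \<or> r \<le> s \<Longrightarrow> \<phi> s = 0"
  obtains \<delta> H where "fixed_end_variation S A a b x \<delta> H"
    "\<And>s. s \<in> J c \<Longrightarrow>
      vector_derivative (\<lambda>\<epsilon>. cmap c (H (\<epsilon>, s))) (at 0 within {- \<delta><..<\<delta>}) = \<phi> s *\<^sub>R z"
    "\<And>s (d :: ('a, 'e) chart). s \<in> I - {l..r} \<Longrightarrow>
      vector_derivative (\<lambda>\<epsilon>. cmap d (H (\<epsilon>, s))) (at 0 within {- \<delta><..<\<delta>}) = 0"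
proof -
  have "continuous_on (J c) (\<xi> c)" by (rule smooth_on_imp_continuous_on[OF x_chart(3)[OF c]])
  then have "compact (\<xi> c ` {l..r})"
    by (intro compact_continuous_image continuous_on_subset[OF _ lr(2)] compact_Icc)
  moreover have "\<xi> c ` {l..r} \<subseteq> cimage c" using lr(2) \<xi>_in by blast
  \<comment> \<open>A uniform radius: the compact arc over [l, r] has a positive margin inside the
    open chart image.\<close>
  ultimately obtain \<eta> where \<eta>: "\<eta> > 0" "(\<Union>q\<in>\<xi> c ` {l..r}. ball q \<eta>) \<subseteq> cimage c"
    using compact_subset_open_imp_ball_epsilon_subset[OF _ chart_open[OF c]] by blast
  have "continuous_on {l..r} \<phi>"
    using smooth_on_imp_continuous_on[OF \<phi>(1)] continuous_on_subset by blast
  then have "bounded (\<phi> ` {l..r})"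
    by (intro compact_imp_bounded compact_continuous_image compact_Icc)
  then obtain M where M: "M > 0" "\<And>s. s \<in> {l..r} \<Longrightarrow> \<bar>\<phi> s\<bar> \<le> M"
    unfolding bounded_pos by auto
  \<comment> \<open>Chosen so that displacements are shorter than \<eta>; the summand 1 keeps the
    denominator positive when z = 0.\<close>
  define \<delta> where "\<delta> = \<eta> / (M * (norm z + 1))"
  have Mz: "M * (norm z + 1) > 0" using M(1) by (intro mult_pos_pos add_nonneg_pos) auto
  then have \<delta>: "\<delta> > 0" using \<eta>(1) by (simp add: \<delta>_def)
  let ?E = "{- \<delta><..<\<delta>}"
  define w where "w p = \<xi> c (snd p) + (fst p * \<phi> (snd p)) *\<^sub>R z" for p
  define H where "H p = (if snd p \<in> J c then cinv c (w p) else x (snd p))" for p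
  have w_in: "w (\<epsilon>, s) \<in> cimage c" if "\<epsilon> \<in> ?E" "s \<in> J c" for \<epsilon> s
  proof (cases "s \<in> {l..r}")
    case True
    have "norm ((\<epsilon> * \<phi> s) *\<^sub>R z) = \<bar>\<epsilon>\<bar> * (\<bar>\<phi> s\<bar> * norm z)" by (simp add: abs_mult)
    also have "\<dots> \<le> \<bar>\<epsilon>\<bar> * (M * (norm z + 1))"
      using M(1) M(2)[OF True] by (intro mult_left_mono mult_mono) auto
    also have "\<dots> < \<delta> * (M * (norm z + 1))"
      using that(1) Mz by (intro mult_strict_right_mono) auto
    also have "\<dots> = \<eta>" 
    proof -
      have "M * (norm z + 1) \<noteq> 0" using Mz by linarith
      then show ?thesis unfolding \<delta>_def times_divide_eq_left by (rule nonzero_mult_div_cancel_right)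
    qed
    finally have "w (\<epsilon>, s) \<in> ball (\<xi> c s) \<eta>" by (simp add: w_def dist_norm)
    then show ?thesis using \<eta>(2) True by blast
  next
    case False
    then have "\<phi> s = 0" using \<phi>(2)[of s] by auto
    then have "w (\<epsilon>, s) = \<xi> c s" by (simp add: w_def)
    then show ?thesis using \<xi>_in[OF that(2)] by simp
  qed
  \<comment> \<open>The two branches of H agree where the displacement vanishes. Off [l, r], inside
    the chart or not, H is therefore x, which provides the second patch for the gluing.\<close>
  have H_off: "H (\<epsilon>, s) = x s" if "\<epsilon> * \<phi> s = 0" for \<epsilon> s
  proof (cases "s \<in> J c")
    case True
    have "w (\<epsilon>, s) = \<xi> c s"
      unfolding w_def fst_conv snd_conv that scaleR_zero_left add_0_right ..
    then have "H (\<epsilon>, s) = cinv c (cmap c (x s))" using True by (simp add: H_def)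
    then show ?thesis using True cinv_cmap[OF chart_inj[OF c], of "x s"] by simp
  next
    case False
    then show ?thesis unfolding H_def snd_conv by (simp only: if_False)
  qed
  have \<phi>_off: "\<phi> s = 0" if "s \<notin> {l..r}" for s using \<phi>(2)[of s] that by auto
  have JI: "J c \<subseteq> I" by blast
  have lrI: "{l..r} \<subseteq> {a..b}" using lr(2) JI unfolding I by blast
  then have al: "a \<le> l" "r \<le> b" using lr(1) by auto
  have "smooth_into S A (?E \<times> I) H"
  proof (rule smooth_into_local[OF spread_Times[OF spread_open[OF open_greaterThanLessThan] spread_I]])
    fix p assume p: "p \<in> ?E \<times> I"
    have fs: "smooth_on X fst" "smooth_on X snd" for X :: "(real \<times> real) set"
      by (rule smooth_on_linear[OF bounded_linear_fst], rule smooth_on_linear[OF bounded_linear_snd])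
    show "\<exists>N f. openin (top_of_set (?E \<times> I)) N \<and> p \<in> N \<and> smooth_into S A N f \<and> (\<forall>y\<in>N. H y = f y)"
    proof (cases "snd p \<in> J c")
      case True
      have "smooth_on (?E \<times> J c) (\<lambda>p. \<xi> c (snd p))"
        by (rule smooth_on_compose[OF x_chart(3)[OF c] fs(2)]) auto
      moreover have "smooth_on (?E \<times> J c) (\<lambda>p. \<phi> (snd p))"
        by (rule smooth_on_compose[OF \<phi>(1) fs(2)]) auto
      ultimately have "smooth_on (?E \<times> J c) w" unfolding w_def
        by (intro smooth_on_add smooth_on_scaleR smooth_on_mult smooth_on_const fs(1))
      then have "smooth_into S A (?E \<times> J c) (\<lambda>p. cinv c (w p))"
        using w_in by (intro smooth_into_cinv[OF c]) auto
      moreover have "openin (top_of_set (?E \<times> I)) (?E \<times> J c)"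
        by (intro openin_Times x_chart(1)[OF c]) simp
      moreover have "p \<in> ?E \<times> J c" using p True by (cases p) auto
      moreover have "\<forall>y\<in>?E \<times> J c. H y = cinv c (w y)" by (auto simp: H_def)
      ultimately show ?thesis by blast
    next
      case False
      let ?N = "?E \<times> (I \<inter> - {l..r})"
      have "smooth_into S A ?N (\<lambda>p. x (snd p))"
        by (rule smooth_into_compose[OF x_smooth fs(2)]) auto
      moreover have "openin (top_of_set (?E \<times> I)) ?N"
        by (intro openin_Times openin_open_Int) auto
      moreover have "p \<in> ?N" using p False lr(2) by (cases p) auto
      moreover have "\<forall>y\<in>?N. H y = x (snd y)" using H_off \<phi>_off by auto
      ultimately show ?thesis by blast
    qed
  qed
  moreover have "\<phi> a = 0" "\<phi> b = 0" using \<phi>(2) al by auto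
  ultimately have "fixed_end_variation S A a b x \<delta> H"
    unfolding fixed_end_variation_def using \<delta> H_off I by auto
  moreover have "vector_derivative (\<lambda>\<epsilon>. cmap c (H (\<epsilon>, s))) (at 0 within ?E) = \<phi> s *\<^sub>R z"
    if s: "s \<in> J c" for s
  proof -
    have d: "((\<lambda>\<epsilon>. \<xi> c s + (\<epsilon> * \<phi> s) *\<^sub>R z) has_vector_derivative \<phi> s *\<^sub>R z) (at 0 within ?E)"
      by (auto intro!: derivative_eq_intros)
    have "((\<lambda>\<epsilon>. cmap c (H (\<epsilon>, s))) has_vector_derivative \<phi> s *\<^sub>R z) (at 0 within ?E)"
    proof (rule has_vector_derivative_transform[OF _ _ d])
      show "0 \<in> ?E" using \<delta> by simp
      show "cmap c (H (\<epsilon>, s)) = \<xi> c s + (\<epsilon> * \<phi> s) *\<^sub>R z" if "\<epsilon> \<in> ?E" for \<epsilon>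
      proof -
        have "H (\<epsilon>, s) = cinv c (w (\<epsilon>, s))" using s by (simp add: H_def)
        then show ?thesis using cmap_cinv[OF w_in[OF that s]] by (simp add: w_def)
      qed
    qed
    moreover have "at 0 within ?E \<noteq> bot" using \<delta> by (simp add: at_within_open[of 0 ?E])
    ultimately show ?thesis by (intro vector_derivative_within)
  qed
  moreover have "vector_derivative (\<lambda>\<epsilon>. cmap d (H (\<epsilon>, s))) (at 0 within ?E) = 0"
    if "s \<in> I - {l..r}" for s and d :: "('a, 'e) chart"
  proof -
    have "(\<lambda>\<epsilon>. cmap d (H (\<epsilon>, s))) = (\<lambda>\<epsilon>. cmap d (x s))" using H_off \<phi>_off that by auto
    moreover have "at 0 within ?E \<noteq> bot" using \<delta> by (simp add: at_within_open[of 0 ?E])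
    ultimately show ?thesis
      using vector_derivative_within[OF _ has_vector_derivative_const] by simp
  qed
  ultimately show thesis using that by blast
qed

text \<open>The fundamental lemma of the calculus of variations, with a bump supported where the
  residual has one sign.\<close>

lemma res_if_energy_critical:
  assumes "\<forall>s\<in>I. F (velocity A I x s) = 1" and crit: "energy_critical S A F a b x"
    and c: "c \<in> A" and s0: "s0 \<in> J c"
  shows "resC c (\<xi> c s0) (\<nu> c s0) (acc c s0) z0 = 0"
proof (rule ccontr)
  have unit: "\<And>s. s \<in> I \<Longrightarrow> F (velocity A I x s) = 1" using assms(1) by blast
  interpret M: fermat_model "cimage c" "bC c" "wC c" "gC c" \<sigma> by (rule chart_model[OF c])
  define R where "R z s = resC c (\<xi> c s) (\<nu> c s) (acc c s) z" for z s
  assume "resC c (\<xi> c s0) (\<nu> c s0) (acc c s0) z0 \<noteq> 0"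
  \<comment> \<open>Replacing z0 by -z0 flips the sign, so the residual may be assumed
    positive.\<close>
  then have "R z0 s0 > 0 \<or> R (- 1 *\<^sub>R z0) s0 > 0"
    unfolding R_def M.res_scale[OF \<xi>_in[OF s0]] by auto
  then obtain z where z: "R z s0 > 0" by blast
  have "smooth_on (J c) (R z)" unfolding R_def
    using x_chart(11)[OF c] by (intro M.res_along_smooth x_chart(3-5)[OF c]) simp
  then have R_cont: "continuous_on (J c) (R z)" by (rule smooth_on_imp_continuous_on)
  have "openin (top_of_set (J c)) (J c \<inter> R z -` {0<..})"
    by (rule continuous_openin_preimage_gen[OF R_cont open_greaterThan])
  then have "openin (top_of_set I) (J c \<inter> R z -` {0<..})"
    by (rule openin_trans[OF _ x_chart(1)[OF c]])
  \<comment> \<open>From here on the midpoint of this interval takes over from s0; it is an interior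
    point even if s0 is an end of I.\<close>
  then obtain l r where lr: "l < r" "{l..r} \<subseteq> J c \<inter> R z -` {0<..}"
    unfolding I using s0 z I by (elim openin_Icc_subinterval[OF ab]) auto
  have lrJ: "{l..r} \<subseteq> J c" using lr(2) by blast
  then have lrI: "{l..r} \<subseteq> I" by blast
  have D_pos: "speed_defect I x s > 0" if "s \<in> I" for s
    using speed_defect_pos[OF that unit[OF that]] .
  from smooth_bump[of l r] obtain \<phi> :: "real \<Rightarrow> real" where "smooth_on UNIV \<phi> \<and> (\<forall>s. l < s \<and> s < r \<longrightarrow> \<phi> s > 0) \<and>
    (\<forall>s. s \<le> l \<or> r \<le> s \<longrightarrow> \<phi> s = 0)" ..
  then have \<phi>: "smooth_on UNIV \<phi>" "\<And>s. l < s \<Longrightarrow> s < r \<Longrightarrow> \<phi> s > 0"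
    "\<And>s. s \<le> l \<or> r \<le> s \<Longrightarrow> \<phi> s = 0" by blast+
  obtain \<delta> H where H: "fixed_end_variation S A a b x \<delta> H"
    and U: "\<And>s. s \<in> J c \<Longrightarrow>
      vector_derivative (\<lambda>\<epsilon>. cmap c (H (\<epsilon>, s))) (at 0 within {- \<delta><..<\<delta>}) = \<phi> s *\<^sub>R z"
    and U0: "\<And>s (d :: ('a, 'e) chart). s \<in> I - {l..r} \<Longrightarrow>
      vector_derivative (\<lambda>\<epsilon>. cmap d (H (\<epsilon>, s))) (at 0 within {- \<delta><..<\<delta>}) = 0"
    by (rule bump_variation[OF c lr(1) lrJ \<phi>(1,3)]) (assumption, rule that)
  obtain \<psi> where \<psi>: "((\<lambda>\<epsilon>. finsler_energy A F a b (\<lambda>s. H (\<epsilon>, s))) has_real_derivative 2 * integral I \<psi>) (at 0)"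
    "\<And>c s. c \<in> A \<Longrightarrow> s \<in> J c \<Longrightarrow> \<psi> s = resC c (\<xi> c s) (\<nu> c s) (acc c s)
      (vector_derivative (\<lambda>\<epsilon>. cmap c (H (\<epsilon>, s))) (at 0 within {- \<delta><..<\<delta>})) / (speed_defect I x s)\<^sup>2"
    by (rule first_variation[OF H unit]) (assumption, rule that)
  have "((\<lambda>\<epsilon>. finsler_energy A F a b (\<lambda>s. H (\<epsilon>, s))) has_real_derivative 0) (at 0)"
    using crit H unfolding energy_critical_def by blast
  from DERIV_unique[OF \<psi>(1) this] have int0: "integral I \<psi> = 0" by simp
  have on: "\<psi> s = \<phi> s * R z s / (speed_defect I x s)\<^sup>2" if s: "s \<in> {l..r}" for s
  proof -
    have sJ: "s \<in> J c" using s lrJ by blast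
    show ?thesis unfolding \<psi>(2)[OF c sJ] U[OF sJ] M.res_scale[OF \<xi>_in[OF sJ]] R_def ..
  qed
  \<comment> \<open>Off the support, \<psi> is read in any chart around the point: the variation
    field is 0 there, and the residual is homogeneous in it.\<close>
  have off: "\<psi> s = 0" if s: "s \<in> I - {l..r}" for s
  proof -
    obtain d where d: "d \<in> A" "s \<in> J d" using chart_exists s by blast
    have "resC d (\<xi> d s) (\<nu> d s) (acc d s) (0 *\<^sub>R 0) = 0"
      unfolding fermat_model.res_scale[OF chart_model[OF d(1)] \<xi>_in[OF d(2)]] by simp
    then show ?thesis unfolding \<psi>(2)[OF d] U0[OF s] by simp
  qed
  have "integral I \<psi> = integral I (\<lambda>s. if s \<in> {l..r} then \<phi> s * R z s / (speed_defect I x s)\<^sup>2 else 0)"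
    by (rule integral_cong) (simp add: on off del: atLeastAtMost_iff)
  also have "\<dots> = integral {l..r} (\<lambda>s. \<phi> s * R z s / (speed_defect I x s)\<^sup>2)"
    unfolding Henstock_Kurzweil_Integration.integral_restrict_Int Int_absorb2[OF lrI] ..
  finally have "integral {l..r} (\<lambda>s. \<phi> s * R z s / (speed_defect I x s)\<^sup>2) = 0" using int0 by simp
  moreover have "continuous_on {l..r} (\<lambda>s. \<phi> s * R z s / (speed_defect I x s)\<^sup>2)"
  proof (intro continuous_on_divide continuous_on_mult continuous_on_power)
    show "continuous_on {l..r} \<phi>"
      by (rule continuous_on_subset[OF smooth_on_imp_continuous_on[OF \<phi>(1)]]) simp
    show "continuous_on {l..r} (R z)" by (rule continuous_on_subset[OF R_cont lrJ])
    show "continuous_on {l..r} (speed_defect I x)"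
      by (rule continuous_on_subset[OF smooth_on_imp_continuous_on[OF speed_defect_smooth] lrI])
    show "\<forall>s\<in>{l..r}. (speed_defect I x s)\<^sup>2 \<noteq> 0" using D_pos lrI by fastforce
  qed
  moreover have "\<phi> s * R z s / (speed_defect I x s)\<^sup>2 \<ge> 0" if s: "s \<in> {l..r}" for s
  proof -
    have "\<phi> s \<ge> 0" using \<phi>(2,3)[of s] by (cases "l < s \<and> s < r") (auto simp: not_less)
    moreover have "R z s > 0" using s lr(2) by blast
    ultimately show ?thesis by simp
  qed
  ultimately have zero: "\<phi> s * R z s / (speed_defect I x s)\<^sup>2 = 0" if "s \<in> {l..r}" for s
    using integral_eq_0_iff[OF _ lr(1)] that by blast
  define m where "m = (l + r) / 2"
  have m: "m \<in> {l..r}" "l < m" "m < r" using lr(1) by (auto simp: m_def)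
  have "R z m > 0" using m(1) lr(2) by blast
  moreover have "\<phi> m > 0" using \<phi>(2) m by blast
  moreover have "speed_defect I x m > 0" using D_pos m(1) lrI by blast
  ultimately have "\<phi> m * R z m / (speed_defect I x m)\<^sup>2 > 0" by simp
  then show False using zero[OF m(1)] by linarith
qed

end

section \<open>Reparametrization and the main theorem\<close>

text \<open>The difference quotient of h at y is the reciprocal of that of f at h(y), and continuity
  of h makes its increments tend to 0. Working within X and Y covers endpoints of intervals.\<close>

lemma inverse_derivative_within:
  fixes f h :: "real \<Rightarrow> real"
  assumes f: "(f has_real_derivative D) (at (h y) within X)" "D \<noteq> 0" and y: "y \<in> Y"
    and h: "continuous_on Y h" "\<And>z. z \<in> Y \<Longrightarrow> h z \<in> X \<and> f (h z) = z"
  shows "(h has_real_derivative inverse D) (at y within Y)"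
proof -
  have ev: "\<forall>\<^sub>F z in at y within Y. h z \<in> X \<and> h z \<noteq> h y \<and> f (h z) = z"
  proof -
    have "h z \<in> X \<and> h z \<noteq> h y \<and> f (h z) = z" if "z \<in> Y" "z \<noteq> y" for z
      using h(2)[OF that(1)] h(2)[OF y] that(2) by metis
    then show ?thesis by (auto simp: eventually_at_filter)
  qed
  have "(h \<longlongrightarrow> h y) (at y within Y)" using h(1) y by (simp add: continuous_on_def)
  then have lim: "filterlim h (at (h y) within X) (at y within Y)"
    using ev by (auto simp: filterlim_at elim: eventually_mono)
  have "((\<lambda>t. (f t - f (h y)) / (t - h y)) \<longlongrightarrow> D) (at (h y) within X)"
    using f(1) by (simp add: has_field_derivative_iff)
  from tendsto_inverse[OF filterlim_compose[OF this lim] f(2)]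
  have "((\<lambda>z. inverse ((f (h z) - f (h y)) / (h z - h y))) \<longlongrightarrow> inverse D) (at y within Y)" .
  then have "((\<lambda>z. (h z - h y) / (z - y)) \<longlongrightarrow> inverse D) (at y within Y)"
  proof (rule Lim_transform_eventually)
    show "\<forall>\<^sub>F z in at y within Y. inverse ((f (h z) - f (h y)) / (h z - h y)) = (h z - h y) / (z - y)"
      using ev by (rule eventually_mono) (simp add: h(2)[OF y])
  qed
  then show ?thesis by (simp add: has_field_derivative_iff)
qed

text \<open>Separation of variables: h is the inverse of the primitive f of D starting at a, and L =
  f(b). Then h' D(h) = 1, the conservation law with its constant normalised.\<close>

lemma reparametrization_ode:
  fixes D :: "real \<Rightarrow> real"
  assumes "a < b" and D: "continuous_on {a..b} D" "\<And>t. t \<in> {a..b} \<Longrightarrow> D t > 0"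
  obtains L h where "0 < L" "bij_betw h {0..L} {a..b}"
    "\<And>s. s \<in> {0..L} \<Longrightarrow> (h has_real_derivative inverse (D (h s))) (at s within {0..L})"
proof -
  define f where "f t = integral {a..t} D" for t
  have df: "(f has_real_derivative D t) (at t within {a..b})" if "t \<in> {a..b}" for t
    unfolding f_def has_real_derivative_iff_has_vector_derivative
    by (rule integral_has_vector_derivative[OF D(1) that])
  have f_cont: "continuous_on {a..b} f" by (rule DERIV_continuous_on[OF df])
  have f_less: "f t < f t'" if "a \<le> t" "t < t'" "t' \<le> b" for t t'
  proof (rule DERIV_pos_imp_increasing_open[OF \<open>t < t'\<close>])
    show "\<exists>y. (f has_real_derivative y) (at z) \<and> 0 < y" if z: "t < z" "z < t'" for z
    proof -
      have ab: "a < z" "z < b" using z \<open>a \<le> t\<close> \<open>t' \<le> b\<close> by auto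
      then have "(f has_real_derivative D z) (at z)"
        using df[of z] at_within_Icc_at[of a z b] by simp
      then show ?thesis using D(2)[of z] ab by auto
    qed
    show "continuous_on {t..t'} f" using that by (intro continuous_on_subset[OF f_cont]) auto
  qed
  have inj: "inj_on f {a..b}"
  proof (rule inj_onI)
    fix t t' assume "t \<in> {a..b}" "t' \<in> {a..b}" "f t = f t'"
    then show "t = t'" using f_less[of t t'] f_less[of t' t] by (cases t t' rule: linorder_cases) auto
  qed
  have fa: "f a = 0" by (simp add: f_def)
  have img: "f ` {a..b} = {0..f b}"
  proof
    show "f ` {a..b} \<subseteq> {0..f b}"
    proof
      fix y assume "y \<in> f ` {a..b}"
      then obtain t where t: "t \<in> {a..b}" "y = f t" by blast
      then show "y \<in> {0..f b}"
        using f_less[of a t] f_less[of t b] fa by (cases "a = t"; cases "t = b") auto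
    qed
    show "{0..f b} \<subseteq> f ` {a..b}"
    proof
      fix y assume "y \<in> {0..f b}"
      then obtain t where "a \<le> t" "t \<le> b" "f t = y"
        using IVT'[of f a y b] fa f_cont \<open>a < b\<close> by auto
      then show "y \<in> f ` {a..b}" by auto
    qed
  qed
  define h where "h = inv_into {a..b} f"
  have hf: "h (f t) = t" if "t \<in> {a..b}" for t unfolding h_def by (rule inv_into_f_f[OF inj that])
  have h_cont: "continuous_on {0..f b} h"
    using continuous_on_inv[OF f_cont compact_Icc, of h] hf unfolding img by blast
  have hX: "h z \<in> {a..b} \<and> f (h z) = z" if "z \<in> {0..f b}" for z
    using that unfolding h_def img[symmetric] by (simp add: inv_into_into f_inv_into_f del: atLeastAtMost_iff)
  show thesis
  proof
    show "0 < f b" using f_less[of a b] fa \<open>a < b\<close> by simp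
    show "bij_betw h {0..f b} {a..b}"
      unfolding h_def img[symmetric] by (rule inj_on_imp_bij_betw[OF inj, THEN bij_betw_inv_into])
    show "(h has_real_derivative inverse (D (h s))) (at s within {0..f b})" if s: "s \<in> {0..f b}" for s
    proof (rule inverse_derivative_within[OF df _ s h_cont hX])
      show "h s \<in> {a..b}" using hX[OF s] by blast
      then show "D (h s) \<noteq> 0" using D(2) by fastforce
    qed
  qed
qed

context fermat_curve
begin

text \<open>A geodesic parametrization makes the residual vanish at every value of h, and h is onto.
  Conversely, once the residual vanishes only the conservation law is left, and a suitable h solves
  it.\<close>

lemma pregeodesic_iff_res:
  assumes unit: "\<forall>s\<in>I. F (velocity A I x s) = 1"
  shows "pregeodesic (metric_geodesic (line_product S) LA g) a b (\<lambda>t. (k + \<sigma> * t, x t)) \<longleftrightarrow>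
    (\<forall>c\<in>A. \<forall>s\<in>J c. \<forall>z. resC c (\<xi> c s) (\<nu> c s) (acc c s) z = 0)"
proof
  have D_pos: "\<forall>s\<in>I. speed_defect I x s > 0" using speed_defect_pos unit by blast
  {
    assume "pregeodesic (metric_geodesic (line_product S) LA g) a b (\<lambda>t. (k + \<sigma> * t, x t))"
    then obtain a' b' h where h: "a' < b'" "bij_betw h {a'..b'} {a..b}" "smooth_on {a'..b'} h"
      "\<forall>s\<in>{a'..b'}. vector_derivative h (at s within {a'..b'}) \<noteq> 0"
      and geo: "metric_geodesic (line_product S) LA g a' b' ((\<lambda>t. (k + \<sigma> * t, x t)) \<circ> h)"
      unfolding pregeodesic_def by blast
    have img: "h ` {a'..b'} = I" using h(2) unfolding bij_betw_def I by blast
    show "\<forall>c\<in>A. \<forall>s\<in>J c. \<forall>z. resC c (\<xi> c s) (\<nu> c s) (acc c s) z = 0"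
    proof (intro ballI allI)
      fix c s z assume c: "c \<in> A" and s: "s \<in> J c"
      obtain s' where s': "s' \<in> {a'..b'}" "s = h s'" using s img by blast
      have "x (h s') \<in> cdom c" using s s'(2) by simp
      then show "resC c (\<xi> c s) (\<nu> c s) (acc c s) z = 0"
        using geo c s'
        unfolding reparametrized_geodesic_iff[OF h(1) refl h(3) equalityD1[OF img] h(4) D_pos]
        by blast
    qed
  next
    assume res: "\<forall>c\<in>A. \<forall>s\<in>J c. \<forall>z. resC c (\<xi> c s) (\<nu> c s) (acc c s) z = 0"
    have "continuous_on {a..b} (speed_defect I x)"
      using smooth_on_imp_continuous_on[OF speed_defect_smooth] unfolding I .
    then obtain L h where L: "0 < L" and bij: "bij_betw h {0..L} {a..b}"
      and dh: "\<And>s. s \<in> {0..L} \<Longrightarrow>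
        (h has_real_derivative inverse (speed_defect I x (h s))) (at s within {0..L})"
      by (rule reparametrization_ode[OF ab]) (use D_pos I in blast)+
    have img: "h ` {0..L} = I" using bij unfolding bij_betw_def I by blast
    have sp: "spread {0..L}" by (rule spread_Icc[OF L])
    have "smooth_on I (\<lambda>t. 1 / speed_defect I x t)"
      by (intro smooth_on_divide smooth_on_const speed_defect_smooth) (use D_pos in blast)
    then have "smooth_on I (\<lambda>t. inverse (speed_defect I x t))" by (simp add: inverse_eq_divide)
    \<comment> \<open>The equation provides the first derivative of h; smoothness of 1 / D then
      provides all higher ones.\<close>
    then have h_smooth: "smooth_on {0..L} h"
      using dh img
      by (intro smooth_on_autonomous[of "{0..L}" h "\<lambda>t. inverse (speed_defect I x t)" I])
        (auto simp: has_real_derivative_iff_has_vector_derivative)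
    have h': "vector_derivative h (at s within {0..L}) = inverse (speed_defect I x (h s))"
      if s: "s \<in> {0..L}" for s
      using dh[OF s] unfolding has_real_derivative_iff_has_vector_derivative
      by (rule vector_derivative_within[OF spread_real_at_within[OF sp s]])
    have nz: "\<forall>s\<in>{0..L}. vector_derivative h (at s within {0..L}) \<noteq> 0"
    proof
      fix s assume s: "s \<in> {0..L}"
      have "speed_defect I x (h s) > 0" using D_pos img s by blast
      then show "vector_derivative h (at s within {0..L}) \<noteq> 0" unfolding h'[OF s] by simp
    qed
    have "metric_geodesic (line_product S) LA g 0 L ((\<lambda>t. (k + \<sigma> * t, x t)) \<circ> h)"
      unfolding reparametrized_geodesic_iff[OF L refl h_smooth equalityD1[OF img] nz D_pos]
    proof (intro ballI impI conjI allI)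
      fix c s assume c: "c \<in> A" and s: "s \<in> {0..L}" and xh: "x (h s) \<in> cdom c"
      have hs: "h s \<in> J c" using img s xh by blast
      show "resC c (\<xi> c (h s)) (\<nu> c (h s)) (acc c (h s)) z = 0" for z using res c hs by blast
      let ?D = "speed_defect I x (h s)" and ?Dd = "DdotC c (\<xi> c (h s)) (\<nu> c (h s)) (acc c (h s))"
      have pos: "?D > 0" using D_pos img s by blast
      have "(speed_defect I x has_real_derivative ?Dd) (at (h s) within h ` {0..L})"
        unfolding img by (rule speed_defect_derivative[OF c hs])
      from DERIV_image_chain[OF this dh[OF s]]
      have "((\<lambda>s. speed_defect I x (h s)) has_real_derivative ?Dd * inverse ?D) (at s within {0..L})"
        unfolding comp_def .
      from DERIV_inverse_fun[OF this] pos
      have d: "((\<lambda>s. inverse (speed_defect I x (h s))) has_real_derivative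
          - (?Dd * inverse ?D * inverse (?D\<^sup>2))) (at s within {0..L})"
        by (simp add: numeral_2_eq_2)
      have "((\<lambda>s. vector_derivative h (at s within {0..L})) has_vector_derivative
          - (?Dd * inverse ?D * inverse (?D\<^sup>2))) (at s within {0..L})"
        by (rule has_vector_derivative_transform[OF s h'
              d[unfolded has_real_derivative_iff_has_vector_derivative]])
      \<comment> \<open>With h' = 1 / D this is -D' / D^3, so that h'' D and h'^2 D' cancel.\<close>
      then have h'': "vector_derivative (\<lambda>s. vector_derivative h (at s within {0..L})) (at s within {0..L})
          = - (?Dd * inverse ?D * inverse (?D\<^sup>2))"
        by (rule vector_derivative_within[OF spread_real_at_within[OF sp s]])
      show "vector_derivative (\<lambda>s. vector_derivative h (at s within {0..L})) (at s within {0..L})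
            * DC c (\<xi> c (h s)) (\<nu> c (h s))
          + vector_derivative h (at s within {0..L}) * vector_derivative h (at s within {0..L}) * ?Dd = 0"
        unfolding h'' h'[OF s] speed_defect_chart[OF c hs, symmetric]
        using pos by (simp add: field_simps power2_eq_square)
    qed
    then show "pregeodesic (metric_geodesic (line_product S) LA g) a b (\<lambda>t. (k + \<sigma> * t, x t))"
      unfolding pregeodesic_def using L bij h_smooth nz by blast
  }
qed

end

section \<open>Lightlike pregeodesics against unit speed geodesics\<close>

context fermat_spacetime
begin

lemma lightlike_pregeodesic_iff:
  fixes k :: real and x :: "real \<Rightarrow> 'a"
  defines "\<gamma> \<equiv> \<lambda>t. (k + \<sigma> * t, x t)"
  shows "lightlike_pregeodesic S A g a b \<gamma> \<and>
      (\<forall>s\<in>{a..b}. \<sigma> * g (velocity LA {a..b} \<gamma> s) (time_field A (\<gamma> s)) < 0)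
    \<longleftrightarrow> unit_speed_geodesic S A F a b x"
proof (cases "a < b \<and> smooth_into S A {a..b} x")
  case True
  interpret C: fermat_curve S A \<beta> \<omega> g\<^sub>0 \<sigma> F a b x "{a..b}"
    using True by unfold_locales auto
  have "smooth_on {a..b} (\<lambda>t. k + \<sigma> * t)"
    by (intro smooth_on_add smooth_on_mult smooth_on_const smooth_on_linear bounded_linear_ident)
  from smooth_into_line_product[OF this, of x] True
  have sm: "smooth_into (line_product S) LA {a..b} \<gamma>" by (simp add: \<gamma>_def)
  have unit: "(\<forall>s\<in>{a..b}. F (velocity A {a..b} x s) = 1) \<longleftrightarrow>
      lightlike_curve LA g a b \<gamma> \<and>
      (\<forall>s\<in>{a..b}. \<sigma> * g (velocity LA {a..b} \<gamma> s) (time_field A (\<gamma> s)) < 0)"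
    using C.unit_speed_iff(1)[of _ k] unfolding lightlike_curve_def Let_def \<gamma>_def by blast
  have "pregeodesic (metric_geodesic (line_product S) LA g) a b \<gamma> \<longleftrightarrow> energy_critical S A F a b x"
    if u: "\<forall>s\<in>{a..b}. F (velocity A {a..b} x s) = 1"
    unfolding \<gamma>_def C.pregeodesic_iff_res[OF u]
    using C.energy_critical_if_res[OF u] C.res_if_energy_critical[OF u] by blast
  then show ?thesis
    unfolding lightlike_pregeodesic_def unit_speed_geodesic_def finsler_geodesic_def
    using sm True unit by blast
next
  case False
  \<comment> \<open>Degenerate data: the spacetime curve is smooth iff x is, so both sides
    fail.\<close>
  have "smooth_on {a..b} (\<lambda>t. k + \<sigma> * t)"
    by (intro smooth_on_add smooth_on_mult smooth_on_const smooth_on_linear bounded_linear_ident)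
  from smooth_into_line_product[OF this, of x]
  show ?thesis
    using False unfolding lightlike_pregeodesic_def unit_speed_geodesic_def finsler_geodesic_def \<gamma>_def
    by blast
qed

text \<open>Passes to the form of the pointing predicates: their first two clauses already follow
  from being lightlike, and \<sigma> = -1 reverses the inequality for the past.\<close>

lemma time_orientation_iff:
  fixes k :: real and x :: "real \<Rightarrow> 'a"
  defines "\<gamma> \<equiv> \<lambda>t. (k + \<sigma> * t, x t)"
  assumes "lightlike_pregeodesic S A g a b \<gamma>"
  shows "(\<forall>s\<in>{a..b}. \<sigma> * g (velocity LA {a..b} \<gamma> s) (time_field A (\<gamma> s)) < 0) \<longleftrightarrow>
    (\<forall>s\<in>{a..b}. let V = velocity LA {a..b} \<gamma> s in
      V \<noteq> tzero (fst V) \<and> g V V \<le> 0 \<and> \<sigma> * g V (time_field A (fst V)) < 0)"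
  using assms(2) unfolding lightlike_pregeodesic_def lightlike_curve_def Let_def
  by (auto simp: velocity_def[of LA _ \<gamma>])

end

lemma unit_speed_geodesic_length:
  assumes "unit_speed_geodesic S A F a b x"
  shows "finsler_length A F a b x = b - a"
proof -
  have "finsler_length A F a b x = integral {a..b} (\<lambda>s. 1)"
    unfolding finsler_length_def using assms
    by (intro integral_cong) (simp add: unit_speed_geodesic_def)
  then show ?thesis
    using assms by (simp add: unit_speed_geodesic_def finsler_geodesic_def)
qed

theorem proposition4p1:
  fixes S :: "'a topology"
    and A :: "('a, 'e::euclidean_space) chart set"
    and \<beta> :: "'a \<Rightarrow> real"
    and \<omega> :: "('a, 'e) tvec \<Rightarrow> real"
    and g\<^sub>0 :: "('a, 'e) tvec \<Rightarrow> ('a, 'e) tvec \<Rightarrow> real"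
    and t0 :: real and x0 x1 :: 'a
  assumes "smooth_manifold S A"
    and "connected_space S"
    and "riemannian_metric A g\<^sub>0"
    and "smooth_one_form A \<omega>"
    and "smooth_function A \<beta>"
    and "\<forall>p\<in>topspace S. \<beta> p > 0"
    and "x0 \<in> topspace S"
    and "x1 \<in> topspace S"
  shows
    "let g = stationary_metric A \<beta> \<omega> g\<^sub>0;
         F = fermat_metric \<beta> \<omega> g\<^sub>0;
         F' = reverse_metric F
     in
      (\<forall>t1 x.
         let \<gamma> = (\<lambda>t. (t, x t));
             P = (future_lightlike_pregeodesic S A g t0 t1 \<gamma> \<and>
                  \<gamma> t0 = (t0, x0) \<and> \<gamma> t1 \<in> time_line x1);
             Q = (unit_speed_geodesic S A F t0 t1 x \<and> x t0 = x0 \<and> x t1 = x1)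
         in (P \<longleftrightarrow> Q) \<and> (P \<longrightarrow> t1 - t0 = finsler_length A F t0 t1 x)) \<and>
      (\<forall>t1 x.
         let \<gamma> = (\<lambda>t. (2 * t0 - t, x t));
             P = (past_lightlike_pregeodesic S A g t0 (2 * t0 - t1) \<gamma> \<and>
                  \<gamma> t0 = (t0, x0) \<and> \<gamma> (2 * t0 - t1) \<in> time_line x1);
             Q = (unit_speed_geodesic S A F' t0 (2 * t0 - t1) x \<and>
                  x t0 = x0 \<and> x (2 * t0 - t1) = x1)
         in (P \<longleftrightarrow> Q) \<and> (P \<longrightarrow> t0 - t1 = finsler_length A F' t0 (2 * t0 - t1) x))"
proof -
  let ?g = "stationary_metric A \<beta> \<omega> g\<^sub>0" and ?F = "fermat_metric \<beta> \<omega> g\<^sub>0"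
  let ?F' = "reverse_metric ?F"
  interpret mf: smooth_mfd S A by unfold_locales (rule assms(1))
  interpret fut: fermat_spacetime S A \<beta> \<omega> g\<^sub>0 1 ?F
  proof
    show "?F (coord_vec A c p v) = 1 * \<omega> (coord_vec A c p v) / \<beta> p +
        sqrt (g\<^sub>0 (coord_vec A c p v) (coord_vec A c p v) / \<beta> p + (\<omega> (coord_vec A c p v))\<^sup>2 / (\<beta> p)\<^sup>2)"
      for c p v by (simp add: fermat_metric_def)
  qed (use assms in auto)
  interpret pas: fermat_spacetime S A \<beta> \<omega> g\<^sub>0 "-1" ?F'
  proof
    fix c p v assume c: "c \<in> A" and p: "p \<in> cdom c"
    \<comment> \<open>By linearity of the transition maps, reversal acts on components as v to -v.
      This changes the sign of \<omega> and leaves both terms under the root unchanged.\<close>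
    have neg: "tneg (coord_vec A c p v) = coord_vec A c p (- v)"
      using mf.coord_vec_scale[OF c p, of "-1" v] by (simp add: tneg_def)
    interpret M: fermat_model "cimage c" "fut.bC c" "fut.wC c" "fut.gC c" 1
      by (rule fut.chart_model[OF c])
    have q: "cmap c p \<in> cimage c" using p by simp
    show "?F' (coord_vec A c p v) = - 1 * \<omega> (coord_vec A c p v) / \<beta> p +
        sqrt (g\<^sub>0 (coord_vec A c p v) (coord_vec A c p v) / \<beta> p + (\<omega> (coord_vec A c p v))\<^sup>2 / (\<beta> p)\<^sup>2)"
      unfolding reverse_metric_def neg fermat_metric_def fst_coord_vec fut.coord_forms[OF c p]
        linear_neg[OF M.w_linear[OF q]] linear_neg[OF M.g_linear[OF q]] linear_neg[OF M.g_linear1[OF q]]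
      by simp
  qed (use assms in auto)
  have fut_iff: "future_lightlike_pregeodesic S A ?g t0 t1 (\<lambda>t. (t, x t)) \<longleftrightarrow>
      unit_speed_geodesic S A ?F t0 t1 x" for t1 x
    unfolding fut.lightlike_pregeodesic_iff[of t0 t1 0 x, symmetric] future_lightlike_pregeodesic_def
      future_pointing_def
    using fut.time_orientation_iff[of t0 t1 0 x] by (simp add: Let_def) blast
  \<comment> \<open>The shift 2 t0 with \<sigma> = -1 gives (2 t0 - t, x(t)): the curve parameter
    still increases while the time coordinate falls.\<close>
  have pas_iff: "past_lightlike_pregeodesic S A ?g t0 b (\<lambda>t. (2 * t0 - t, x t)) \<longleftrightarrow>
      unit_speed_geodesic S A ?F' t0 b x" for b x
    unfolding pas.lightlike_pregeodesic_iff[of t0 b "2 * t0" x, symmetric] past_lightlike_pregeodesic_def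
      past_pointing_def
    using pas.time_orientation_iff[of t0 b "2 * t0" x] by (simp add: Let_def) blast
  have line: "(t, p) \<in> time_line q \<longleftrightarrow> p = q" for t :: real and p q :: 'a
    by (auto simp: time_line_def)
  show ?thesis
    unfolding Let_def fut_iff pas_iff line
    using unit_speed_geodesic_length by fastforce
qed

end
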